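(* Let $\mathbf H_{\mathcal{LRF}}$ be the $\mathbb Q$-vector space of finitely supported functions $f:I(\mathcal{LRF})\to\mathbb Q$ on the set of isomorphism classes of labeled rooted forests (including the empty forest), with product $$(f\times g)(F)=\sum_{G\subset F}f(G)\,g(F/G)$$ (sum over all subforests $G$ of $F$) and coproduct $$\Delta:\mathbf H_{\mathcal{LRF}}\to\mathbf H_{\mathcal{LRF}}\otimes\mathbf H_{\mathcal{LRF}},\qquad \Delta(f)(F,G)=f(F\oplus G).$$ Then $\mathbf H_{\mathcal{LRF}}$ is a co-commutative Hopf algebra isomorphic to $\mathcal U(\mathfrak n_T)$, the universal enveloping algebra of the Connes-Kreimer Lie algebra $\mathfrak n_T$ on rooted trees.
   Context: A rooted tree is a finite one-dimensional contractible simplicial complex $T$ (non-empty, non-planar) with a distinguished vertex, the root; $V(T)$, $E(T)$ are its vertices and edges. $\mathbb T$ denotes the set of (isomorphism classes of) unlabeled rooted trees. A labeled rooted tree is a rooted tree with a bijection from a subset of $\mathbb N$ to $V(T)$. A labeled rooted forest is a finite set $F=\{T_1,\dots,T_n\}$ of labeled rooted trees with pairwise disjoint label sets; the empty forest $\emptyset$ is allowed, and empty trees occurring in a forest are discarded. An isomorphism of labeled trees is a root- and incidence-preserving bijection of vertices (labels need not be preserved), and an isomorphism of forests is a bijection of vertex sets matching the trees bijectively and restricting to isomorphisms of the matched trees. $F\oplus G$ is the disjoint union of forests (after relabeling if necessary; well defined up to isomorphism). An admissible cut of a tree $T$ is a subset $C\subset E(T)$ such that at most one member of $C$ lies on any path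 joining a leaf to the root. Removing the edges of $C$ gives the rooted tree $R_C(T)$, the component containing the root, and the forest $P_C(T)$ of the other components (each rooted at its vertex closest to the root of $T$). The null cut $C_{null}=\emptyset$ has $(P,R)=(\emptyset,T)$; one also allows a formal full cut $C_{full}$ with $(P,R)=(T,\emptyset)$. An admissible cut $C$ of a forest $F=\{T_1,\dots,T_n\}$ is a tuple of admissible cuts $C_i$ of the $T_i$, with $P_C(F)$ the union of the forests $P_{C_i}(T_i)$ and $R_C(F)$ the forest of the $R_{C_i}(T_i)$. A subforest $G\subset F$ is a forest $G=P_C(F)$ for an admissible cut $C$ of $F$, and then $F/G:=R_C(F)$; in the product the sum runs over actual subforests of a representative $F$ (one for each admissible cut), and functions are evaluated on isomorphism classes. $\mathbf H_{\mathcal{LRF}}\otimes\mathbf H_{\mathcal{LRF}}$ is identified with the finitely supported functions on $I(\mathcal{LRF})\times I(\mathcal{LRF})$. The unit is the characteristic function of the class of $\emptyset$ and the counit is $f\mapsto f(\emptyset)$. "Isomorphic" means isomorphic as Hopf algebras, $\mathcal U(\mathfrak n_T)$ carrying its standard Hopf algebra structure. Connes-Kreimer Lie algebra on rooted trees: as a vector space $\mathfrak n_T=\mathbb Q\{\mathbb T\}$, the span of unlabeled rooted trees. For $T_1,T_2\in\mathbb T$ put $$T_1*T_2=\sum_{T\in\mathbb T}a(T_1,T_2;T)\,T,\qquad a(T_1,T_2;T)=\bigl|\{e\in E(T)\mid P_{C_e}(T)=T_1,\ R_{C_e}(T)=T_2\}\bigr|,$$ where $C_e$ is the cut severing the single edge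 $e$ and equalities are as unlabeled rooted trees. This is a pre-Lie product, and the Lie bracket is $[T_1,T_2]=T_1*T_2-T_2*T_1$. *)

theory Defs
  imports Complex_Main "HOL-Library.Poly_Mapping" "HOL-Library.FuncSet"
begin

section \<open>Rational vector spaces, linear and bilinear maps\<close>

class rat_vector = ab_group_add +
  fixes scaleQ :: "rat \<Rightarrow> 'a \<Rightarrow> 'a"  (infixr \<open>*\<^sub>Q\<close> 75)
  assumes scaleQ_add_right: "a *\<^sub>Q (x + y) = a *\<^sub>Q x + a *\<^sub>Q y"
    and scaleQ_add_left: "(a + b) *\<^sub>Q x = a *\<^sub>Q x + b *\<^sub>Q x"
    and scaleQ_scaleQ: "a *\<^sub>Q (b *\<^sub>Q x) = (a * b) *\<^sub>Q x"
    and scaleQ_one: "1 *\<^sub>Q x = x"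

global_interpretation rat_vector: vector_space "scaleQ :: rat \<Rightarrow> 'a \<Rightarrow> 'a::rat_vector"
  by unfold_locales (rule scaleQ_add_right scaleQ_add_left scaleQ_scaleQ scaleQ_one)+

instantiation rat :: rat_vector
begin
definition scaleQ_rat :: "rat \<Rightarrow> rat \<Rightarrow> rat" where "scaleQ_rat = (*)"
instance by standard (simp_all add: scaleQ_rat_def algebra_simps)
end

instantiation poly_mapping :: (type, rat_vector) rat_vector
begin
lift_definition scaleQ_poly_mapping :: "rat \<Rightarrow> ('a \<Rightarrow>\<^sub>0 'b) \<Rightarrow> 'a \<Rightarrow>\<^sub>0 'b"
  is "\<lambda>c f x. c *\<^sub>Q f x"
  by (erule rev_finite_subset) auto
instance
  by (standard; transfer; simp add: scaleQ_add_right scaleQ_add_left scaleQ_scaleQ scaleQ_one)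
end

lemma lookup_scaleQ: "Poly_Mapping.lookup (c *\<^sub>Q f) x = c *\<^sub>Q Poly_Mapping.lookup f x"
  by transfer simp

abbreviation qlinear :: "('a::rat_vector \<Rightarrow> 'b::rat_vector) \<Rightarrow> bool" where
  "qlinear \<equiv> Vector_Spaces.linear scaleQ scaleQ"

definition qbilinear :: "('a::rat_vector \<Rightarrow> 'b::rat_vector \<Rightarrow> 'c::rat_vector) \<Rightarrow> bool" where
  "qbilinear b \<longleftrightarrow> (\<forall>x. qlinear (\<lambda>y. b x y)) \<and> (\<forall>y. qlinear (\<lambda>x. b x y))"


lemma qlinearI:
  assumes "\<And>x y. f (x + y) = f x + f y" "\<And>c x. f (c *\<^sub>Q x) = c *\<^sub>Q f x"
  shows "qlinear f"
  using assms by (simp add: Vector_Spaces.linear_iff rat_vector.vector_space_axioms)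

lemma qlinear_add: "qlinear f \<Longrightarrow> f (x + y) = f x + f y"
  and qlinear_scale: "qlinear f \<Longrightarrow> f (c *\<^sub>Q x) = c *\<^sub>Q f x"
  by (simp_all add: Vector_Spaces.linear_iff)

lemma qlinear_diff: "qlinear f \<Longrightarrow> f (x - y) = f x - f y"
  by (metis add_diff_cancel diff_add_cancel qlinear_add)

lemma qlinear_0: "qlinear f \<Longrightarrow> f 0 = 0"
  by (metis diff_self qlinear_diff)

lemma qlinear_sum: "qlinear f \<Longrightarrow> f (sum g S) = (\<Sum>s\<in>S. f (g s))"
  by (induction S rule: infinite_finite_induct) (auto simp: qlinear_0 qlinear_add)

lemma qlinear_id: "qlinear (\<lambda>x. x)"
  by (rule qlinearI) auto

lemma qlinear_compose: "qlinear f \<Longrightarrow> qlinear g \<Longrightarrow> qlinear (\<lambda>x. g (f x))"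
  by (rule qlinearI) (auto simp: qlinear_add qlinear_scale)

lemma qlinear_scaleQ: "qlinear f \<Longrightarrow> qlinear (\<lambda>x. c *\<^sub>Q f x)"
  by (rule qlinearI) (auto simp: qlinear_add qlinear_scale scaleQ_add_right scaleQ_scaleQ mult.commute)

lemma qlinear_plus: "qlinear f \<Longrightarrow> qlinear g \<Longrightarrow> qlinear (\<lambda>x. f x + g x)"
  by (rule qlinearI) (auto simp: qlinear_add qlinear_scale scaleQ_add_right)

lemma qlinear_setsum: "(\<And>s. s \<in> S \<Longrightarrow> qlinear (f s)) \<Longrightarrow> qlinear (\<lambda>x. \<Sum>s\<in>S. f s x)"
  by (rule qlinearI) (simp_all add: qlinear_add qlinear_scale sum.distrib rat_vector.scale_sum_right)

text \<open>Linear extension of a map given on the basis of characteristic functions.\<close>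
definition lin_ext :: "('a \<Rightarrow> 'b::rat_vector) \<Rightarrow> ('a \<Rightarrow>\<^sub>0 rat) \<Rightarrow> 'b" where
  "lin_ext g p = (\<Sum>k\<in>Poly_Mapping.keys p. Poly_Mapping.lookup p k *\<^sub>Q g k)"

lemma lin_ext_superset:
  assumes "finite A" "Poly_Mapping.keys p \<subseteq> A"
  shows "lin_ext g p = (\<Sum>k\<in>A. Poly_Mapping.lookup p k *\<^sub>Q g k)"
  unfolding lin_ext_def using assms
  by (intro sum.mono_neutral_left) (auto simp: in_keys_iff)

lemma qlinear_lin_ext: "qlinear (lin_ext g)"
proof (rule qlinearI)
  fix p q :: "'a \<Rightarrow>\<^sub>0 rat" and c
  let ?A = "Poly_Mapping.keys p \<union> Poly_Mapping.keys q"
  have "lin_ext g (p + q) = (\<Sum>k\<in>?A. Poly_Mapping.lookup (p + q) k *\<^sub>Q g k)"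
    by (rule lin_ext_superset) (use Poly_Mapping.keys_add[of p q] in auto)
  also have "\<dots> = (\<Sum>k\<in>?A. Poly_Mapping.lookup p k *\<^sub>Q g k) + (\<Sum>k\<in>?A. Poly_Mapping.lookup q k *\<^sub>Q g k)"
    by (simp add: lookup_add scaleQ_add_left sum.distrib)
  also have "\<dots> = lin_ext g p + lin_ext g q"
    by (simp add: lin_ext_superset[of ?A])
  finally show "lin_ext g (p + q) = lin_ext g p + lin_ext g q" .
  have "lin_ext g (c *\<^sub>Q p) = (\<Sum>k\<in>Poly_Mapping.keys p. Poly_Mapping.lookup (c *\<^sub>Q p) k *\<^sub>Q g k)"
    by (rule lin_ext_superset) (auto simp: in_keys_iff lookup_scaleQ)
  then show "lin_ext g (c *\<^sub>Q p) = c *\<^sub>Q lin_ext g p"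
    by (simp add: lookup_scaleQ lin_ext_def rat_vector.scale_sum_right scaleQ_rat_def scaleQ_scaleQ)
qed

lemma lin_ext_single: "lin_ext g (Poly_Mapping.single k c) = c *\<^sub>Q g k"
  by (cases "c = 0") (simp_all add: lin_ext_def)

lemma single_eq_scaleQ: "Poly_Mapping.single k c = c *\<^sub>Q Poly_Mapping.single k (1::rat)"
  by (rule poly_mapping_eqI) (simp add: lookup_scaleQ lookup_single when_def scaleQ_rat_def)

lemma poly_mapping_as_sum:
  "p = (\<Sum>k\<in>Poly_Mapping.keys p. Poly_Mapping.lookup p k *\<^sub>Q Poly_Mapping.single k (1::rat))"
  by (rule poly_mapping_eqI)
    (auto simp: lookup_sum lookup_scaleQ lookup_single when_def scaleQ_rat_def in_keys_iff
      if_distrib[of "\<lambda>x. _ * x"] cong: if_cong)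

lemma qlinear_eqI:
  assumes "qlinear f" "qlinear g"
    and "\<And>k. f (Poly_Mapping.single k (1::rat)) = g (Poly_Mapping.single k 1)"
  shows "f p = g p"
  by (subst (1 2) poly_mapping_as_sum)
    (simp add: assms qlinear_sum[of f] qlinear_sum[of g] qlinear_scale[of f] qlinear_scale[of g])


section \<open>Tensor products\<close>

definition tensor_relations :: "('a::rat_vector \<times> 'b::rat_vector \<Rightarrow>\<^sub>0 rat) set" where
  "tensor_relations =
     {Poly_Mapping.single (x + x', y) 1 - Poly_Mapping.single (x, y) 1 - Poly_Mapping.single (x', y) 1
        | x x' y. True}
   \<union> {Poly_Mapping.single (x, y + y') 1 - Poly_Mapping.single (x, y) 1 - Poly_Mapping.single (x, y') 1
        | x y y'. True}
   \<union> {Poly_Mapping.single (c *\<^sub>Q x, y) 1 - c *\<^sub>Q Poly_Mapping.single (x, y) 1 | c x y. True}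
   \<union> {Poly_Mapping.single (x, c *\<^sub>Q y) 1 - c *\<^sub>Q Poly_Mapping.single (x, y) 1 | c x y. True}"

definition tensor_rel ::
  "('a::rat_vector \<times> 'b::rat_vector \<Rightarrow>\<^sub>0 rat) \<Rightarrow> ('a \<times> 'b \<Rightarrow>\<^sub>0 rat) \<Rightarrow> bool" where
  "tensor_rel p q \<longleftrightarrow> p - q \<in> rat_vector.span tensor_relations"

lemma equivp_diff_in_span: "equivp (\<lambda>p q. p - q \<in> rat_vector.span R)"
proof (rule equivpI)
  show "reflp (\<lambda>p q. p - q \<in> rat_vector.span R)"
    by (rule reflpI) (simp add: rat_vector.span_zero)
  show "symp (\<lambda>p q. p - q \<in> rat_vector.span R)"
    by (rule sympI) (metis minus_diff_eq rat_vector.span_neg)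
  show "transp (\<lambda>p q. p - q \<in> rat_vector.span R)"
    by (rule transpI) (metis diff_add_cancel add_diff_eq rat_vector.span_add)
qed

lemma
  assumes "p - p' \<in> rat_vector.span R" "q - q' \<in> rat_vector.span R"
  shows diff_in_span_add: "(p + q) - (p' + q') \<in> rat_vector.span R"
    and diff_in_span_diff: "(p - q) - (p' - q') \<in> rat_vector.span R"
  using rat_vector.span_add[OF assms] rat_vector.span_diff[OF assms]
  by (simp_all add: algebra_simps)

lemma diff_in_span_scale:
  "p - q \<in> rat_vector.span R \<Longrightarrow> c *\<^sub>Q p - c *\<^sub>Q q \<in> rat_vector.span R"
  by (metis rat_vector.scale_right_diff_distrib rat_vector.span_scale)

lemma diff_in_span_uminus:
  "p - q \<in> rat_vector.span R \<Longrightarrow> - p - - q \<in> rat_vector.span R"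
  using diff_in_span_diff[of 0 0 R p q] by (simp add: rat_vector.span_zero)

quotient_type (overloaded) ('a, 'b) tensor = "'a::rat_vector \<times> 'b::rat_vector \<Rightarrow>\<^sub>0 rat" / tensor_rel
  unfolding tensor_rel_def by (rule equivp_diff_in_span)

instantiation tensor :: (rat_vector, rat_vector) rat_vector
begin
lift_definition zero_tensor :: "('a, 'b) tensor" is 0 .
lift_definition plus_tensor :: "('a, 'b) tensor \<Rightarrow> ('a, 'b) tensor \<Rightarrow> ('a, 'b) tensor" is "(+)"
  unfolding tensor_rel_def by (rule diff_in_span_add)
lift_definition minus_tensor :: "('a, 'b) tensor \<Rightarrow> ('a, 'b) tensor \<Rightarrow> ('a, 'b) tensor" is "(-)"
  unfolding tensor_rel_def by (rule diff_in_span_diff)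
lift_definition uminus_tensor :: "('a, 'b) tensor \<Rightarrow> ('a, 'b) tensor" is uminus
  unfolding tensor_rel_def by (rule diff_in_span_uminus)
lift_definition scaleQ_tensor :: "rat \<Rightarrow> ('a, 'b) tensor \<Rightarrow> ('a, 'b) tensor" is scaleQ
  unfolding tensor_rel_def by (rule diff_in_span_scale)
instance
  by (standard; transfer)
    (simp_all add: tensor_rel_def rat_vector.span_zero algebra_simps scaleQ_add_right
      scaleQ_add_left scaleQ_scaleQ)
end

definition tens :: "'a::rat_vector \<Rightarrow> 'b::rat_vector \<Rightarrow> ('a, 'b) tensor"  (infixl \<open>\<otimes>\<close> 76) where
  "x \<otimes> y = abs_tensor (Poly_Mapping.single (x, y) 1)"

text \<open>
  The linear map on a tensor product induced by a bilinear map; independent of the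
  representative of the tensor by \<open>tensor_lift_abs\<close>.
\<close>
definition tensor_lift ::
  "('a::rat_vector \<Rightarrow> 'b::rat_vector \<Rightarrow> 'c::rat_vector) \<Rightarrow> ('a, 'b) tensor \<Rightarrow> 'c" where
  "tensor_lift b t = lin_ext (\<lambda>(x, y). b x y) (rep_tensor t)"

lemma qbilinearD:
  assumes "qbilinear b"
  shows "qlinear (b x)" "qlinear (\<lambda>x. b x y)"
  using assms by (auto simp: qbilinear_def)

lemma span_subset_kernel:
  assumes "qlinear f" "\<And>r. r \<in> R \<Longrightarrow> f r = 0" "p \<in> rat_vector.span R"
  shows "f p = 0"
  using assms(3)
  by (induction rule: rat_vector.span_induct_alt)
    (auto simp: assms qlinear_0 qlinear_add qlinear_scale)

lemma abs_rep_tensor: "abs_tensor (rep_tensor t) = t"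
  by (rule Quotient3_abs_rep[OF Quotient3_tensor])

lemma tensor_lift_abs:
  assumes "qbilinear b"
  shows "tensor_lift b (abs_tensor p) = lin_ext (\<lambda>(x, y). b x y) p"
proof -
  let ?f = "lin_ext (\<lambda>(x, y). b x y)"
  note lin = qlinear_lin_ext[of "\<lambda>(x, y). b x y"]
  have "tensor_rel (rep_tensor (abs_tensor p)) p"
    using Quotient3_tensor by (meson Quotient3_rep_abs Quotient3_rel equivp_reflp tensor_equivp)
  then have "rep_tensor (abs_tensor p) - p \<in> rat_vector.span tensor_relations"
    by (simp add: tensor_rel_def)
  then have "?f (rep_tensor (abs_tensor p) - p) = 0"
    by (rule span_subset_kernel[OF lin, rotated])
      (auto simp: tensor_relations_def qlinear_diff[OF lin] lin_ext_single qlinear_scale[OF lin]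
        qlinear_add[OF qbilinearD(1)[OF assms]] qlinear_add[OF qbilinearD(2)[OF assms]]
        qlinear_scale[OF qbilinearD(1)[OF assms]] qlinear_scale[OF qbilinearD(2)[OF assms]])
  then show ?thesis
    by (simp add: tensor_lift_def qlinear_diff[OF lin])
qed

lemma tensor_lift_tens: "qbilinear b \<Longrightarrow> tensor_lift b (x \<otimes> y) = b x y"
  by (simp add: tens_def tensor_lift_abs lin_ext_single)

lemma qlinear_abs_tensor: "qlinear abs_tensor"
  by (rule qlinearI) (simp_all add: plus_tensor.abs_eq scaleQ_tensor.abs_eq)

lemma qlinear_tensor_lift:
  assumes "qbilinear b" shows "qlinear (tensor_lift b)"
proof (rule qlinearI)
  fix s t :: "('a, 'b) tensor" and c
  obtain p q where "s = abs_tensor p" "t = abs_tensor q" by (metis abs_rep_tensor)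
  then show "tensor_lift b (s + t) = tensor_lift b s + tensor_lift b t"
    "tensor_lift b (c *\<^sub>Q s) = c *\<^sub>Q tensor_lift b s"
    by (simp_all add: plus_tensor.abs_eq scaleQ_tensor.abs_eq tensor_lift_abs assms
        qlinear_add[OF qlinear_lin_ext] qlinear_scale[OF qlinear_lin_ext])
qed

lemma qbilinear_tens: "qbilinear (\<otimes>)"
proof -
  have rel: "abs_tensor p = abs_tensor q" if "p - q \<in> tensor_relations"
    for p q :: "'a \<times> 'b \<Rightarrow>\<^sub>0 rat"
    using that by (simp add: tensor.abs_eq_iff tensor_rel_def rat_vector.span_base)
  have "x \<otimes> (y + y') = x \<otimes> y + x \<otimes> y'" "(x + x') \<otimes> y = x \<otimes> y + x' \<otimes> y"
    "(c *\<^sub>Q x) \<otimes> y = c *\<^sub>Q (x \<otimes> y)" "x \<otimes> (c *\<^sub>Q y) = c *\<^sub>Q (x \<otimes> y)"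
    for x x' :: 'a and y y' :: 'b and c
    unfolding tens_def plus_tensor.abs_eq scaleQ_tensor.abs_eq
    by (rule rel; force simp: tensor_relations_def diff_diff_eq)+
  then show ?thesis
    by (simp add: qbilinear_def qlinearI)
qed

lemma qlinear_tensor_eqI:
  assumes "qlinear f" "qlinear g" "\<And>x y. f (x \<otimes> y) = g (x \<otimes> y)"
  shows "f t = g t"
proof -
  obtain p where t: "t = abs_tensor p" by (metis abs_rep_tensor)
  show ?thesis unfolding t
    by (rule qlinear_eqI) 
      (use assms in \<open>auto simp: tens_def intro: qlinear_compose[OF qlinear_abs_tensor]\<close>)
qed

definition tensor_map ::
  "('a::rat_vector \<Rightarrow> 'c::rat_vector) \<Rightarrow> ('b::rat_vector \<Rightarrow> 'd::rat_vector) \<Rightarrow>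
    ('a, 'b) tensor \<Rightarrow> ('c, 'd) tensor" where
  "tensor_map f g = tensor_lift (\<lambda>x y. f x \<otimes> g y)"

definition tensor_swap :: "('a::rat_vector, 'b::rat_vector) tensor \<Rightarrow> ('b, 'a) tensor" where
  "tensor_swap = tensor_lift (\<lambda>x y. y \<otimes> x)"

definition tensor_assoc ::
  "(('a::rat_vector, 'b::rat_vector) tensor, 'c::rat_vector) tensor \<Rightarrow> ('a, ('b, 'c) tensor) tensor" where
  "tensor_assoc = tensor_lift (\<lambda>t z. tensor_lift (\<lambda>x y. x \<otimes> (y \<otimes> z)) t)"

definition tensor_mult ::
  "('a::rat_vector \<Rightarrow> 'a \<Rightarrow> 'a) \<Rightarrow> ('a, 'a) tensor \<Rightarrow> ('a, 'a) tensor \<Rightarrow> ('a, 'a) tensor" where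
  "tensor_mult m s t = tensor_lift (\<lambda>x y. tensor_lift (\<lambda>x' y'. m x x' \<otimes> m y y') t) s"


section \<open>Hopf algebras\<close>

locale rat_algebra =
  fixes m :: "'a::rat_vector \<Rightarrow> 'a \<Rightarrow> 'a" and u :: 'a
  assumes bilinear: "qbilinear m"
    and assoc: "m (m x y) z = m x (m y z)"
    and unit_left: "m u x = x"
    and unit_right: "m x u = x"

lemma qbilinear_tensor_lift_param:
  assumes "\<And>x y. qbilinear (b x y)" "\<And>x' y'. qbilinear (\<lambda>x y. b x y x' y')"
  shows "qbilinear (\<lambda>x y. tensor_lift (b x y) t)"
  unfolding qbilinear_def
proof (intro conjI allI; rule qlinearI)
  note lin = qlinear_tensor_lift[OF assms(1)]
  fix x x2 y y2 c
  show "tensor_lift (b x (y + y2)) t = tensor_lift (b x y) t + tensor_lift (b x y2) t"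
    by (rule qlinear_tensor_eqI[OF lin qlinear_plus[OF lin lin]])
      (simp add: tensor_lift_tens[OF assms(1)] qlinear_add[OF qbilinearD(1)[OF assms(2)]])
  show "tensor_lift (b (x + x2) y) t = tensor_lift (b x y) t + tensor_lift (b x2 y) t"
    by (rule qlinear_tensor_eqI[OF lin qlinear_plus[OF lin lin]])
      (simp add: tensor_lift_tens[OF assms(1)] qlinear_add[OF qbilinearD(2)[OF assms(2)]])
  show "tensor_lift (b x (c *\<^sub>Q y)) t = c *\<^sub>Q tensor_lift (b x y) t"
    by (rule qlinear_tensor_eqI[OF lin qlinear_scaleQ[OF lin]])
      (simp add: tensor_lift_tens[OF assms(1)] qlinear_scale[OF qbilinearD(1)[OF assms(2)]])
  show "tensor_lift (b (c *\<^sub>Q x) y) t = c *\<^sub>Q tensor_lift (b x y) t"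
    by (rule qlinear_tensor_eqI[OF lin qlinear_scaleQ[OF lin]])
      (simp add: tensor_lift_tens[OF assms(1)] qlinear_scale[OF qbilinearD(2)[OF assms(2)]])
qed

context rat_algebra
begin

lemma qbilinear_mult_tens:
  "qbilinear (\<lambda>x' y'. m x x' \<otimes> m y y')" "qbilinear (\<lambda>x y. m x x' \<otimes> m y y')"
proof -
  note bm = qbilinearD[OF bilinear] and bt = qbilinearD[OF qbilinear_tens]
  show "qbilinear (\<lambda>x' y'. m x x' \<otimes> m y y')"
    unfolding qbilinear_def
    by (auto intro: qlinear_compose[OF bm(1) bt(1)] qlinear_compose[OF bm(1) bt(2)])
  show "qbilinear (\<lambda>x y. m x x' \<otimes> m y y')"
    unfolding qbilinear_def
    by (auto intro: qlinear_compose[OF bm(2) bt(1)] qlinear_compose[OF bm(2) bt(2)])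
qed

lemma qbilinear_tensor_mult: "qbilinear (tensor_mult m)"
proof -
  note b = qbilinear_tensor_lift_param[OF qbilinear_mult_tens]
  have left: "qlinear (\<lambda>s. tensor_mult m s t)" for t
    unfolding tensor_mult_def by (rule qlinear_tensor_lift[OF b])
  have right: "tensor_mult m (x \<otimes> y) t = tensor_lift (\<lambda>x' y'. m x x' \<otimes> m y y') t" for x y t
    unfolding tensor_mult_def by (rule tensor_lift_tens[OF b])
  note lin = qlinear_tensor_lift[OF qbilinear_mult_tens(1)]
  have "tensor_mult m s (t + t') = tensor_mult m s t + tensor_mult m s t'" for s t t'
    by (rule qlinear_tensor_eqI[OF left qlinear_plus[OF left left]])
      (simp add: right qlinear_add[OF lin])
  moreover have "tensor_mult m s (c *\<^sub>Q t) = c *\<^sub>Q tensor_mult m s t" for s t c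
    by (rule qlinear_tensor_eqI[OF left qlinear_scaleQ[OF left]])
      (simp add: right qlinear_scale[OF lin])
  ultimately show ?thesis
    by (auto simp: qbilinear_def left intro: qlinearI)
qed

lemma tensor_mult_tens: "tensor_mult m (x \<otimes> y) (x' \<otimes> y') = m x x' \<otimes> m y y'"
  by (simp add: tensor_mult_def tensor_lift_tens qbilinear_tensor_lift_param qbilinear_mult_tens)

lemma tensor_unit_left: "tensor_mult m (u \<otimes> u) t = t"
  by (rule qlinear_tensor_eqI[OF qbilinearD(1)[OF qbilinear_tensor_mult] qlinear_id])
    (simp add: tensor_mult_tens unit_left)

lemma tensor_unit_right: "tensor_mult m t (u \<otimes> u) = t"
  by (rule qlinear_tensor_eqI[OF qbilinearD(2)[OF qbilinear_tensor_mult] qlinear_id])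
    (simp add: tensor_mult_tens unit_right)

lemma tensor_mult_assoc:
  "tensor_mult m (tensor_mult m r s) t = tensor_mult m r (tensor_mult m s t)"
proof -
  note tm = qbilinearD[OF qbilinear_tensor_mult]
  have 1: "tensor_mult m (tensor_mult m (x \<otimes> y) (x' \<otimes> y')) t =
      tensor_mult m (x \<otimes> y) (tensor_mult m (x' \<otimes> y') t)" for x y x' y'
    by (rule qlinear_tensor_eqI[OF tm(1) qlinear_compose[OF tm(1) tm(1)]])
      (simp add: tensor_mult_tens assoc)
  have 2: "tensor_mult m (tensor_mult m (x \<otimes> y) s) t =
      tensor_mult m (x \<otimes> y) (tensor_mult m s t)" for x y
    by (rule qlinear_tensor_eqI[OF qlinear_compose[OF tm(1) tm(2)] qlinear_compose[OF tm(2) tm(1)] 1])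
  show ?thesis
    by (rule qlinear_tensor_eqI[OF qlinear_compose[OF tm(2) tm(2)] tm(2) 2])
qed

end

locale rat_coalgebra =
  fixes cop :: "'a::rat_vector \<Rightarrow> ('a, 'a) tensor" and eps :: "'a \<Rightarrow> rat"
  assumes cop_linear: "qlinear cop"
    and eps_linear: "qlinear eps"
    and coassoc: "tensor_assoc (tensor_map cop id (cop x)) = tensor_map id cop (cop x)"
    and counit_left: "tensor_lift (\<lambda>y z. eps y *\<^sub>Q z) (cop x) = x"
    and counit_right: "tensor_lift (\<lambda>y z. eps z *\<^sub>Q y) (cop x) = x"

locale rat_bialgebra = rat_algebra m u + rat_coalgebra cop eps
  for m :: "'a::rat_vector \<Rightarrow> 'a \<Rightarrow> 'a" and u cop eps +
  assumes cop_mult: "cop (m x y) = tensor_mult m (cop x) (cop y)"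
    and cop_unit: "cop u = u \<otimes> u"
    and eps_mult: "eps (m x y) = eps x * eps y"
    and eps_unit: "eps u = 1"

locale hopf_algebra = rat_bialgebra m u cop eps
  for m :: "'a::rat_vector \<Rightarrow> 'a \<Rightarrow> 'a" and u cop eps +
  fixes ant :: "'a \<Rightarrow> 'a"
  assumes ant_linear: "qlinear ant"
    and ant_left: "tensor_lift (\<lambda>y z. m (ant y) z) (cop x) = eps x *\<^sub>Q u"
    and ant_right: "tensor_lift (\<lambda>y z. m y (ant z)) (cop x) = eps x *\<^sub>Q u"

definition cocommutative :: "('a::rat_vector \<Rightarrow> ('a, 'a) tensor) \<Rightarrow> bool" where
  "cocommutative cop \<longleftrightarrow> (\<forall>x. tensor_swap (cop x) = cop x)"

locale hopf_isomorphism =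
  A: hopf_algebra m u cop eps ant + B: hopf_algebra m' u' cop' eps' ant'
  for m :: "'a::rat_vector \<Rightarrow> 'a \<Rightarrow> 'a" and u cop eps ant
    and m' :: "'b::rat_vector \<Rightarrow> 'b \<Rightarrow> 'b" and u' cop' eps' ant' +
  fixes \<phi> :: "'a \<Rightarrow> 'b"
  assumes bij: "bij \<phi>"
    and linear: "qlinear \<phi>"
    and mult: "\<phi> (m x y) = m' (\<phi> x) (\<phi> y)"
    and unit: "\<phi> u = u'"
    and comult: "cop' (\<phi> x) = tensor_map \<phi> \<phi> (cop x)"
    and counit: "eps' (\<phi> x) = eps x"
    and antipode: "ant' (\<phi> x) = \<phi> (ant x)"

section \<open>Labeled rooted trees and forests\<close>

text \<open>Vertices are identified with their labels.\<close>
datatype ltree = LTree (vertices: "nat set") (edges: "nat set set") (root_of: nat)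

definition adjacency :: "nat set set \<Rightarrow> (nat \<times> nat) set" where
  "adjacency E = {(x, y). {x, y} \<in> E}"

definition is_path :: "nat set set \<Rightarrow> nat list \<Rightarrow> bool" where
  "is_path E p \<longleftrightarrow> p \<noteq> [] \<and> distinct p \<and> successively (\<lambda>x y. {x, y} \<in> E) p"

definition is_cycle :: "nat set set \<Rightarrow> nat list \<Rightarrow> bool" where
  "is_cycle E p \<longleftrightarrow> is_path E p \<and> 3 \<le> length p \<and> {last p, hd p} \<in> E"

text \<open>
  A finite simplicial complex of dimension at most one is a finite simple graph; it is
  contractible iff it is connected and acyclic.
\<close>
definition rooted_tree :: "ltree \<Rightarrow> bool" where
  "rooted_tree T \<longleftrightarrow>
     finite (vertices T) \<and> root_of T \<in> vertices T \<and>
     (\<forall>e\<in>edges T. e \<subseteq> vertices T \<and> card e = 2) \<and>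
     (\<forall>v\<in>vertices T. \<forall>w\<in>vertices T. (v, w) \<in> (adjacency (edges T))\<^sup>*) \<and>
     (\<nexists>p. is_cycle (edges T) p)"

definition labeled_forest :: "ltree set \<Rightarrow> bool" where
  "labeled_forest F \<longleftrightarrow>
     finite F \<and> (\<forall>T\<in>F. rooted_tree T) \<and>
     (\<forall>T\<in>F. \<forall>T'\<in>F. T \<noteq> T' \<longrightarrow> vertices T \<inter> vertices T' = {})"

definition forest_vertices :: "ltree set \<Rightarrow> nat set" where
  "forest_vertices F = (\<Union>T\<in>F. vertices T)"

definition tree_iso :: "(nat \<Rightarrow> nat) \<Rightarrow> ltree \<Rightarrow> ltree \<Rightarrow> bool" where
  "tree_iso h T T' \<longleftrightarrow>
     bij_betw h (vertices T) (vertices T') \<and> h (root_of T) = root_of T' \<and>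
     (\<lambda>e. h ` e) ` edges T = edges T'"

definition tree_rel :: "ltree \<Rightarrow> ltree \<Rightarrow> bool" where
  "tree_rel T T' \<longleftrightarrow> rooted_tree T \<and> rooted_tree T' \<and> (\<exists>h. tree_iso h T T')"

definition forest_rel :: "ltree set \<Rightarrow> ltree set \<Rightarrow> bool" where
  "forest_rel F F' \<longleftrightarrow> labeled_forest F \<and> labeled_forest F' \<and>
     (\<exists>h \<sigma>. bij_betw h (forest_vertices F) (forest_vertices F') \<and> bij_betw \<sigma> F F' \<and>
       (\<forall>T\<in>F. tree_iso h T (\<sigma> T)))"

definition relabel :: "(nat \<Rightarrow> nat) \<Rightarrow> ltree \<Rightarrow> ltree" where
  "relabel h T = LTree (h ` vertices T) ((\<lambda>e. h ` e) ` edges T) (h (root_of T))"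

lemma relabel_sel [simp]:
  "vertices (relabel h T) = h ` vertices T"
  "edges (relabel h T) = (\<lambda>e. h ` e) ` edges T"
  "root_of (relabel h T) = h (root_of T)"
  by (simp_all add: relabel_def)

lemma tree_iso_iff: "tree_iso h T T' \<longleftrightarrow> inj_on h (vertices T) \<and> T' = relabel h T"
  by (cases T') (auto simp: tree_iso_def relabel_def bij_betw_def)

lemma forest_rel_iff:
  "forest_rel F F' \<longleftrightarrow> labeled_forest F \<and> labeled_forest F' \<and>
     (\<exists>h. inj_on h (forest_vertices F) \<and> F' = relabel h ` F)"
proof safe
  assume "forest_rel F F'"
  then obtain h \<sigma> where h: "bij_betw h (forest_vertices F) (forest_vertices F')"
    "bij_betw \<sigma> F F'" "\<forall>T\<in>F. tree_iso h T (\<sigma> T)"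
    unfolding forest_rel_def by blast
  then have "F' = relabel h ` F"
    by (force simp: tree_iso_iff bij_betw_def)
  with h(1) show "\<exists>h. inj_on h (forest_vertices F) \<and> F' = relabel h ` F"
    by (auto simp: bij_betw_def)
next
  fix h
  assume F: "labeled_forest F" and F': "labeled_forest (relabel h ` F)"
    and inj: "inj_on h (forest_vertices F)"
  have "inj_on (relabel h) F"
  proof (rule inj_onI)
    fix T T' assume T: "T \<in> F" "T' \<in> F" "relabel h T = relabel h T'"
    then have "h ` vertices T = h ` vertices T'" by (metis relabel_sel(1))
    with T inj have "vertices T = vertices T'"
      by (metis inj_on_image_eq_iff UN_upper forest_vertices_def)
    with T F show "T = T'"
      by (force simp: labeled_forest_def rooted_tree_def)
  qed
  moreover have "bij_betw h (forest_vertices F) (forest_vertices (relabel h ` F))"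
    using inj by (simp add: bij_betw_def forest_vertices_def image_UN)
  moreover have "\<forall>T\<in>F. tree_iso h T (relabel h T)"
    using inj by (auto simp: tree_iso_iff forest_vertices_def intro: inj_on_subset)
  ultimately show "forest_rel F (relabel h ` F)"
    unfolding forest_rel_def using F F' by (blast intro: inj_on_imp_bij_betw)
qed (auto simp: forest_rel_def)

lemma relabel_relabel: "relabel g (relabel h T) = relabel (\<lambda>x. g (h x)) T"
  by (simp add: relabel_def image_image)

lemma relabel_cong:
  assumes "rooted_tree T" "\<And>x. x \<in> vertices T \<Longrightarrow> g x = h x"
  shows "relabel g T = relabel h T"
proof -
  have "g ` e = h ` e" if "e \<in> edges T" for e
    using that assms by (force simp: rooted_tree_def intro!: image_cong)
  then show ?thesis
    using assms by (auto simp: relabel_def rooted_tree_def intro!: image_cong)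
qed

lemma relabel_ident: "rooted_tree T \<Longrightarrow> (\<And>x. x \<in> vertices T \<Longrightarrow> h x = x) \<Longrightarrow> relabel h T = T"
  using relabel_cong[of T h "\<lambda>x. x"] by (simp add: relabel_def)

text \<open>Isomorphism classes of rooted trees (unlabeled rooted trees) and of labeled rooted forests.\<close>
quotient_type rtree = ltree / partial: tree_rel
proof (rule part_equivpI)
  show "\<exists>T. tree_rel T T"
  proof
    have "\<not> is_cycle {} p" for p
      by (auto simp: is_cycle_def)
    then show "tree_rel (LTree {0} {} 0) (LTree {0} {} 0)"
      by (auto simp: tree_rel_def rooted_tree_def tree_iso_def intro!: exI[of _ id])
  qed
  show "symp tree_rel"
  proof (rule sympI)
    fix T T' assume "tree_rel T T'"
    then obtain h where T: "rooted_tree T" "rooted_tree T'" and h: "inj_on h (vertices T)"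
      and eq: "T' = relabel h T"
      by (auto simp: tree_rel_def tree_iso_iff)
    let ?g = "inv_into (vertices T) h"
    have "relabel ?g T' = T"
      unfolding eq relabel_relabel by (rule relabel_ident[OF T(1)]) (simp add: h)
    moreover have "inj_on ?g (vertices T')"
      by (auto simp: eq intro: inj_on_inv_into)
    ultimately show "tree_rel T' T"
      unfolding tree_rel_def tree_iso_iff using T by metis
  qed
  show "transp tree_rel"
  proof (rule transpI)
    fix T T' T'' assume "tree_rel T T'" "tree_rel T' T''"
    then obtain g h where T: "rooted_tree T" "rooted_tree T''"
      and h: "inj_on h (vertices T)" and g: "inj_on g (vertices (relabel h T))"
      and eq: "T'' = relabel g (relabel h T)"
      unfolding tree_rel_def tree_iso_iff by blast
    show "tree_rel T T''"
      unfolding tree_rel_def tree_iso_iff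
      using T eq comp_inj_on[OF h] g by (auto simp: comp_def relabel_relabel)
  qed
qed

quotient_type rforest = "ltree set" / partial: forest_rel
proof (rule part_equivpI)
  show "\<exists>F. forest_rel F F"
    by (rule exI[of _ "{}"]) (auto simp: forest_rel_iff labeled_forest_def forest_vertices_def)
  show "symp forest_rel"
  proof (rule sympI)
    fix F F' assume "forest_rel F F'"
    then obtain h where F: "labeled_forest F" "labeled_forest F'"
      and h: "inj_on h (forest_vertices F)" and eq: "F' = relabel h ` F"
      by (auto simp: forest_rel_iff)
    let ?g = "inv_into (forest_vertices F) h"
    have "relabel ?g (relabel h T) = T" if "T \<in> F" for T
      unfolding relabel_relabel
    proof (rule relabel_ident)
      fix x assume "x \<in> vertices T"
      with that have "x \<in> forest_vertices F" by (auto simp: forest_vertices_def)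
      then show "?g (h x) = x" by (rule inv_into_f_f[OF h])
    qed (use that F in \<open>simp add: labeled_forest_def\<close>)
    then have "F = relabel ?g ` F'"
      by (simp add: eq image_image)
    moreover have "inj_on ?g (forest_vertices F')"
      by (rule inj_on_inv_into) (auto simp: eq forest_vertices_def)
    ultimately show "forest_rel F' F"
      unfolding forest_rel_iff using F by metis
  qed
  show "transp forest_rel"
  proof (rule transpI)
    fix F F' F'' assume "forest_rel F F'" "forest_rel F' F''"
    then obtain g h where F: "labeled_forest F" "labeled_forest F''"
      and h: "inj_on h (forest_vertices F)" and g: "inj_on g (forest_vertices (relabel h ` F))"
      and eq: "F'' = relabel g ` relabel h ` F"
      by (auto simp: forest_rel_iff)
    have "forest_vertices (relabel h ` F) = h ` forest_vertices F"
      by (auto simp: forest_vertices_def)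
    with g h have "inj_on (\<lambda>x. g (h x)) (forest_vertices F)"
      using comp_inj_on[of h _ g] by (simp add: comp_def)
    then show "forest_rel F F''"
      unfolding forest_rel_iff using F eq by (auto simp: image_image relabel_relabel)
  qed
qed


section \<open>Admissible cuts\<close>

definition leaf :: "ltree \<Rightarrow> nat \<Rightarrow> bool" where
  "leaf T v \<longleftrightarrow> v \<in> vertices T \<and> v \<noteq> root_of T \<and> card {e \<in> edges T. v \<in> e} = 1"

definition path_edges :: "nat list \<Rightarrow> nat set set" where
  "path_edges p = {{p ! i, p ! Suc i} | i. Suc i < length p}"

definition admissible :: "ltree \<Rightarrow> nat set set \<Rightarrow> bool" where
  "admissible T C \<longleftrightarrow> C \<subseteq> edges T \<and>
     (\<forall>v p. leaf T v \<and> is_path (edges T) p \<and> hd p = v \<and> last p = root_of T \<longrightarrow>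
        card (C \<inter> path_edges p) \<le> 1)"

definition component :: "ltree \<Rightarrow> nat set set \<Rightarrow> nat \<Rightarrow> nat set" where
  "component T C v = {w. (v, w) \<in> (adjacency (edges T - C))\<^sup>*}"

definition tree_dist :: "ltree \<Rightarrow> nat \<Rightarrow> nat \<Rightarrow> nat" where
  "tree_dist T v w = (LEAST n. (v, w) \<in> adjacency (edges T) ^^ n)"

text \<open>Used for the connected components of a cut tree, where the minimum is attained once.\<close>
definition closest_to_root :: "ltree \<Rightarrow> nat set \<Rightarrow> nat" where
  "closest_to_root T K = (ARG_MIN (tree_dist T (root_of T)) v. v \<in> K)"

text \<open>The component \<open>K\<close> of \<open>T\<close> after removal of \<open>C\<close>, with root \<open>r\<close>.\<close>
definition restrict_tree :: "ltree \<Rightarrow> nat set set \<Rightarrow> nat set \<Rightarrow> nat \<Rightarrow> ltree" where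
  "restrict_tree T C K r = LTree K {e \<in> edges T - C. e \<subseteq> K} r"

text \<open>\<open>trunk T C\<close> and \<open>pruned T C\<close> are R and P of the cut \<open>C\<close>.\<close>
definition trunk :: "ltree \<Rightarrow> nat set set \<Rightarrow> ltree" where
  "trunk T C = restrict_tree T C (component T C (root_of T)) (root_of T)"

definition pruned :: "ltree \<Rightarrow> nat set set \<Rightarrow> ltree set" where
  "pruned T C = (\<lambda>K. restrict_tree T C K (closest_to_root T K)) `
     (component T C ` vertices T - {component T C (root_of T)})"

datatype cut = Full_Cut | Edge_Cut "nat set set"

definition tree_cuts :: "ltree \<Rightarrow> cut set" where
  "tree_cuts T = insert Full_Cut (Edge_Cut ` {C. admissible T C})"

fun tree_P :: "ltree \<Rightarrow> cut \<Rightarrow> ltree set" where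
  "tree_P T Full_Cut = {T}"
| "tree_P T (Edge_Cut C) = pruned T C"

fun tree_R :: "ltree \<Rightarrow> cut \<Rightarrow> ltree set" where
  "tree_R T Full_Cut = {}"
| "tree_R T (Edge_Cut C) = {trunk T C}"

definition forest_cuts :: "ltree set \<Rightarrow> (ltree \<Rightarrow> cut) set" where
  "forest_cuts F = (\<Pi>\<^sub>E T\<in>F. tree_cuts T)"

definition forest_P :: "ltree set \<Rightarrow> (ltree \<Rightarrow> cut) \<Rightarrow> ltree set" where
  "forest_P F c = (\<Union>T\<in>F. tree_P T (c T))"

definition forest_R :: "ltree set \<Rightarrow> (ltree \<Rightarrow> cut) \<Rightarrow> ltree set" where
  "forest_R F c = (\<Union>T\<in>F. tree_R T (c T))"


section \<open>Well-definedness of cuts and disjoint unions\<close>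

lemma adjacency_sym: "(x, y) \<in> (adjacency E)\<^sup>* \<Longrightarrow> (y, x) \<in> (adjacency E)\<^sup>*"
  by (rule symD[OF sym_rtrancl]) (auto simp: adjacency_def sym_def insert_commute)

lemma is_cycle_mono: "is_cycle E p \<Longrightarrow> E \<subseteq> E' \<Longrightarrow> is_cycle E' p"
  by (auto simp: is_cycle_def is_path_def elim!: successively_mono)

lemma component_eq_iff: "component T C v = component T C w \<longleftrightarrow> w \<in> component T C v"
proof
  assume "w \<in> component T C v"
  then show "component T C v = component T C w"
    unfolding component_def
    by (auto intro: rtrancl_trans adjacency_sym)
qed (auto simp: component_def)

lemma component_disjoint:
  "component T C v \<noteq> component T C w \<Longrightarrow> component T C v \<inter> component T C w = {}"
  by (metis component_eq_iff disjoint_iff)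

lemma self_in_component: "v \<in> component T C v"
  by (simp add: component_def)

lemma component_subset:
  assumes "rooted_tree T" "v \<in> vertices T"
  shows "component T C v \<subseteq> vertices T"
proof
  fix w assume "w \<in> component T C v"
  then have "(v, w) \<in> (adjacency (edges T - C))\<^sup>*" by (simp add: component_def)
  then show "w \<in> vertices T"
    by (induction rule: rtrancl_induct)
      (use assms in \<open>auto simp: rooted_tree_def adjacency_def\<close>)
qed

lemma rooted_tree_restrict:
  assumes T: "rooted_tree T" and v: "v \<in> vertices T" and r: "r \<in> component T C v"
  shows "rooted_tree (restrict_tree T C (component T C v) r)"
proof -
  let ?K = "component T C v" and ?E = "{e \<in> edges T - C. e \<subseteq> component T C v}"
  have sub: "?K \<subseteq> vertices T" by (rule component_subset[OF T v])
  have reach: "(v, w) \<in> (adjacency ?E)\<^sup>*" if "w \<in> ?K" for w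
  proof -
    from that have "(v, w) \<in> (adjacency (edges T - C))\<^sup>*" by (simp add: component_def)
    then show ?thesis
    proof (induction rule: rtrancl_induct)
      case (step y z)
      then have "y \<in> ?K" "z \<in> ?K" by (auto simp: component_def intro: rtrancl_into_rtrancl)
      with step have "(y, z) \<in> adjacency ?E" by (auto simp: adjacency_def)
      with step show ?case by (meson rtrancl_into_rtrancl)
    qed simp
  qed
  have "(x, y) \<in> (adjacency ?E)\<^sup>*" if "x \<in> ?K" "y \<in> ?K" for x y
    using reach[OF that(1)] reach[OF that(2)] by (meson adjacency_sym rtrancl_trans)
  moreover have "\<not> is_cycle ?E p" for p
    using T is_cycle_mono[of ?E p "edges T"] by (auto simp: rooted_tree_def)
  moreover have "finite ?K"
    using T sub finite_subset by (auto simp: rooted_tree_def)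
  ultimately show ?thesis
    using T r by (auto simp: rooted_tree_def restrict_tree_def)
qed

lemma closest_to_root_in: "x \<in> K \<Longrightarrow> closest_to_root T K \<in> K"
  unfolding closest_to_root_def by (rule arg_min_natI)

lemma rooted_tree_trunk: "rooted_tree T \<Longrightarrow> rooted_tree (trunk T C)"
  unfolding trunk_def
  by (rule rooted_tree_restrict) (auto simp: self_in_component rooted_tree_def)

lemma vertices_trunk: "vertices (trunk T C) = component T C (root_of T)"
  by (simp add: trunk_def restrict_tree_def)

lemma labeled_forest_pruned:
  assumes "rooted_tree T" shows "labeled_forest (pruned T C)"
  unfolding labeled_forest_def
proof (intro conjI ballI impI)
  show "finite (pruned T C)"
    using assms by (simp add: pruned_def rooted_tree_def)
next
  fix S assume "S \<in> pruned T C"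
  then show "rooted_tree S"
    by (auto simp: pruned_def intro!: rooted_tree_restrict[OF assms] closest_to_root_in
        self_in_component)
next
  fix S S' assume S: "S \<in> pruned T C" "S' \<in> pruned T C" "S \<noteq> S'"
  then obtain v w where eqs: "S = restrict_tree T C (component T C v) (closest_to_root T (component T C v))"
    "S' = restrict_tree T C (component T C w) (closest_to_root T (component T C w))"
    by (auto simp: pruned_def)
  with S have "component T C v \<noteq> component T C w" by auto
  then show "vertices S \<inter> vertices S' = {}"
    using component_disjoint by (simp add: eqs restrict_tree_def)
qed

lemma pruned_trunk_partition:
  assumes "rooted_tree T"
  shows "forest_vertices (pruned T C) \<union> vertices (trunk T C) = vertices T"
    "forest_vertices (pruned T C) \<inter> vertices (trunk T C) = {}"
proof -
  have eq: "forest_vertices (pruned T C) =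
    \<Union>(component T C ` vertices T - {component T C (root_of T)})"
    by (auto simp: forest_vertices_def pruned_def restrict_tree_def)
  have "root_of T \<in> vertices T" using assms by (simp add: rooted_tree_def)
  then have "forest_vertices (pruned T C) \<union> vertices (trunk T C) = (\<Union>v\<in>vertices T. component T C v)"
    unfolding eq vertices_trunk by blast
  also have "\<dots> = vertices T"
    using component_subset[OF assms] by (auto simp: self_in_component )
  finally show "forest_vertices (pruned T C) \<union> vertices (trunk T C) = vertices T" .
  show "forest_vertices (pruned T C) \<inter> vertices (trunk T C) = {}"
    unfolding eq vertices_trunk
    by (auto simp flip: component_eq_iff)
qed

lemma labeled_forest_UN:
  assumes F: "labeled_forest F" and G: "\<And>T. T \<in> F \<Longrightarrow> labeled_forest (G T)"
    and sub: "\<And>T. T \<in> F \<Longrightarrow> forest_vertices (G T) \<subseteq> vertices T"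
  shows "labeled_forest (\<Union>T\<in>F. G T)"
  unfolding labeled_forest_def
proof (intro conjI ballI impI)
  fix S S' assume S: "S \<in> (\<Union>T\<in>F. G T)" "S' \<in> (\<Union>T\<in>F. G T)" "S \<noteq> S'"
  then obtain T T' where T: "T \<in> F" "T' \<in> F" "S \<in> G T" "S' \<in> G T'" by auto
  show "vertices S \<inter> vertices S' = {}"
  proof (cases "T = T'")
    case True
    then show ?thesis using G T S by (auto simp: labeled_forest_def)
  next
    case False
    then have "vertices T \<inter> vertices T' = {}" using F T by (auto simp: labeled_forest_def)
    then show ?thesis using sub[OF T(1)] sub[OF T(2)] T(3,4) by (auto simp: forest_vertices_def)
  qed
qed (use F G in \<open>auto simp: labeled_forest_def\<close>)

lemma tree_P_R:
  assumes "rooted_tree T"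
  shows "labeled_forest (tree_P T c)" "labeled_forest (tree_R T c)"
    "forest_vertices (tree_P T c) \<union> forest_vertices (tree_R T c) = vertices T"
    "forest_vertices (tree_P T c) \<inter> forest_vertices (tree_R T c) = {}"
proof -
  have single: "labeled_forest {S}" if "rooted_tree S" for S
    using that by (simp add: labeled_forest_def)
  have empty: "labeled_forest {}" by (simp add: labeled_forest_def)
  have "forest_vertices {S} = vertices S" "forest_vertices {} = {}" for S
    by (simp_all add: forest_vertices_def)
  then show "labeled_forest (tree_P T c)" "labeled_forest (tree_R T c)"
    "forest_vertices (tree_P T c) \<union> forest_vertices (tree_R T c) = vertices T"
    "forest_vertices (tree_P T c) \<inter> forest_vertices (tree_R T c) = {}"
    using pruned_trunk_partition[OF assms]
    by (cases c; simp add: single empty assms labeled_forest_pruned rooted_tree_trunk)+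
qed

lemma tree_P_R_subset:
  assumes "rooted_tree T"
  shows "forest_vertices (tree_P T c) \<subseteq> vertices T" "forest_vertices (tree_R T c) \<subseteq> vertices T"
  using tree_P_R(3)[OF assms] by blast+

lemma labeled_forest_P: "labeled_forest F \<Longrightarrow> labeled_forest (forest_P F c)"
  unfolding forest_P_def
  by (rule labeled_forest_UN) (simp_all add: labeled_forest_def[of F] tree_P_R tree_P_R_subset)

lemma labeled_forest_R: "labeled_forest F \<Longrightarrow> labeled_forest (forest_R F c)"
  unfolding forest_R_def
  by (rule labeled_forest_UN) (simp_all add: labeled_forest_def[of F] tree_P_R tree_P_R_subset)

lemma finite_forest_vertices: "labeled_forest F \<Longrightarrow> finite (forest_vertices F)"
  by (auto simp: forest_vertices_def labeled_forest_def rooted_tree_def)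

lemma card_forest_P_R:
  assumes "labeled_forest F"
  shows "card (forest_vertices F) = card (forest_vertices (forest_P F c)) + card (forest_vertices (forest_R F c))"
proof -
  have T: "rooted_tree T" if "T \<in> F" for T using that assms by (simp add: labeled_forest_def)
  have un: "forest_vertices (forest_P F c) = (\<Union>T\<in>F. forest_vertices (tree_P T (c T)))"
    "forest_vertices (forest_R F c) = (\<Union>T\<in>F. forest_vertices (tree_R T (c T)))"
    by (auto simp: forest_vertices_def forest_P_def forest_R_def)
  have "forest_vertices F = forest_vertices (forest_P F c) \<union> forest_vertices (forest_R F c)"
    unfolding un using tree_P_R(3)[OF T] by (force simp: forest_vertices_def[of F])
  moreover have "forest_vertices (forest_P F c) \<inter> forest_vertices (forest_R F c) = {}"
  proof (rule ccontr)
    assume "\<not> ?thesis"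
    then obtain x T T' where x: "T \<in> F" "T' \<in> F" "x \<in> forest_vertices (tree_P T (c T))"
      "x \<in> forest_vertices (tree_R T' (c T'))"
      unfolding un by auto
    then have "x \<in> vertices T" "x \<in> vertices T'"
      using tree_P_R(3)[OF T] by blast+
    then have "T = T'" using assms x by (auto simp: labeled_forest_def)
    then show False using x tree_P_R(4)[OF T] by blast
  qed
  ultimately show ?thesis
    by (simp add: card_Un_disjoint finite_forest_vertices labeled_forest_P labeled_forest_R assms)
qed

lemma rooted_tree_relabel:
  assumes T: "rooted_tree T" and inj: "inj_on h (vertices T)"
  shows "rooted_tree (relabel h T)"
proof -
  have sub: "e \<subseteq> vertices T" if "e \<in> edges T" for e
    using that T by (auto simp: rooted_tree_def)
  have "(h v, h w) \<in> (adjacency ((\<lambda>e. h ` e) ` edges T))\<^sup>*"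
    if "(v, w) \<in> (adjacency (edges T))\<^sup>*" for v w
    using that
  proof (induction rule: rtrancl_induct)
    case (step y z)
    then have "{y, z} \<in> edges T" by (simp add: adjacency_def)
    then have "h ` {y, z} \<in> (\<lambda>e. h ` e) ` edges T" by (rule imageI)
    then have "(h y, h z) \<in> adjacency ((\<lambda>e. h ` e) ` edges T)"
      by (simp add: adjacency_def)
    with step show ?case by (meson rtrancl_into_rtrancl)
  qed simp
  moreover have False if cyc: "is_cycle ((\<lambda>e. h ` e) ` edges T) p" for p
  proof -
    let ?g = "inv_into (vertices T) h"
    have pull: "{?g x, ?g y} \<in> edges T \<and> x \<in> h ` vertices T \<and> y \<in> h ` vertices T"
      if xy: "{x, y} \<in> (\<lambda>e. h ` e) ` edges T" for x y
    proof -
      from xy obtain e where e: "e \<in> edges T" "{x, y} = h ` e" by auto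
      have "?g ` {x, y} = e"
        unfolding e(2) by (rule inv_into_image_cancel[OF inj sub[OF e(1)]])
      moreover have "{x, y} \<subseteq> h ` vertices T" using e sub by blast
      ultimately show ?thesis using e(1) by (metis image_insert image_empty insert_subset)
    qed
    have succ: "successively (\<lambda>x y. {x, y} \<in> (\<lambda>e. h ` e) ` edges T) p" and
      p: "p \<noteq> []" "distinct p" "3 \<le> length p" "{last p, hd p} \<in> (\<lambda>e. h ` e) ` edges T"
      using cyc by (auto simp: is_cycle_def is_path_def)
    have "set q \<subseteq> h ` vertices T"
      if "successively (\<lambda>x y. {x, y} \<in> (\<lambda>e. h ` e) ` edges T) q" "last q \<in> h ` vertices T" for q
      using that
    proof (induction q rule: induct_list012)
      case (3 x y zs)
      then have "{x, y} \<in> (\<lambda>e. h ` e) ` edges T" by simp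
      from pull[OF this] 3 show ?case by auto
    qed auto
    with succ p pull have set: "set p \<subseteq> h ` vertices T" by blast
    have "is_cycle (edges T) (map ?g p)"
      unfolding is_cycle_def is_path_def
    proof (intro conjI)
      show "distinct (map ?g p)"
        using p set by (auto simp: distinct_map intro: inj_on_subset[OF inj_on_inv_into])
      show "successively (\<lambda>x y. {x, y} \<in> edges T) (map ?g p)"
        unfolding successively_map using succ by (rule successively_mono) (use pull in blast)
      show "{last (map ?g p), hd (map ?g p)} \<in> edges T"
        using pull[OF p(4)] p(1) by (simp add: last_map hd_map)
    qed (use p in auto)
    with T show False by (auto simp: rooted_tree_def)
  qed
  moreover have "card (h ` e) = 2" if "e \<in> edges T" for e
    using that sub[OF that] T inj by (metis card_image inj_on_subset rooted_tree_def)
  moreover have "h ` e \<subseteq> h ` vertices T" if "e \<in> edges T" for e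
    using sub[OF that] by (rule image_mono)
  ultimately show ?thesis
    using T unfolding rooted_tree_def relabel_sel by blast
qed

lemma vertices_nonempty: "rooted_tree T \<Longrightarrow> vertices T \<noteq> {}"
  by (auto simp: rooted_tree_def)

lemma labeled_forest_relabel:
  assumes F: "labeled_forest F" and inj: "inj_on h (forest_vertices F)"
  shows "labeled_forest (relabel h ` F)"
  unfolding labeled_forest_def
proof (intro conjI ballI impI)
  show "finite (relabel h ` F)" using F by (simp add: labeled_forest_def)
next
  fix S assume "S \<in> relabel h ` F"
  then show "rooted_tree S"
    using F inj by (auto simp: labeled_forest_def forest_vertices_def
        intro!: rooted_tree_relabel intro: inj_on_subset)
next
  fix S S' assume S: "S \<in> relabel h ` F" "S' \<in> relabel h ` F" "S \<noteq> S'"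
  then obtain T T' where T: "T \<in> F" "T' \<in> F" "S = relabel h T" "S' = relabel h T'" "T \<noteq> T'"
    by auto
  then have "vertices T \<inter> vertices T' = {}" using F by (auto simp: labeled_forest_def)
  then show "vertices S \<inter> vertices S' = {}"
    using T inj_on_image_Int[OF inj, of "vertices T" "vertices T'"]
    by (auto simp: forest_vertices_def)
qed

definition disjoint_sum :: "ltree set \<Rightarrow> ltree set \<Rightarrow> ltree set" where
  "disjoint_sum F G = relabel (\<lambda>n. 2 * n) ` F \<union> relabel (\<lambda>n. 2 * n + 1) ` G"

lemma forest_vertices_relabel: "forest_vertices (relabel h ` F) = h ` forest_vertices F"
  by (auto simp: forest_vertices_def)

lemma forest_vertices_Un: "forest_vertices (F \<union> G) = forest_vertices F \<union> forest_vertices G"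
  by (simp add: forest_vertices_def)

lemma labeled_forest_disjoint_sum:
  assumes "labeled_forest F" "labeled_forest G"
  shows "labeled_forest (disjoint_sum F G)"
proof -
  have "labeled_forest (relabel (\<lambda>n. 2 * n) ` F)" "labeled_forest (relabel (\<lambda>n. 2 * n + 1) ` G)"
    by (auto intro!: labeled_forest_relabel assms inj_onI)
  moreover have "vertices (relabel (\<lambda>n. 2 * n) S) \<inter> vertices (relabel (\<lambda>n. 2 * n + 1) T) = {}" for S T
    by auto presburger
  ultimately show ?thesis
    unfolding disjoint_sum_def labeled_forest_def
    by (simp only: finite_Un ball_Un) (simp add: Int_commute)
qed

lemma card_disjoint_sum:
  assumes "labeled_forest F" "labeled_forest G"
  shows "card (forest_vertices (disjoint_sum F G)) = card (forest_vertices F) + card (forest_vertices G)"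
proof -
  have "(\<lambda>n. 2 * n) ` A \<inter> (\<lambda>n. 2 * n + 1) ` B = {}" for A B :: "nat set"
    by auto presburger
  then have "card (forest_vertices (disjoint_sum F G)) =
      card ((\<lambda>n. 2 * n) ` forest_vertices F) + card ((\<lambda>n. 2 * n + 1) ` forest_vertices G)"
    unfolding disjoint_sum_def forest_vertices_Un forest_vertices_relabel
    by (intro card_Un_disjoint) (auto simp: assms finite_forest_vertices)
  then show ?thesis
    by (simp add: card_image inj_on_def)
qed

lemma rep_rtree: "rooted_tree (rep_rtree X)" "abs_rtree (rep_rtree X) = X"
  using Quotient_rep_reflp[OF Quotient_rtree, of X] Quotient_abs_rep[OF Quotient_rtree]
  by (simp_all add: tree_rel_def)

lemma rep_rforest: "labeled_forest (rep_rforest X)" "abs_rforest (rep_rforest X) = X"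
  using Quotient_rep_reflp[OF Quotient_rforest, of X] Quotient_abs_rep[OF Quotient_rforest]
  by (simp_all add: forest_rel_def)

lemma forest_rel_refl: "labeled_forest F \<Longrightarrow> forest_rel F F"
  by (auto simp: forest_rel_iff relabel_def intro!: exI[of _ "\<lambda>x. x"])

lemma tree_rel_refl: "rooted_tree T \<Longrightarrow> tree_rel T T"
  by (auto simp: tree_rel_def tree_iso_iff relabel_def intro!: exI[of _ "\<lambda>x. x"])

definition forest_size :: "rforest \<Rightarrow> nat" where
  "forest_size X = card (forest_vertices (rep_rforest X))"

definition tree_size :: "rtree \<Rightarrow> nat" where
  "tree_size X = card (vertices (rep_rtree X))"

lemma forest_size_abs:
  assumes "labeled_forest F"
  shows "forest_size (abs_rforest F) = card (forest_vertices F)"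
proof -
  have "forest_rel F (rep_rforest (abs_rforest F))"
    using Quotient_rep_abs[OF Quotient_rforest forest_rel_refl[OF assms]]
    by (meson Quotient_symp Quotient_rforest sympD)
  then show ?thesis
    by (auto simp: forest_size_def forest_rel_iff forest_vertices_relabel card_image)
qed

lemma tree_size_abs:
  assumes "rooted_tree T"
  shows "tree_size (abs_rtree T) = card (vertices T)"
proof -
  have "tree_rel T (rep_rtree (abs_rtree T))"
    using Quotient_rep_abs[OF Quotient_rtree tree_rel_refl[OF assms]]
    by (meson Quotient_symp Quotient_rtree sympD)
  then show ?thesis
    by (auto simp: tree_size_def tree_rel_def tree_iso_iff card_image)
qed

lemma finite_ltrees: "finite {T. vertices T \<subseteq> {..<n} \<and> edges T \<subseteq> Pow {..<n} \<and> root_of T < n}"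
proof (rule finite_subset)
  show "finite ((\<lambda>(V, E, r). LTree V E r) ` (Pow {..<n} \<times> Pow (Pow {..<n}) \<times> {..<n}))"
    by simp
  show "{T. vertices T \<subseteq> {..<n} \<and> edges T \<subseteq> Pow {..<n} \<and> root_of T < n} \<subseteq>
      (\<lambda>(V, E, r). LTree V E r) ` (Pow {..<n} \<times> Pow (Pow {..<n}) \<times> {..<n})" (is "_ \<subseteq> ?f ` ?A")
  proof
    fix T assume "T \<in> {T. vertices T \<subseteq> {..<n} \<and> edges T \<subseteq> Pow {..<n} \<and> root_of T < n}"
    then have "T = ?f (vertices T, edges T, root_of T)" "(vertices T, edges T, root_of T) \<in> ?A"
      by auto
    then show "T \<in> ?f ` ?A" by blast
  qed
qed

lemma finite_rforests: "finite {X. forest_size X = n}"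
proof (rule finite_subset)
  let ?L = "{T. vertices T \<subseteq> {..<n} \<and> edges T \<subseteq> Pow {..<n} \<and> root_of T < n}"
  show "finite (abs_rforest ` Pow ?L)" using finite_ltrees by simp
  show "{X. forest_size X = n} \<subseteq> abs_rforest ` Pow ?L"
  proof
    fix X assume "X \<in> {X. forest_size X = n}"
    moreover define F where "F = rep_rforest X"
    ultimately have F: "labeled_forest F" "card (forest_vertices F) = n" "X = abs_rforest F"
      by (simp_all add: forest_size_def rep_rforest)
    obtain h where h: "bij_betw h (forest_vertices F) {..<n}"
      using ex_bij_betw_finite_nat[OF finite_forest_vertices[OF F(1)]] F(2)
      by (auto simp: atLeast0LessThan)
    have "forest_rel F (relabel h ` F)"
      using h F(1) labeled_forest_relabel by (auto simp: forest_rel_iff bij_betw_def)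
    then have "X = abs_rforest (relabel h ` F)"
      using F(3) Quotient_rel_abs[OF Quotient_rforest] by simp
    moreover have "relabel h T \<in> ?L" if "T \<in> F" for T
    proof -
      have "rooted_tree T" using that F(1) by (simp add: labeled_forest_def)
      moreover have "h x < n" if "x \<in> vertices T" for x
        using h that \<open>T \<in> F\<close> by (auto simp: bij_betw_def forest_vertices_def)
      ultimately show ?thesis by (auto simp: rooted_tree_def)
    qed
    ultimately show "X \<in> abs_rforest ` Pow ?L" by blast
  qed
qed

lemma finite_rtrees: "finite {X. tree_size X = n}"
proof (rule finite_subset)
  let ?L = "{T. vertices T \<subseteq> {..<n} \<and> edges T \<subseteq> Pow {..<n} \<and> root_of T < n}"
  show "finite (abs_rtree ` ?L)" using finite_ltrees by simp
  show "{X. tree_size X = n} \<subseteq> abs_rtree ` ?L"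
  proof
    fix X assume "X \<in> {X. tree_size X = n}"
    moreover define T where "T = rep_rtree X"
    ultimately have T: "rooted_tree T" "card (vertices T) = n" "X = abs_rtree T"
      by (simp_all add: tree_size_def rep_rtree)
    then obtain h where h: "bij_betw h (vertices T) {..<n}"
      using ex_bij_betw_finite_nat[of "vertices T"]
      by (auto simp: atLeast0LessThan rooted_tree_def)
    have "tree_rel T (relabel h T)"
      using h T(1) rooted_tree_relabel by (auto simp: tree_rel_def tree_iso_iff bij_betw_def)
    then have "X = abs_rtree (relabel h T)"
      using T(3) Quotient_rel_abs[OF Quotient_rtree] by simp
    moreover have "relabel h T \<in> ?L"
      using h T(1) by (force simp: rooted_tree_def bij_betw_def)
    ultimately show "X \<in> abs_rtree ` ?L" by blast
  qed
qed


section \<open>The Connes-Kreimer Lie algebra\<close>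

type_synonym nT = "rtree \<Rightarrow>\<^sub>0 rat"

text \<open>
  Here and below, cuts are counted on a representative of an isomorphism class; the results
  do not depend on its choice because isomorphisms transport cuts.
\<close>
definition ck_coeff :: "rtree \<Rightarrow> rtree \<Rightarrow> rtree \<Rightarrow> nat" where
  "ck_coeff T1 T2 X = (let T = rep_rtree X in
     card {e \<in> edges T. (\<exists>S. pruned T {e} = {S} \<and> abs_rtree S = T1) \<and> abs_rtree (trunk T {e}) = T2})"

lift_definition ck_basis_product :: "rtree \<Rightarrow> rtree \<Rightarrow> nT" is
  "\<lambda>T1 T2 X. rat_of_nat (ck_coeff T1 T2 X)"
proof -
  fix T1 T2
  have "tree_size X = tree_size T1 + tree_size T2" if "ck_coeff T1 T2 X \<noteq> 0" for X
  proof -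
    define T where "T = rep_rtree X"
    have T: "rooted_tree T" by (simp add: T_def rep_rtree)
    have "{e \<in> edges T. (\<exists>S. pruned T {e} = {S} \<and> abs_rtree S = T1) \<and> abs_rtree (trunk T {e}) = T2} \<noteq> {}"
      using that unfolding ck_coeff_def Let_def T_def by (metis card.empty)
    then obtain e S where S: "pruned T {e} = {S}" "abs_rtree S = T1" "abs_rtree (trunk T {e}) = T2"
      by blast
    have "rooted_tree S" using labeled_forest_pruned[OF T, of "{e}"] by (simp add: S labeled_forest_def)
    moreover have "card (vertices T) = card (vertices S) + card (vertices (trunk T {e}))"
      using pruned_trunk_partition[OF T, of "{e}"] T
      by (simp add: S forest_vertices_def rooted_tree_def) (metis card_Un_disjoint finite_Un)
    ultimately show ?thesis
      using S rooted_tree_trunk[OF T] by (simp add: tree_size_abs T_def[symmetric] tree_size_def[of X] flip: S(2,3))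
  qed
  then have "{X. rat_of_nat (ck_coeff T1 T2 X) \<noteq> 0} \<subseteq> {X. tree_size X = tree_size T1 + tree_size T2}"
    by auto
  then show "finite {X. rat_of_nat (ck_coeff T1 T2 X) \<noteq> 0}"
    using finite_rtrees finite_subset by blast
qed

definition ck_product :: "nT \<Rightarrow> nT \<Rightarrow> nT" where
  "ck_product f g = lin_ext (\<lambda>T1. lin_ext (\<lambda>T2. ck_basis_product T1 T2) g) f"

definition ck_bracket :: "nT \<Rightarrow> nT \<Rightarrow> nT" where
  "ck_bracket f g = ck_product f g - ck_product g f"


section \<open>The Hopf algebra of labeled rooted forests\<close>

type_synonym H_LRF = "rforest \<Rightarrow>\<^sub>0 rat"

definition forest_sum :: "rforest \<Rightarrow> rforest \<Rightarrow> rforest" where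
  "forest_sum X Y = abs_rforest (disjoint_sum (rep_rforest X) (rep_rforest Y))"

lemma forest_size_sum: "forest_size (forest_sum X Y) = forest_size X + forest_size Y"
  by (simp add: forest_sum_def forest_size_abs labeled_forest_disjoint_sum rep_rforest
      card_disjoint_sum forest_size_def[of X] forest_size_def[of Y])

text \<open>The sum over subforests is a sum over admissible cuts of a representative forest.\<close>
lift_definition H_mult :: "H_LRF \<Rightarrow> H_LRF \<Rightarrow> H_LRF" is
  "\<lambda>f g X. let F = rep_rforest X in
     \<Sum>c\<in>forest_cuts F. f (abs_rforest (forest_P F c)) * g (abs_rforest (forest_R F c))"
proof -
  fix f g :: "rforest \<Rightarrow> rat"
  assume fin: "finite {X. f X \<noteq> 0}" "finite {X. g X \<noteq> 0}"
  let ?h = "\<lambda>X. let F = rep_rforest X in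
     \<Sum>c\<in>forest_cuts F. f (abs_rforest (forest_P F c)) * g (abs_rforest (forest_R F c))"
  let ?N = "(\<lambda>(X, Y). forest_size X + forest_size Y) ` ({X. f X \<noteq> 0} \<times> {X. g X \<noteq> 0})"
  have "forest_size X \<in> ?N" if "?h X \<noteq> 0" for X
  proof -
    define F where "F = rep_rforest X"
    have F: "labeled_forest F" by (simp add: F_def rep_rforest)
    have "(\<Sum>c\<in>forest_cuts F. f (abs_rforest (forest_P F c)) * g (abs_rforest (forest_R F c))) \<noteq> 0"
      using that by (simp add: Let_def F_def)
    then obtain c where "f (abs_rforest (forest_P F c)) * g (abs_rforest (forest_R F c)) \<noteq> 0"
      by (rule sum.not_neutral_contains_not_neutral)
    then have c: "(abs_rforest (forest_P F c), abs_rforest (forest_R F c)) \<in> {X. f X \<noteq> 0} \<times> {X. g X \<noteq> 0}"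
      by simp
    have "forest_size X = forest_size (abs_rforest (forest_P F c)) + forest_size (abs_rforest (forest_R F c))"
      using card_forest_P_R[OF F, of c] F
      by (simp add: forest_size_abs labeled_forest_P labeled_forest_R F_def forest_size_def[of X])
    with c show ?thesis by (intro image_eqI[OF _ c]) simp
  qed
  then have "{X. ?h X \<noteq> 0} \<subseteq> (\<Union>n\<in>?N. {X. forest_size X = n})" by auto
  moreover have "finite (\<Union>n\<in>?N. {X. forest_size X = n})"
    using fin finite_rforests by auto
  ultimately show "finite {X. ?h X \<noteq> 0}" by (rule finite_subset)
qed

definition H_one :: H_LRF where
  "H_one = Poly_Mapping.single (abs_rforest {}) 1"

definition H_counit :: "H_LRF \<Rightarrow> rat" where
  "H_counit f = Poly_Mapping.lookup f (abs_rforest {})"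

lift_definition pair_product :: "('a \<Rightarrow>\<^sub>0 rat) \<Rightarrow> ('b \<Rightarrow>\<^sub>0 rat) \<Rightarrow> ('a \<times> 'b \<Rightarrow>\<^sub>0 rat)" is
  "\<lambda>f g (x, y). f x * g y"
proof -
  fix f :: "'a \<Rightarrow> rat" and g :: "'b \<Rightarrow> rat"
  assume "finite {x. f x \<noteq> 0}" "finite {y. g y \<noteq> 0}"
  then have "finite ({x. f x \<noteq> 0} \<times> {y. g y \<noteq> 0})" by simp
  then show "finite {z. (case z of (x, y) \<Rightarrow> f x * g y) \<noteq> 0}"
    by (rule rev_finite_subset) auto
qed

text \<open>
  The identification of a tensor product of spaces of finitely supported functions with
  the finitely supported functions of two variables; it is bijective by \<open>bij_tensor_to_fun\<close>.
\<close>
definition tensor_to_fun :: "('a \<Rightarrow>\<^sub>0 rat, 'b \<Rightarrow>\<^sub>0 rat) tensor \<Rightarrow> ('a \<times> 'b \<Rightarrow>\<^sub>0 rat)" where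
  "tensor_to_fun = tensor_lift pair_product"

lemma lookup_pair_product:
  "Poly_Mapping.lookup (pair_product f g) (x, y) = Poly_Mapping.lookup f x * Poly_Mapping.lookup g y"
  by transfer simp

lemma qbilinear_pair_product: "qbilinear pair_product"
  unfolding qbilinear_def
  by (auto intro!: qlinearI poly_mapping_eqI
      simp: lookup_pair_product lookup_add lookup_scaleQ scaleQ_rat_def algebra_simps)

lemma bij_tensor_to_fun:
  "bij (tensor_to_fun :: ('a \<Rightarrow>\<^sub>0 rat, 'b \<Rightarrow>\<^sub>0 rat) tensor \<Rightarrow> _)"
proof (rule o_bij)
  define G :: "('a \<times> 'b \<Rightarrow>\<^sub>0 rat) \<Rightarrow> ('a \<Rightarrow>\<^sub>0 rat, 'b \<Rightarrow>\<^sub>0 rat) tensor" where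
    "G = lin_ext (\<lambda>(x, y). Poly_Mapping.single x 1 \<otimes> Poly_Mapping.single y 1)"
  have linG: "qlinear G" unfolding G_def by (rule qlinear_lin_ext)
  have lin: "qlinear (tensor_to_fun :: ('a \<Rightarrow>\<^sub>0 rat, 'b \<Rightarrow>\<^sub>0 rat) tensor \<Rightarrow> _)"
    unfolding tensor_to_fun_def by (rule qlinear_tensor_lift[OF qbilinear_pair_product])
  have tens: "tensor_to_fun (f \<otimes> g) = pair_product f g" for f :: "'a \<Rightarrow>\<^sub>0 rat" and g :: "'b \<Rightarrow>\<^sub>0 rat"
    unfolding tensor_to_fun_def by (rule tensor_lift_tens[OF qbilinear_pair_product])
  have single: "pair_product (Poly_Mapping.single x 1) (Poly_Mapping.single y 1) = Poly_Mapping.single (x, y) 1"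
    for x :: 'a and y :: 'b
    by (rule poly_mapping_eqI) (auto simp: lookup_pair_product lookup_single when_def split: if_splits)
  note bp = qbilinearD[OF qbilinear_pair_product] and bt = qbilinearD[OF qbilinear_tens]
  have G1: "G (pair_product (Poly_Mapping.single x 1) g) = Poly_Mapping.single x 1 \<otimes> g" for x g
    by (rule qlinear_eqI[OF qlinear_compose[OF bp(1) linG] bt(1)]) (simp add: single G_def lin_ext_single)
  have G2: "G (pair_product f g) = f \<otimes> g" for f g
    by (rule qlinear_eqI[OF qlinear_compose[OF bp(2) linG] bt(2)]) (simp add: G1)
  show "G \<circ> tensor_to_fun = id"
  proof
    fix t show "(G \<circ> tensor_to_fun) t = id t"
      unfolding comp_def id_def
      by (rule qlinear_tensor_eqI[OF qlinear_compose[OF lin linG] qlinear_id]) (simp add: tens G2)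
  qed
  show "tensor_to_fun \<circ> G = id"
  proof
    fix p show "(tensor_to_fun \<circ> G) p = id p"
      unfolding comp_def id_def
      by (rule qlinear_eqI[OF qlinear_compose[OF linG lin] qlinear_id])
        (auto simp: G_def lin_ext_single tens single)
  qed
qed

lift_definition H_comult_fun :: "H_LRF \<Rightarrow> (rforest \<times> rforest \<Rightarrow>\<^sub>0 rat)" is
  "\<lambda>f (X, Y). f (forest_sum X Y)"
proof -
  fix f :: "rforest \<Rightarrow> rat" assume fin: "finite {X. f X \<noteq> 0}"
  let ?S = "\<Union>n\<in>forest_size ` {X. f X \<noteq> 0}. \<Union>m\<in>{..n}. {X. forest_size X = m}"
  have "finite (?S \<times> ?S)" using fin finite_rforests by auto
  moreover have "{z. (case z of (X, Y) \<Rightarrow> f (forest_sum X Y)) \<noteq> 0} \<subseteq> ?S \<times> ?S"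
  proof (rule subsetI)
    fix z assume "z \<in> {z. (case z of (X, Y) \<Rightarrow> f (forest_sum X Y)) \<noteq> 0}"
    moreover obtain X Y where z: "z = (X, Y)" by (cases z)
    ultimately have "f (forest_sum X Y) \<noteq> 0" by simp
    then have "forest_size (forest_sum X Y) \<in> forest_size ` {X. f X \<noteq> 0}" by simp
    moreover have "forest_size X \<le> forest_size (forest_sum X Y)"
      "forest_size Y \<le> forest_size (forest_sum X Y)"
      by (simp_all add: forest_size_sum)
    ultimately show "z \<in> ?S \<times> ?S" unfolding z by blast
  qed
  ultimately show "finite {z. (case z of (X, Y) \<Rightarrow> f (forest_sum X Y)) \<noteq> 0}"
    by (rule rev_finite_subset)
qed

text \<open>Under the identification above, \<open>H_comult f\<close> is the function \<open>(X, Y) \<mapsto> f (X \<oplus> Y)\<close>.\<close>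
definition H_comult :: "H_LRF \<Rightarrow> (H_LRF, H_LRF) tensor" where
  "H_comult f = inv tensor_to_fun (H_comult_fun f)"


section \<open>Universal enveloping algebras\<close>

definition lie_algebra :: "('l::rat_vector \<Rightarrow> 'l \<Rightarrow> 'l) \<Rightarrow> bool" where
  "lie_algebra br \<longleftrightarrow> qbilinear br \<and> (\<forall>x. br x x = 0) \<and>
     (\<forall>x y z. br x (br y z) + br y (br z x) + br z (br x y) = 0)"

text \<open>
  The free algebra on the set of vectors of a Lie algebra: linear combinations of words,
  multiplied by concatenation. The first two families of relations below cut it down to the
  tensor algebra, the third one to the universal enveloping algebra.
\<close>
definition free_mult :: "('l list \<Rightarrow>\<^sub>0 rat) \<Rightarrow> ('l list \<Rightarrow>\<^sub>0 rat) \<Rightarrow> ('l list \<Rightarrow>\<^sub>0 rat)" where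
  "free_mult p q = lin_ext (\<lambda>v. lin_ext (\<lambda>w. Poly_Mapping.single (v @ w) 1) q) p"

abbreviation word :: "'l list \<Rightarrow> ('l list \<Rightarrow>\<^sub>0 rat)" where
  "word w \<equiv> Poly_Mapping.single w 1"

definition envelope_relations :: "('l::rat_vector \<Rightarrow> 'l \<Rightarrow> 'l) \<Rightarrow> ('l list \<Rightarrow>\<^sub>0 rat) set" where
  "envelope_relations br =
     {word [x + y] - word [x] - word [y] | x y. True}
   \<union> {word [c *\<^sub>Q x] - c *\<^sub>Q word [x] | c x. True}
   \<union> {word [x, y] - word [y, x] - word [br x y] | x y. True}"

definition envelope_ideal :: "('l::rat_vector \<Rightarrow> 'l \<Rightarrow> 'l) \<Rightarrow> ('l list \<Rightarrow>\<^sub>0 rat) set" where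
  "envelope_ideal br =
     rat_vector.span {free_mult a (free_mult r b) | a r b. r \<in> envelope_relations br}"

definition envelope_rel ::
  "('l::rat_vector \<Rightarrow> 'l \<Rightarrow> 'l) \<Rightarrow> ('l list \<Rightarrow>\<^sub>0 rat) \<Rightarrow> ('l list \<Rightarrow>\<^sub>0 rat) \<Rightarrow> bool" where
  "envelope_rel br p q \<longleftrightarrow> p - q \<in> envelope_ideal br"

lemma equivp_envelope_rel: "equivp (envelope_rel br)"
  unfolding envelope_rel_def envelope_ideal_def by (rule equivp_diff_in_span)

lemma free_mult_word: "free_mult (word v) (word w) = word (v @ w)"
  by (simp add: free_mult_def lin_ext_single)

lemma qbilinear_free_mult: "qbilinear free_mult"
  unfolding qbilinear_def
proof (intro conjI allI)
  fix p :: "'a list \<Rightarrow>\<^sub>0 rat"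
  show "qlinear (\<lambda>q. free_mult p q)"
    unfolding free_mult_def lin_ext_def[of _ p]
    by (intro qlinear_setsum qlinear_scaleQ qlinear_lin_ext)
  show "qlinear (\<lambda>q. free_mult q p)"
    unfolding free_mult_def by (rule qlinear_lin_ext)
qed

lemma qbilinear_eqI:
  assumes "qbilinear b" "qbilinear b'"
    and "\<And>v w. b (Poly_Mapping.single v (1::rat)) (Poly_Mapping.single w (1::rat)) =
      b' (Poly_Mapping.single v 1) (Poly_Mapping.single w 1)"
  shows "b p q = b' p q"
proof -
  have "b (Poly_Mapping.single v 1) q = b' (Poly_Mapping.single v 1) q" for v
    by (rule qlinear_eqI[OF qbilinearD(1)[OF assms(1)] qbilinearD(1)[OF assms(2)] assms(3)])
  then show ?thesis
    by (rule qlinear_eqI[OF qbilinearD(2)[OF assms(1)] qbilinearD(2)[OF assms(2)]])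
qed

lemma free_mult_assoc: "free_mult (free_mult p q) r = free_mult p (free_mult q r)"
proof -
  note fm = qbilinearD[OF qbilinear_free_mult]
  have "free_mult (free_mult p q) (word w) = free_mult p (free_mult q (word w))" for w
    by (rule qbilinear_eqI[where b = "\<lambda>p q. free_mult (free_mult p q) (word w)"
          and b' = "\<lambda>p q. free_mult p (free_mult q (word w))"])
      (auto simp: qbilinear_def free_mult_word
        intro: qlinear_compose[OF fm(1) fm(2)] qlinear_compose[OF fm(2) fm(2)]
          qlinear_compose[OF fm(2) fm(1)] fm)
  then show ?thesis
    by (rule qlinear_eqI[OF fm(1) qlinear_compose[OF fm(1) fm(1)]])
qed

lemma free_mult_one: "free_mult (word []) p = p" "free_mult p (word []) = p"
  by (rule qlinear_eqI[OF qbilinearD(1)[OF qbilinear_free_mult] qlinear_id], simp add: free_mult_word)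
    (rule qlinear_eqI[OF qbilinearD(2)[OF qbilinear_free_mult] qlinear_id], simp add: free_mult_word)

text \<open>A linear map sends the ideal into a subspace if it sends the spanning set into it.\<close>
lemma envelope_ideal_image:
  assumes "qlinear f"
    and "\<And>a r b. r \<in> envelope_relations br \<Longrightarrow> f (free_mult a (free_mult r b)) \<in> rat_vector.span S"
    and "p \<in> envelope_ideal br"
  shows "f p \<in> rat_vector.span S"
  using assms(3) unfolding envelope_ideal_def
  by (induction rule: rat_vector.span_induct_alt)
    (auto simp: assms(1,2) qlinear_0 qlinear_add qlinear_scale
      intro!: rat_vector.span_add rat_vector.span_scale rat_vector.span_zero)

lemma envelope_idealI:
  "r \<in> envelope_relations br \<Longrightarrow> free_mult a (free_mult r b) \<in> envelope_ideal br"
  unfolding envelope_ideal_def by (rule rat_vector.span_base) auto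

lemma envelope_ideal_add:
  "p \<in> envelope_ideal br \<Longrightarrow> q \<in> envelope_ideal br \<Longrightarrow> p + q \<in> envelope_ideal br"
  unfolding envelope_ideal_def by (rule rat_vector.span_add)

lemma envelope_ideal_uminus: "p \<in> envelope_ideal br \<Longrightarrow> - p \<in> envelope_ideal br"
  unfolding envelope_ideal_def by (rule rat_vector.span_neg)

lemma envelope_ideal_mult:
  assumes "p \<in> envelope_ideal br"
  shows "free_mult q p \<in> envelope_ideal br" "free_mult p q \<in> envelope_ideal br"
proof -
  note fm = qbilinearD[OF qbilinear_free_mult]
  have left: "free_mult q (free_mult a (free_mult r b)) \<in> envelope_ideal br"
    and right: "free_mult (free_mult a (free_mult r b)) q \<in> envelope_ideal br"
    if "r \<in> envelope_relations br" for a r b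
    using envelope_idealI[OF that, of "free_mult q a" b] envelope_idealI[OF that, of a "free_mult b q"]
    by (simp_all add: free_mult_assoc)
  show "free_mult q p \<in> envelope_ideal br"
    using envelope_ideal_image[OF fm(1) left[unfolded envelope_ideal_def] assms]
    by (simp add: envelope_ideal_def)
  show "free_mult p q \<in> envelope_ideal br"
    using envelope_ideal_image[OF fm(2) right[unfolded envelope_ideal_def] assms]
    by (simp add: envelope_ideal_def)
qed

quotient_type U_nT = "nT list \<Rightarrow>\<^sub>0 rat" / "envelope_rel ck_bracket"
  by (rule equivp_envelope_rel)

instantiation U_nT :: rat_vector
begin
lift_definition zero_U_nT :: U_nT is 0 .
lift_definition plus_U_nT :: "U_nT \<Rightarrow> U_nT \<Rightarrow> U_nT" is "(+)"
  unfolding envelope_rel_def envelope_ideal_def by (rule diff_in_span_add)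
lift_definition minus_U_nT :: "U_nT \<Rightarrow> U_nT \<Rightarrow> U_nT" is "(-)"
  unfolding envelope_rel_def envelope_ideal_def by (rule diff_in_span_diff)
lift_definition uminus_U_nT :: "U_nT \<Rightarrow> U_nT" is uminus
  unfolding envelope_rel_def envelope_ideal_def by (rule diff_in_span_uminus)
lift_definition scaleQ_U_nT :: "rat \<Rightarrow> U_nT \<Rightarrow> U_nT" is scaleQ
  unfolding envelope_rel_def envelope_ideal_def by (rule diff_in_span_scale)
instance
  by (standard; transfer)
    (simp_all add: envelope_rel_def envelope_ideal_def rat_vector.span_zero algebra_simps
      scaleQ_add_right scaleQ_add_left scaleQ_scaleQ)
end

lift_definition U_mult :: "U_nT \<Rightarrow> U_nT \<Rightarrow> U_nT" is free_mult
proof -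
  fix p p' q q' :: "nT list \<Rightarrow>\<^sub>0 rat"
  assume rel: "envelope_rel ck_bracket p p'" "envelope_rel ck_bracket q q'"
  note fm = qbilinearD[OF qbilinear_free_mult]
  have "free_mult p q - free_mult p' q' = free_mult (p - p') q + free_mult p' (q - q')"
    by (simp add: qlinear_diff[OF fm(1)] qlinear_diff[OF fm(2)])
  also have "\<dots> \<in> envelope_ideal ck_bracket"
    using rel unfolding envelope_rel_def by (intro envelope_ideal_add envelope_ideal_mult)
  finally show "envelope_rel ck_bracket (free_mult p q) (free_mult p' q')"
    by (simp add: envelope_rel_def)
qed

lift_definition U_one :: U_nT is "word []" .

definition U_incl :: "nT \<Rightarrow> U_nT" where
  "U_incl x = abs_U_nT (word [x])"

lemma qlinear_abs_U_nT: "qlinear abs_U_nT"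
  by (rule qlinearI) (simp_all add: plus_U_nT.abs_eq scaleQ_U_nT.abs_eq)

lemma abs_U_nT_mult: "abs_U_nT (free_mult p q) = U_mult (abs_U_nT p) (abs_U_nT q)"
  by (simp add: U_mult.abs_eq)

lemma abs_U_nT_eqI: "p - q \<in> envelope_relations ck_bracket \<Longrightarrow> abs_U_nT p = abs_U_nT q"
  using envelope_idealI[of "p - q" ck_bracket "word []" "word []"]
  by (simp add: U_nT.abs_eq_iff envelope_rel_def free_mult_one)

lemma U_incl_linear: "qlinear U_incl"
proof (rule qlinearI)
  fix x y :: nT and c
  show "U_incl (x + y) = U_incl x + U_incl y"
    unfolding U_incl_def plus_U_nT.abs_eq
    by (rule abs_U_nT_eqI) (auto simp: envelope_relations_def diff_diff_eq)
  show "U_incl (c *\<^sub>Q x) = c *\<^sub>Q U_incl x"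
    unfolding U_incl_def scaleQ_U_nT.abs_eq
    by (rule abs_U_nT_eqI) (auto simp: envelope_relations_def)
qed

lemma U_incl_bracket:
  "U_incl (ck_bracket x y) = U_mult (U_incl x) (U_incl y) - U_mult (U_incl y) (U_incl x)"
proof -
  have "abs_U_nT (word [x, y] - word [y, x]) = abs_U_nT (word [ck_bracket x y])"
    by (rule abs_U_nT_eqI) (auto simp: envelope_relations_def)
  then show ?thesis
    by (simp add: U_incl_def free_mult_word minus_U_nT.abs_eq flip: abs_U_nT_mult)
qed

lemma abs_rep_U_nT: "abs_U_nT (rep_U_nT t) = t"
  by (rule Quotient3_abs_rep[OF Quotient3_U_nT])

lemma qbilinear_U_mult: "qbilinear U_mult"
proof -
  note fm = qbilinearD[OF qbilinear_free_mult]
  have "U_mult s (t + t') = U_mult s t + U_mult s t'" "U_mult (t + t') s = U_mult t s + U_mult t' s"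
    "U_mult s (c *\<^sub>Q t) = c *\<^sub>Q U_mult s t" "U_mult (c *\<^sub>Q t) s = c *\<^sub>Q U_mult t s" for s t t' c
  proof -
    obtain p q q' where "s = abs_U_nT p" "t = abs_U_nT q" "t' = abs_U_nT q'"
      by (metis abs_rep_U_nT)
    then show "U_mult s (t + t') = U_mult s t + U_mult s t'"
      "U_mult (t + t') s = U_mult t s + U_mult t' s"
      "U_mult s (c *\<^sub>Q t) = c *\<^sub>Q U_mult s t" "U_mult (c *\<^sub>Q t) s = c *\<^sub>Q U_mult t s"
      by (simp_all add: qlinear_add[OF fm(1)] qlinear_add[OF fm(2)] qlinear_scale[OF fm(1)]
          qlinear_scale[OF fm(2)] flip: abs_U_nT_mult qlinear_add[OF qlinear_abs_U_nT]
          qlinear_scale[OF qlinear_abs_U_nT])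
  qed
  then show ?thesis by (simp add: qbilinear_def qlinearI)
qed

interpretation U: rat_algebra U_mult U_one
proof
  fix x y z :: U_nT
  show "U_mult (U_mult x y) z = U_mult x (U_mult y z)"
    by transfer (simp add: free_mult_assoc envelope_rel_def envelope_ideal_def rat_vector.span_zero)
  show "U_mult U_one x = x" "U_mult x U_one = x"
    by (transfer, simp add: free_mult_one envelope_rel_def envelope_ideal_def rat_vector.span_zero)+
qed (rule qbilinear_U_mult)

text \<open>
  Comultiplication, counit and antipode are determined by their values on the generators:
  every \<open>x\<close> in the Lie algebra is primitive, the comultiplication and the counit are
  homomorphisms, and the antipode is the antihomomorphism with \<open>x \<mapsto> - x\<close>.
\<close>
fun word_comult :: "nT list \<Rightarrow> (U_nT, U_nT) tensor" where
  "word_comult [] = U_one \<otimes> U_one"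
| "word_comult (x # w) = tensor_mult U_mult (U_incl x \<otimes> U_one + U_one \<otimes> U_incl x) (word_comult w)"

lemma word_comult_append:
  "word_comult (v @ w) = tensor_mult U_mult (word_comult v) (word_comult w)"
  by (induction v) (simp_all add: U.tensor_unit_left U.tensor_mult_assoc)

abbreviation free_comult :: "(nT list \<Rightarrow>\<^sub>0 rat) \<Rightarrow> (U_nT, U_nT) tensor" where
  "free_comult \<equiv> lin_ext word_comult"

lemma free_comult_mult:
  "free_comult (free_mult p q) = tensor_mult U_mult (free_comult p) (free_comult q)"
proof (rule qbilinear_eqI[where b = "\<lambda>p q. free_comult (free_mult p q)"
      and b' = "\<lambda>p q. tensor_mult U_mult (free_comult p) (free_comult q)"])
  note fm = qbilinearD[OF qbilinear_free_mult] and tm = qbilinearD[OF U.qbilinear_tensor_mult]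
  show "qbilinear (\<lambda>p q. free_comult (free_mult p q))"
    unfolding qbilinear_def
    by (auto intro: qlinear_compose[OF fm(1) qlinear_lin_ext] qlinear_compose[OF fm(2) qlinear_lin_ext])
  show "qbilinear (\<lambda>p q. tensor_mult U_mult (free_comult p) (free_comult q))"
    unfolding qbilinear_def
    by (auto intro: qlinear_compose[OF qlinear_lin_ext tm(1)] qlinear_compose[OF qlinear_lin_ext tm(2)])
  show "free_comult (free_mult (word v) (word w)) =
      tensor_mult U_mult (free_comult (word v)) (free_comult (word w))" for v w
    unfolding free_mult_word lin_ext_single scaleQ_one by (rule word_comult_append)
qed

lemma free_comult_relations: "r \<in> envelope_relations ck_bracket \<Longrightarrow> free_comult r = 0"
proof -
  note lin = qlinear_lin_ext[of word_comult] and tm = qbilinearD[OF U.qbilinear_tensor_mult]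
    and bt = qbilinearD[OF qbilinear_tens]
  have one: "word_comult [x] = U_incl x \<otimes> U_one + U_one \<otimes> U_incl x" for x
    by (simp add: U.tensor_unit_right)
  have two: "word_comult [x, y] = U_mult (U_incl x) (U_incl y) \<otimes> U_one + U_incl x \<otimes> U_incl y
      + U_incl y \<otimes> U_incl x + U_one \<otimes> U_mult (U_incl x) (U_incl y)" for x y
    by (simp add: U.tensor_unit_right qlinear_add[OF tm(1)] qlinear_add[OF tm(2)]
        U.tensor_mult_tens U.unit_left U.unit_right)
  note fc = qlinear_diff[OF lin] qlinear_scale[OF lin] lin_ext_single scaleQ_one
  have 1: "free_comult (word [x + y] - word [x] - word [y]) = 0" for x y
    unfolding fc one qlinear_add[OF U_incl_linear] qlinear_add[OF bt(1)] qlinear_add[OF bt(2)]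
    by simp
  have 2: "free_comult (word [c *\<^sub>Q x] - c *\<^sub>Q word [x]) = 0" for c x
    unfolding fc one qlinear_scale[OF U_incl_linear] qlinear_scale[OF bt(1)]
      qlinear_scale[OF bt(2)] scaleQ_add_right
    by simp
  have 3: "free_comult (word [x, y] - word [y, x] - word [ck_bracket x y]) = 0" for x y
    unfolding fc one two U_incl_bracket qlinear_diff[OF bt(1)] qlinear_diff[OF bt(2)]
    by simp
  show "free_comult r = 0" if "r \<in> envelope_relations ck_bracket"
    using that by (auto simp only: envelope_relations_def Un_iff mem_Collect_eq 1 2 3)
qed

lemma qlinear_vanishes_on_ideal:
  assumes "qlinear f"
    and "\<And>a r b. r \<in> envelope_relations br \<Longrightarrow> f (free_mult a (free_mult r b)) = 0"
    and "p - q \<in> envelope_ideal br"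
  shows "f p = f q"
proof -
  have "f (p - q) = 0"
    using envelope_ideal_image[OF assms(1), of br "{}" "p - q"] assms(2,3) by simp
  then show ?thesis by (simp add: qlinear_diff[OF assms(1)])
qed

lift_definition U_comult :: "U_nT \<Rightarrow> (U_nT, U_nT) tensor" is free_comult
proof -
  fix p q :: "nT list \<Rightarrow>\<^sub>0 rat"
  note tm = qbilinearD[OF U.qbilinear_tensor_mult]
  assume "envelope_rel ck_bracket p q"
  then show "free_comult p = free_comult q"
    by (intro qlinear_vanishes_on_ideal[OF qlinear_lin_ext])
      (auto simp: envelope_rel_def free_comult_mult free_comult_relations
        qlinear_0[OF tm(1)] qlinear_0[OF tm(2)])
qed

lemma lookup_free_mult_Nil:
  "Poly_Mapping.lookup (free_mult p q) [] = Poly_Mapping.lookup p [] * Poly_Mapping.lookup q []"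
proof (rule qbilinear_eqI[where b = "\<lambda>p q. Poly_Mapping.lookup (free_mult p q) []"
      and b' = "\<lambda>p q. Poly_Mapping.lookup p [] * Poly_Mapping.lookup q []"])
  note fm = qbilinearD[OF qbilinear_free_mult]
  have lin: "qlinear (\<lambda>p :: 'a list \<Rightarrow>\<^sub>0 rat. Poly_Mapping.lookup p [])"
    by (rule qlinearI) (simp_all add: lookup_add lookup_scaleQ)
  show "qbilinear (\<lambda>p q :: 'a list \<Rightarrow>\<^sub>0 rat. Poly_Mapping.lookup (free_mult p q) [])"
    unfolding qbilinear_def
    by (auto intro: qlinear_compose[OF fm(1) lin] qlinear_compose[OF fm(2) lin])
  show "qbilinear (\<lambda>p q :: 'a list \<Rightarrow>\<^sub>0 rat. Poly_Mapping.lookup p [] * Poly_Mapping.lookup q [])"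
    unfolding qbilinear_def
    by (intro conjI allI; rule qlinearI)
      (simp_all add: lookup_add lookup_scaleQ scaleQ_rat_def algebra_simps)
qed (simp add: free_mult_word lookup_single when_def)

lift_definition U_counit :: "U_nT \<Rightarrow> rat" is "\<lambda>p. Poly_Mapping.lookup p []"
proof -
  fix p q :: "nT list \<Rightarrow>\<^sub>0 rat"
  have lin: "qlinear (\<lambda>p :: nT list \<Rightarrow>\<^sub>0 rat. Poly_Mapping.lookup p [])"
    by (rule qlinearI) (simp_all add: lookup_add lookup_scaleQ)
  have "Poly_Mapping.lookup r [] = 0" if "r \<in> envelope_relations ck_bracket" for r
    using that by (auto simp: envelope_relations_def lookup_minus lookup_scaleQ lookup_single
        when_def scaleQ_rat_def)
  moreover assume "envelope_rel ck_bracket p q"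
  ultimately show "Poly_Mapping.lookup p [] = Poly_Mapping.lookup q []"
    by (intro qlinear_vanishes_on_ideal[OF lin]) (auto simp: envelope_rel_def lookup_free_mult_Nil)
qed

definition free_antipode :: "('l list \<Rightarrow>\<^sub>0 rat) \<Rightarrow> ('l list \<Rightarrow>\<^sub>0 rat)" where
  "free_antipode = lin_ext (\<lambda>w. (- 1) ^ length w *\<^sub>Q word (rev w))"

lemma free_antipode_mult:
  "free_antipode (free_mult p q) = free_mult (free_antipode q) (free_antipode p)"
proof (rule qbilinear_eqI[where b = "\<lambda>p q. free_antipode (free_mult p q)"
      and b' = "\<lambda>p q. free_mult (free_antipode q) (free_antipode p)"])
  note fm = qbilinearD[OF qbilinear_free_mult]
  have lin: "qlinear (free_antipode :: ('a list \<Rightarrow>\<^sub>0 rat) \<Rightarrow> _)"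
    unfolding free_antipode_def by (rule qlinear_lin_ext)
  show "qbilinear (\<lambda>p q :: 'a list \<Rightarrow>\<^sub>0 rat. free_antipode (free_mult p q))"
    unfolding qbilinear_def
    by (auto intro: qlinear_compose[OF fm(1) lin] qlinear_compose[OF fm(2) lin])
  show "qbilinear (\<lambda>p q :: 'a list \<Rightarrow>\<^sub>0 rat. free_mult (free_antipode q) (free_antipode p))"
    unfolding qbilinear_def
    by (auto intro: qlinear_compose[OF lin fm(1)] qlinear_compose[OF lin fm(2)])
  show "free_antipode (free_mult (word v) (word w)) =
      free_mult (free_antipode (word w)) (free_antipode (word v))" for v w :: "'a list"
    by (simp add: free_antipode_def lin_ext_single qlinear_scale[OF fm(1)] qlinear_scale[OF fm(2)]
        scaleQ_scaleQ power_add free_mult_word mult.commute)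
qed

lift_definition U_antipode :: "U_nT \<Rightarrow> U_nT" is free_antipode
proof -
  fix p q :: "nT list \<Rightarrow>\<^sub>0 rat"
  have lin: "qlinear (free_antipode :: (nT list \<Rightarrow>\<^sub>0 rat) \<Rightarrow> _)"
    unfolding free_antipode_def by (rule qlinear_lin_ext)
  have single: "free_antipode (word [x]) = - word [x]" "free_antipode (word [x, y]) = word [y, x]"
    for x y :: nT
    by (simp_all add: free_antipode_def lin_ext_single scaleQ_one)
  have neg: "free_antipode r = - r" if "r \<in> envelope_relations ck_bracket" for r
    using that unfolding envelope_relations_def
    by (auto simp: qlinear_diff[OF lin] qlinear_scale[OF lin] single)
  have spanning: "free_antipode (free_mult a (free_mult r b)) \<in> envelope_ideal ck_bracket"
    if r: "r \<in> envelope_relations ck_bracket" for a r b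
  proof -
    have "r \<in> envelope_ideal ck_bracket"
      using envelope_idealI[OF r, of "word []" "word []"] by (simp add: free_mult_one)
    then have "free_antipode r \<in> envelope_ideal ck_bracket"
      by (simp add: neg[OF r] envelope_ideal_uminus)
    then show ?thesis
      by (simp add: free_antipode_mult envelope_ideal_mult)
  qed
  assume "envelope_rel ck_bracket p q"
  then have "p - q \<in> envelope_ideal ck_bracket"
    by (simp add: envelope_rel_def)
  from envelope_ideal_image[OF lin spanning[unfolded envelope_ideal_def] this]
  have "free_antipode (p - q) \<in> envelope_ideal ck_bracket"
    by (simp add: envelope_ideal_def)
  then show "envelope_rel ck_bracket (free_antipode p) (free_antipode q)"
    by (simp add: envelope_rel_def qlinear_diff[OF lin])
qed

end

theory Submission
  imports Defs "HOL-Library.Multiset"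
begin

text \<open>
  Orient every edge of a forest away from its root. The admissible cuts then correspond to the
  sets of vertices \<open>U\<close> that are closed under descendants, with P and R the restrictions to
  \<open>U\<close> and to its complement. In this form associativity of the product is the bijection
  between chains \<open>W \<subseteq> U\<close> and pairs \<open>(W, U - W)\<close>, and compatibility
  with the coproduct is the splitting of \<open>U\<close> along a disjoint union.

  The characteristic functions of trees form a copy of the Connes-Kreimer Lie algebra: in
  \<open>\<delta>\<^bsub>S\<^esub> \<times> \<delta>\<^bsub>T\<^esub>\<close> the forest with two trees is symmetric in \<open>S\<close> and
  \<open>T\<close>, and the trees occur with the pre-Lie coefficients. This gives a homomorphism
  from the enveloping algebra. The product \<open>\<delta>\<^bsub>A\<^esub> \<times> \<delta>\<^bsub>B\<^esub>\<close> is a nonzero multiple of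
  \<open>\<delta>\<^bsub>A \<oplus> B\<^esub>\<close> plus forests with fewer trees. Hence the images of one monomial for each
  multiset of trees form a basis, and since these monomials span the enveloping algebra (the
  easy half of the Poincare-Birkhoff-Witt theorem), the homomorphism is bijective. The
  coalgebra axioms are then transported to the enveloping algebra, and the antipode is
  transported back.
\<close>

section \<open>Orienting a rooted tree away from its root\<close>

text \<open>The given notions speak of undirected edges, leaf-to-root paths, components, an arg-min
  root, and a representative picked by \<open>rep_rforest\<close>. All of this is translated once,
  into a vertex set \<open>V\<close> and a parent relation \<open>D\<close> that together determine
  the forest; afterwards P and R are plain restrictions and any isomorphic pair may be used. The
  formal full cut is what makes every closed set occur, including those that contain a root.

  The number of trees equals the number of vertices without a parent. Restricting \<open>D\<close>
  to a closed set and to its complement can only create such vertices, and creates none exactly when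
  no edge is cut; then the complement is closed as well. This single count yields both the leading
  term of a product and the symmetry of its top part.

  The hard half of Poincare-Birkhoff-Witt, the linear independence of the monomials, is obtained
  from the algebra of forests, where their images are triangular for the number of trees.\<close>

definition arborescence :: "ltree \<Rightarrow> (nat \<times> nat) set \<Rightarrow> bool" where
  "arborescence T D \<longleftrightarrow>
     root_of T \<in> vertices T \<and> D \<subseteq> vertices T \<times> vertices T \<and>
     edges T = (\<lambda>(x, y). {x, y}) ` D \<and> single_valued (D\<inverse>) \<and>
     (\<forall>x. (x, root_of T) \<notin> D) \<and> (\<forall>v\<in>vertices T. (root_of T, v) \<in> D\<^sup>*)"

text \<open>A walk is extended vertex by vertex; when the new vertex already lies on the path, the
  path is cut back to it, which keeps the vertices distinct.\<close>

lemma rtrancl_adjacency_imp_path: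
  assumes "(a, b) \<in> (adjacency E)\<^sup>*"
  shows "\<exists>p. is_path E p \<and> hd p = a \<and> last p = b"
  using assms
proof (induction rule: rtrancl_induct)
  case base
  show ?case by (rule exI[of _ "[a]"]) (simp add: is_path_def)
next
  case (step y z)
  then obtain p where p: "is_path E p" "hd p = a" "last p = y" by blast
  show ?case
  proof (cases "z \<in> set p")
    case True
    then obtain xs ys where "p = xs @ z # ys" by (meson split_list)
    with p show ?thesis
      by (intro exI[of _ "xs @ [z]"])
        (auto simp: is_path_def successively_append_iff hd_append split: if_splits)
  next
    case False
    with p step(2) show ?thesis
      by (intro exI[of _ "p @ [z]"])
        (auto simp: is_path_def successively_append_iff adjacency_def)
  qed
qed

text \<open>The witness is the last but one vertex of a shortest walk from \<open>r\<close> to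
  \<open>v\<close>; it serves as the parent in a breadth-first tree.\<close>

lemma ex_parent_closer_to_root:
  assumes "(r, v) \<in> R\<^sup>*" "v \<noteq> r"
  shows "\<exists>w. (w, v) \<in> R \<and> (r, w) \<in> R\<^sup>* \<and>
    (LEAST n. (r, w) \<in> R ^^ n) < (LEAST n. (r, v) \<in> R ^^ n)"
proof -
  let ?d = "\<lambda>v. LEAST n. (r, v) \<in> R ^^ n"
  have v: "(r, v) \<in> R ^^ ?d v"
    using assms(1) by (metis LeastI rtrancl_power)
  with assms(2) obtain n where n: "?d v = Suc n" by (cases "?d v") auto
  with v obtain w where w: "(r, w) \<in> R ^^ n" "(w, v) \<in> R" by auto
  have "?d w \<le> n" by (rule Least_le) (rule w)
  with w n show ?thesis by (metis le_imp_less_Suc rtrancl_power)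
qed

text \<open>
  A breadth-first spanning tree is an arborescence, and an edge outside it would close a cycle.
\<close>
lemma arborescence_exists:
  assumes T: "rooted_tree T"
  shows "\<exists>D. arborescence T D"
proof -
  define r where "r = root_of T"
  let ?A = "adjacency (edges T)" and ?d = "\<lambda>v. LEAST n. (r, v) \<in> adjacency (edges T) ^^ n"
  have reach: "(r, v) \<in> ?A\<^sup>*" if "v \<in> vertices T" for v
    using T that by (simp add: rooted_tree_def r_def)
  have A_sub: "x \<in> vertices T \<and> y \<in> vertices T" if "(x, y) \<in> ?A" for x y
    using T that by (force simp: rooted_tree_def adjacency_def)
  have "\<exists>w. (w, v) \<in> ?A \<and> ?d w < ?d v" if "v \<in> vertices T" "v \<noteq> r" for v
    using ex_parent_closer_to_root[OF reach[OF that(1)] that(2)] by blast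
  then obtain par where par: "(par v, v) \<in> ?A" "?d (par v) < ?d v"
    if "v \<in> vertices T" "v \<noteq> r" for v
    by metis
  define D where "D = {(par v, v) | v. v \<in> vertices T \<and> v \<noteq> r}"
  have D_sub: "D \<subseteq> vertices T \<times> vertices T"
    using par A_sub by (force simp: D_def)
  have D_reach: "v \<in> vertices T \<Longrightarrow> (r, v) \<in> D\<^sup>*" for v
  proof (induction v rule: measure_induct_rule[of ?d])
    case (less v)
    show ?case
    proof (cases "v = r")
      case False
      then have "(r, par v) \<in> D\<^sup>*"
        using less par A_sub by blast
      moreover have "(par v, v) \<in> D" using False less.prems by (auto simp: D_def)
      ultimately show ?thesis by (rule rtrancl_into_rtrancl)
    qed simp
  qed
  define E where "E = (\<lambda>(x, y). {x, y}) ` D"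
  have E_sub: "E \<subseteq> edges T"
    using par by (auto simp: E_def D_def adjacency_def)
  have "D\<^sup>* \<subseteq> (adjacency E)\<^sup>*"
    by (rule rtrancl_mono) (auto simp: E_def adjacency_def)
  then have E_conn: "(a, b) \<in> (adjacency E)\<^sup>*" if "a \<in> vertices T" "b \<in> vertices T" for a b
    using D_reach that by (meson adjacency_sym rtrancl_trans subsetD)
  have "edges T \<subseteq> E"
  proof
    fix e assume e: "e \<in> edges T"
    then have "card e = 2" "e \<subseteq> vertices T" using T by (auto simp: rooted_tree_def)
    then obtain a b where ab: "e = {a, b}" "a \<noteq> b" "a \<in> vertices T" "b \<in> vertices T"
      by (auto simp: card_2_iff)
    obtain p where p: "is_path E p" "hd p = a" "last p = b"
      using rtrancl_adjacency_imp_path[OF E_conn] ab by blast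
    show "e \<in> E"
    proof (rule ccontr)
      assume "e \<notin> E"
      \<comment> \<open>One vertex would force \<open>a = b\<close>, and two vertices would make
        \<open>e\<close> itself a member of \<open>E\<close>.\<close>
      then have "3 \<le> length p"
        using p ab by (cases p rule: remdups_adj.cases) (auto simp: is_path_def Suc_le_eq split: if_splits)
      moreover have "is_path (edges T) p"
        using p(1) E_sub by (auto simp: is_path_def elim!: successively_mono)
      ultimately have "is_cycle (edges T) p"
        using p e ab by (simp add: is_cycle_def insert_commute)
      then show False using T by (auto simp: rooted_tree_def)
    qed
  qed
  moreover have "single_valued (D\<inverse>)" "\<forall>x. (x, r) \<notin> D"
    by (auto simp: D_def single_valued_def)
  ultimately show ?thesis
    using T D_sub D_reach E_sub unfolding arborescence_def r_def E_def
    by (intro exI[of _ D]) (auto simp: rooted_tree_def)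
qed

context
  fixes T D
  assumes arb: "arborescence T D"
begin

lemma arb_parent_unique: "(x, z) \<in> D \<Longrightarrow> (y, z) \<in> D \<Longrightarrow> x = y"
  using arb by (auto simp: arborescence_def single_valued_def)

lemma arb_root: "(x, root_of T) \<notin> D" "root_of T \<in> vertices T"
  using arb by (auto simp: arborescence_def)

lemma arb_vertices: "(x, y) \<in> D \<Longrightarrow> x \<in> vertices T" "(x, y) \<in> D \<Longrightarrow> y \<in> vertices T"
  using arb by (auto simp: arborescence_def)

lemma arb_reach: "v \<in> vertices T \<Longrightarrow> (root_of T, v) \<in> D\<^sup>*"
  using arb by (auto simp: arborescence_def)

lemma arb_edge_iff: "{x, y} \<in> edges T \<longleftrightarrow> (x, y) \<in> D \<or> (y, x) \<in> D"
  using arb by (auto simp: arborescence_def doubleton_eq_iff)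

lemma arb_edgeE:
  assumes "e \<in> edges T"
  obtains x y where "e = {x, y}" "(x, y) \<in> D"
  using assms arb by (auto simp: arborescence_def)

lemma arb_rtrancl_vertices: "(x, y) \<in> D\<^sup>* \<Longrightarrow> x \<in> vertices T \<Longrightarrow> y \<in> vertices T"
  by (induction rule: rtrancl_induct) (auto dest: arb_vertices)

lemma arb_ancestor_parent: "(x, z) \<in> D\<^sup>* \<Longrightarrow> x \<noteq> z \<Longrightarrow> (y, z) \<in> D \<Longrightarrow> (x, y) \<in> D\<^sup>*"
  by (metis arb_parent_unique rtranclE)

lemma arb_parent_exists: "v \<in> vertices T \<Longrightarrow> v \<noteq> root_of T \<Longrightarrow> \<exists>x. (x, v) \<in> D"
  by (metis arb_reach rtranclE)

text \<open>The root has no parent, so it lies on no cycle; and a cycle through a vertex also passes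
  through its only parent. Induction along the path from the root excludes every vertex.\<close>

lemma arb_acyclic: "acyclic D"
proof (rule acyclicI, rule allI, rule notI)
  fix x assume "(x, x) \<in> D\<^sup>+"
  then have "(root_of T, x) \<in> D\<^sup>*"
    by (metis arb_reach arb_vertices(1) converse_tranclE)
  then have "(x, x) \<notin> D\<^sup>+"
  proof (induction rule: rtrancl_induct)
    case base
    show ?case by (metis arb_root(1) tranclE)
  next
    case (step y z)
    then show ?case
      by (metis arb_parent_unique rtrancl_into_trancl2 tranclD2 )
  qed
  with \<open>(x, x) \<in> D\<^sup>+\<close> show False by simp
qed

lemma arb_antisym: "(x, y) \<in> D\<^sup>* \<Longrightarrow> (y, x) \<in> D\<^sup>* \<Longrightarrow> x = y"
  using arb_acyclic acyclic_impl_antisym_rtrancl antisymD by metis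

text \<open>Climbing is deterministic because parents are unique, so the ancestors of
  \<open>z\<close> form a chain.\<close>

lemma arb_ancestors_comparable:
  assumes "(x, z) \<in> D\<^sup>*" "(y, z) \<in> D\<^sup>*"
  shows "(x, y) \<in> D\<^sup>* \<or> (y, x) \<in> D\<^sup>*"
  using single_valued_confluent[of "D\<inverse>" z x y] arb assms
  by (auto simp: arborescence_def rtrancl_converse)

lemma arb_depth_unique:
  "(root_of T, v) \<in> D ^^ m \<Longrightarrow> (root_of T, v) \<in> D ^^ n \<Longrightarrow> m = n"
proof (induction m arbitrary: v n)
  case 0
  then show ?case using arb_root(1) by (cases n) auto
next
  case (Suc m)
  from Suc.prems(1) obtain y where y: "(root_of T, y) \<in> D ^^ m" "(y, v) \<in> D" by auto
  with Suc.prems(2) arb_root(1) obtain k where k: "n = Suc k" by (cases n) auto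
  with Suc.prems(2) y have "(root_of T, y) \<in> D ^^ k"
    by (auto dest: arb_parent_unique)
  with Suc.IH y k show ?case by blast
qed

text \<open>An undirected walk may also climb, but each climbing step lowers the depth by one. A
  walk of length \<open>k\<close> therefore ends at depth at most \<open>k\<close>.\<close>

lemma arb_tree_dist:
  assumes "(root_of T, v) \<in> D ^^ n"
  shows "tree_dist T (root_of T) v = n"
  unfolding tree_dist_def
proof (rule Least_equality)
  show "(root_of T, v) \<in> adjacency (edges T) ^^ n"
    using assms
  proof (induction n arbitrary: v)
    case (Suc n)
    then obtain y where "(root_of T, y) \<in> D ^^ n" "(y, v) \<in> D" by auto
    with Suc.IH show ?case
      by (intro relpow_Suc_I[of _ y]) (auto simp: adjacency_def arb_edge_iff)
  qed simp
next
  fix k assume "(root_of T, v) \<in> adjacency (edges T) ^^ k"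
  then have "\<exists>m\<le>k. (root_of T, v) \<in> D ^^ m"
  proof (induction k arbitrary: v)
    case (Suc k)
    then obtain y where y: "(root_of T, y) \<in> adjacency (edges T) ^^ k" "(y, v) \<in> adjacency (edges T)"
      by auto
    with Suc.IH obtain m where m: "m \<le> k" "(root_of T, y) \<in> D ^^ m" by blast
    from y(2) consider "(y, v) \<in> D" | "(v, y) \<in> D" by (auto simp: adjacency_def arb_edge_iff)
    then show ?case
    proof cases
      case 1
      with m show ?thesis by (meson Suc_le_mono relpow_Suc_I)
    next
      case 2
      then obtain j where j: "m = Suc j" using m arb_root(1) by (cases m) auto
      with m 2 have "(root_of T, v) \<in> D ^^ j" by (auto dest: arb_parent_unique)
      with m j show ?thesis by (intro exI[of _ j]) auto
    qed
  qed auto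
  then show "n \<le> k" using assms arb_depth_unique by blast
qed

text \<open>All other members of \<open>K\<close> lie strictly deeper than \<open>t\<close>, so the
  choice made by \<open>ARG_MIN\<close> is forced.\<close>

lemma arb_closest_to_root:
  assumes "t \<in> K" "t \<in> vertices T" "\<And>w. w \<in> K \<Longrightarrow> (t, w) \<in> D\<^sup>*"
  shows "closest_to_root T K = t"
proof -
  obtain m where m: "(root_of T, t) \<in> D ^^ m"
    using arb_reach[OF assms(2)] by (auto simp: rtrancl_power)
  have less: "tree_dist T (root_of T) t < tree_dist T (root_of T) w" if w: "w \<in> K" "w \<noteq> t" for w
  proof -
    obtain k where k: "(t, w) \<in> D ^^ k" using assms(3)[OF w(1)] by (auto simp: rtrancl_power)
    with w(2) have "0 < k" by (cases k) auto
    moreover have "(root_of T, w) \<in> D ^^ (m + k)" using m k by (auto simp: relpow_add)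
    ultimately show ?thesis using m by (simp add: arb_tree_dist)
  qed
  have "is_arg_min (tree_dist T (root_of T)) (\<lambda>v. v \<in> K) (closest_to_root T K)"
    unfolding closest_to_root_def by (rule is_arg_min_arg_min_nat) (rule assms(1))
  with less assms(1) show ?thesis by (auto simp: is_arg_min_def)
qed

end

text \<open>The orientation spreads from the root. Edges at the root must leave it; and once the
  edge from \<open>z\<close> to \<open>x\<close> is oriented, any other edge at \<open>x\<close>
  must leave \<open>x\<close>, since \<open>x\<close> cannot have a second parent.\<close>

lemma arborescence_unique:
  assumes D: "arborescence T D" and D': "arborescence T D'"
  shows "D = D'"
proof -
  have "D \<subseteq> D'" if D: "arborescence T D" and D': "arborescence T D'" for D D'
  proof -
    have "(x, y) \<in> D \<Longrightarrow> (root_of T, x) \<in> D\<^sup>* \<Longrightarrow> (x, y) \<in> D'" for x y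
    proof (rotate_tac, induction arbitrary: y rule: rtrancl_induct)
      case base
      then have "{root_of T, y} \<in> edges T" using arb_edge_iff[OF D] by blast
      then show ?case using arb_edge_iff[OF D'] arb_root[OF D'] by blast
    next
      case (step z x)
      have "(x, y) \<in> D' \<or> (y, x) \<in> D'"
        using step.prems arb_edge_iff[OF D] arb_edge_iff[OF D'] by blast
      moreover have "y \<noteq> z"
        using step arb_acyclic[OF D] by (meson acyclic_def r_into_trancl' trancl.simps)
      ultimately show ?case
        using step arb_parent_unique[OF D'] by blast
    qed
    then show ?thesis using arb_reach[OF D] arb_vertices[OF D] by (metis subrelI)
  qed
  from this[OF D D'] this[OF D' D] show ?thesis by blast
qed

definition parent_rel :: "ltree \<Rightarrow> (nat \<times> nat) set" where
  "parent_rel T = (THE D. arborescence T D)"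

lemma parent_rel_eqI: "arborescence T D \<Longrightarrow> parent_rel T = D"
  unfolding parent_rel_def by (rule the_equality) (metis arborescence_unique)+

lemma arborescence_parent_rel: "rooted_tree T \<Longrightarrow> arborescence T (parent_rel T)"
  using arborescence_exists parent_rel_eqI by metis

section \<open>Admissible cuts and descendant-closed vertex sets\<close>

definition closed_subsets :: "'a set \<Rightarrow> ('a \<times> 'a) set \<Rightarrow> 'a set set" where
  "closed_subsets V D = {U. U \<subseteq> V \<and> D `` U \<subseteq> U}"

lemma closed_subsets_rtrancl:
  "U \<in> closed_subsets V D \<Longrightarrow> x \<in> U \<Longrightarrow> (x, y) \<in> D\<^sup>* \<Longrightarrow> y \<in> U"
  by (rotate_tac 2, induction rule: rtrancl_induct) (auto simp: closed_subsets_def)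

text \<open>For an admissible cut these vertices become the roots of the pruned trees. Since parents
  are unique, they determine the cut.\<close>

definition cut_tops :: "(nat \<times> nat) set \<Rightarrow> nat set set \<Rightarrow> nat set" where
  "cut_tops D C = {y. \<exists>x. (x, y) \<in> D \<and> {x, y} \<in> C}"

lemma path_edges_Cons_Cons: "path_edges (a # b # q) = insert {a, b} (path_edges (b # q))"
proof (intro subset_antisym subsetI)
  fix e assume "e \<in> path_edges (a # b # q)"
  then obtain i where "Suc i < length (a # b # q)" "e = {(a # b # q) ! i, (a # b # q) ! Suc i}"
    by (auto simp: path_edges_def)
  then show "e \<in> insert {a, b} (path_edges (b # q))"
    by (cases i) (auto simp: path_edges_def)
next
  fix e assume "e \<in> insert {a, b} (path_edges (b # q))"
  then consider "e = {a, b}"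
    | i where "Suc i < length (b # q)" "e = {(b # q) ! i, (b # q) ! Suc i}"
    by (auto simp: path_edges_def)
  then show "e \<in> path_edges (a # b # q)"
  proof cases
    case 1
    then show ?thesis by (auto simp: path_edges_def intro!: exI[of _ 0])
  next
    case (2 i)
    then show ?thesis by (auto simp: path_edges_def intro!: exI[of _ "Suc i"])
  qed
qed

lemma finite_path_edges: "finite (path_edges p)"
  unfolding path_edges_def
  by (rule finite_image_set, rule finite_subset[of _ "{..<length p}"]) auto

context
  fixes T D
  assumes tree: "rooted_tree T" and arb: "arborescence T D"
begin

lemma finite_arborescence: "finite D"
proof -
  have "D \<subseteq> vertices T \<times> vertices T" using arb by (simp add: arborescence_def)
  moreover have "finite (vertices T)" using tree by (simp add: rooted_tree_def)
  ultimately show ?thesis using finite_subset by blast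
qed

text \<open>A descendant without children exists because the converse of a finite acyclic relation
  is well-founded; its only edge leads to its parent. The root is excluded since \<open>leaf\<close>
  does not admit it.\<close>

lemma ex_leaf_below:
  assumes "v \<in> vertices T" "v \<noteq> root_of T"
  shows "\<exists>l. leaf T l \<and> (v, l) \<in> D\<^sup>*"
proof -
  have "wf (D\<inverse>)"
    using finite_acyclic_wf_converse[OF finite_arborescence arb_acyclic[OF arb]] .
  then obtain l where l: "(v, l) \<in> D\<^sup>*" and max: "\<And>y. (l, y) \<in> D \<Longrightarrow> (v, y) \<notin> D\<^sup>*"
    using wfE_min[of "D\<inverse>" v "{l. (v, l) \<in> D\<^sup>*}"] by auto
  then have childless: "(l, y) \<notin> D" for y by (meson rtrancl_into_rtrancl)
  have root: "l \<noteq> root_of T"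
    using l assms arb_root(1)[OF arb] by (metis rtranclE)
  have lV: "l \<in> vertices T" using arb_rtrancl_vertices[OF arb l assms(1)] .
  obtain x where x: "(x, l) \<in> D" using arb_parent_exists[OF arb lV root] by blast
  have "{e \<in> edges T. l \<in> e} = {{x, l}}"
    using x childless arb_edge_iff[OF arb]
    by (auto elim!: arb_edgeE[OF arb] dest: arb_parent_unique[OF arb])
  with lV root l show ?thesis by (auto simp: leaf_def)
qed

text \<open>Suppose the path stepped down from \<open>x\<close> to \<open>y\<close>. It cannot stop
  at \<open>y\<close>, which is not the root, and by induction it climbs from \<open>y\<close>,
  hence returns to the only parent \<open>x\<close>; but its vertices are distinct.\<close>

lemma path_to_root_descends:
  assumes "is_path (edges T) p" "last p = root_of T"
  shows "successively (\<lambda>x y. (y, x) \<in> D) p"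
  using assms
proof (induction p rule: induct_list012)
  case (3 x y zs)
  then have IH: "successively (\<lambda>x y. (y, x) \<in> D) (y # zs)"
    by (auto simp: is_path_def)
  have "(y, x) \<in> D"
  proof (rule ccontr)
    assume "(y, x) \<notin> D"
    then have xy: "(x, y) \<in> D"
      using 3 arb_edge_iff[OF arb] by (auto simp: is_path_def)
    show False
    proof (cases zs)
      case Nil
      then show ?thesis using 3 xy arb_root(1)[OF arb] by auto
    next
      case (Cons z zs')
      with IH xy have "z = x" using arb_parent_unique[OF arb] by auto
      with Cons 3 show ?thesis by (auto simp: is_path_def)
    qed
  qed
  with IH show ?case by simp
qed auto

lemma path_edgesE:
  assumes "successively (\<lambda>x y. (y, x) \<in> D) p" "e \<in> path_edges p"
  obtains x y where "e = {x, y}" "(x, y) \<in> D" "(y, hd p) \<in> D\<^sup>*"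
  using assms
proof (induction p arbitrary: thesis rule: induct_list012)
  case (3 a b q)
  from 3(5) consider "e = {a, b}" | "e \<in> path_edges (b # q)"
    by (auto simp: path_edges_Cons_Cons)
  then show ?case
  proof cases
    case 1
    with 3 show ?thesis by (auto simp: insert_commute)
  next
    case 2
    with 3 obtain x y where "e = {x, y}" "(x, y) \<in> D" "(y, b) \<in> D\<^sup>*" by auto
    with 3 show ?thesis by (auto intro: rtrancl_into_rtrancl)
  qed
qed (auto simp: path_edges_def)

text \<open>The path passes through every ancestor of its starting vertex, so it uses the edge above
  each of them other than the root.\<close>

lemma edge_in_path_edges:
  assumes "successively (\<lambda>x y. (y, x) \<in> D) p" "p \<noteq> []" "last p = root_of T"
    "(y, hd p) \<in> D\<^sup>*" "(x, y) \<in> D"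
  shows "{x, y} \<in> path_edges p"
  using assms
proof (induction p rule: induct_list012)
  case (2 a)
  then show ?case using arb_root(1)[OF arb] by (auto elim: rtranclE)
next
  case (3 a b q)
  show ?case
  proof (cases "y = a")
    case True
    then show ?thesis
      using 3 arb_parent_unique[OF arb, of x a b] by (auto simp: path_edges_Cons_Cons insert_commute)
  next
    case False
    then show ?thesis
      using 3 arb_ancestor_parent[OF arb, of y a b] by (auto simp: path_edges_Cons_Cons)
  qed
qed auto

text \<open>Admissibility becomes an antichain condition on the cut tops. Two comparable tops lie
  above a common leaf, whose path to the root uses both cut edges. Conversely, the tops of two cut
  edges on one path to the root are ancestors of its first vertex and hence comparable.\<close>

lemma admissible_iff:
  "admissible T C \<longleftrightarrow> C \<subseteq> edges T \<and> (\<forall>y\<in>cut_tops D C. \<forall>z\<in>cut_tops D C. (y, z) \<in> D\<^sup>* \<longrightarrow> y = z)"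
proof safe
  assume "admissible T C"
  then show "e \<in> C \<Longrightarrow> e \<in> edges T" for e by (auto simp: admissible_def)
  fix y z assume yz: "y \<in> cut_tops D C" "z \<in> cut_tops D C" "(y, z) \<in> D\<^sup>*"
  then obtain y' z' where e: "(y', y) \<in> D" "{y', y} \<in> C" "(z', z) \<in> D" "{z', z} \<in> C"
    by (auto simp: cut_tops_def)
  then have "z \<in> vertices T" "z \<noteq> root_of T"
    using arb_vertices[OF arb] arb_root[OF arb] by auto
  then obtain l where l: "leaf T l" "(z, l) \<in> D\<^sup>*" using ex_leaf_below by blast
  then have lV: "l \<in> vertices T" by (simp add: leaf_def)
  have "(l, root_of T) \<in> (adjacency (edges T))\<^sup>*"
    using tree lV by (auto simp: rooted_tree_def)
  from rtrancl_adjacency_imp_path[OF this] obtain p where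
    p: "is_path (edges T) p" "hd p = l" "last p = root_of T" by blast
  note desc = path_to_root_descends[OF p(1,3)]
  have p0: "p \<noteq> []" using p by (simp add: is_path_def)
  have "(y, l) \<in> D\<^sup>*" using yz(3) l(2) by (rule rtrancl_trans)
  then have "{y', y} \<in> path_edges p" "{z', z} \<in> path_edges p"
    using edge_in_path_edges[OF desc p0 p(3)] p(2) l e by auto
  moreover have "card (C \<inter> path_edges p) \<le> 1"
    using \<open>admissible T C\<close> p l by (auto simp: admissible_def)
  ultimately have "{y', y} = {z', z}"
    using e finite_path_edges[of p] by (auto simp: card_le_Suc0_iff_eq)
  then have "y = z \<or> y = z' \<and> y' = z" by (auto simp: doubleton_eq_iff)
  then show "y = z"
    using e yz(3) arb_antisym[OF arb, of y z] by (auto simp: r_into_rtrancl)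
next
  assume C: "C \<subseteq> edges T"
    and anti: "\<forall>y\<in>cut_tops D C. \<forall>z\<in>cut_tops D C. (y, z) \<in> D\<^sup>* \<longrightarrow> y = z"
  show "admissible T C"
    unfolding admissible_def
  proof (intro conjI C allI impI, elim conjE)
    fix v p assume p: "is_path (edges T) p" "last p = root_of T"
    have "e = f" if ef: "e \<in> C \<inter> path_edges p" "f \<in> C \<inter> path_edges p" for e f
    proof -
      obtain x y where xy: "e = {x, y}" "(x, y) \<in> D" "(y, hd p) \<in> D\<^sup>*"
        by (rule path_edgesE[OF path_to_root_descends[OF p]]) (use ef in blast)+
      obtain x' y' where xy': "f = {x', y'}" "(x', y') \<in> D" "(y', hd p) \<in> D\<^sup>*"
        by (rule path_edgesE[OF path_to_root_descends[OF p]]) (use ef in blast)+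
      have "y \<in> cut_tops D C" "y' \<in> cut_tops D C"
        using xy xy' ef by (auto simp: cut_tops_def)
      with anti arb_ancestors_comparable[OF arb xy(3) xy'(3)] have "y = y'" by blast
      with xy xy' arb_parent_unique[OF arb] show ?thesis by auto
    qed
    then show "card (C \<inter> path_edges p) \<le> 1"
      by (subst card_le_Suc0_iff_eq[unfolded One_nat_def[symmetric]])
        (auto simp: finite_path_edges)
  qed
qed

text \<open>A walk that avoids \<open>C\<close> cannot enter the region below a cut top, whose upper
  edge is missing. The directed path from the root to a vertex outside these regions uses no cut
  edge.\<close>

lemma component_root: "component T C (root_of T) = vertices T - D\<^sup>* `` cut_tops D C"
proof
  show "component T C (root_of T) \<subseteq> vertices T - D\<^sup>* `` cut_tops D C"
  proof
    fix w assume "w \<in> component T C (root_of T)"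
    then have "(root_of T, w) \<in> (adjacency (edges T - C))\<^sup>*" by (simp add: component_def)
    then show "w \<in> vertices T - D\<^sup>* `` cut_tops D C"
    proof (induction rule: rtrancl_induct)
      case base
      show ?case
        using arb_root[OF arb] by (auto simp: cut_tops_def elim: rtranclE)
    next
      case (step y z)
      then have e: "{y, z} \<notin> C" "(y, z) \<in> D \<or> (z, y) \<in> D"
        using arb_edge_iff[OF arb] by (auto simp: adjacency_def)
      then have "z \<in> vertices T" using arb_vertices[OF arb] by blast
      moreover have "z \<notin> D\<^sup>* `` cut_tops D C"
      proof
        assume "z \<in> D\<^sup>* `` cut_tops D C"
        then obtain t where t: "t \<in> cut_tops D C" "(t, z) \<in> D\<^sup>*" by blast
        from e(2) have "(t, y) \<in> D\<^sup>*"
        proof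
          assume yz: "(y, z) \<in> D"
          have "t \<noteq> z"
            using t(1) yz e(1) arb_parent_unique[OF arb] by (auto simp: cut_tops_def)
          then show ?thesis using arb_ancestor_parent[OF arb t(2) _ yz] by blast
        next
          assume "(z, y) \<in> D"
          with t(2) show ?thesis by (rule rtrancl_into_rtrancl)
        qed
        with t(1) step.IH show False by blast
      qed
      ultimately show ?case by blast
    qed
  qed
next
  show "vertices T - D\<^sup>* `` cut_tops D C \<subseteq> component T C (root_of T)"
  proof safe
    fix w assume w: "w \<in> vertices T" "w \<notin> D\<^sup>* `` cut_tops D C"
    have "(root_of T, w) \<in> (adjacency (edges T - C))\<^sup>*"
      using arb_reach[OF arb w(1)] w
    proof (induction rule: rtrancl_induct)
      case (step y z)
      then have y: "y \<in> vertices T" "y \<notin> D\<^sup>* `` cut_tops D C"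
        using arb_vertices[OF arb] by (auto intro: rtrancl_into_rtrancl)
      have "{y, z} \<notin> C" using step by (auto simp: cut_tops_def)
      then have "(y, z) \<in> adjacency (edges T - C)"
        using step.hyps arb_edge_iff[OF arb] by (auto simp: adjacency_def)
      with step y show ?case by (meson rtrancl_into_rtrancl)
    qed simp
    then show "w \<in> component T C (root_of T)" by (simp add: component_def)
  qed
qed

text \<open>The edge above \<open>t\<close> is cut, so a walk cannot leave upwards; below
  \<open>t\<close> nothing is cut, since a second cut top there would be comparable with
  \<open>t\<close>.\<close>

lemma component_cut_top:
  assumes C: "admissible T C" and t: "t \<in> cut_tops D C"
  shows "component T C t = D\<^sup>* `` {t}"
proof (intro subset_antisym subsetI)
  fix w assume "w \<in> component T C t"
  then have "(t, w) \<in> (adjacency (edges T - C))\<^sup>*" by (simp add: component_def)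
  then show "w \<in> D\<^sup>* `` {t}"
  proof (induction rule: rtrancl_induct)
    case (step y z)
    then have e: "{y, z} \<notin> C" "(y, z) \<in> D \<or> (z, y) \<in> D"
      using arb_edge_iff[OF arb] by (auto simp: adjacency_def)
    from e(2) have "(t, z) \<in> D\<^sup>*"
    proof
      assume zy: "(z, y) \<in> D"
      have "t \<noteq> y"
        using t e(1) by (auto simp: cut_tops_def insert_commute dest: arb_parent_unique[OF arb zy])
      then show ?thesis using arb_ancestor_parent[OF arb _ _ zy] step.IH by blast
    qed (use step in \<open>auto intro: rtrancl_into_rtrancl\<close>)
    then show ?case by blast
  qed simp
next
  fix w assume "w \<in> D\<^sup>* `` {t}"
  then have "(t, w) \<in> D\<^sup>*" by simp
  then have "(t, w) \<in> (adjacency (edges T - C))\<^sup>*"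
  proof (induction rule: rtrancl_induct)
    case (step y z)
    have "z \<notin> cut_tops D C"
    proof
      assume z: "z \<in> cut_tops D C"
      have "(t, z) \<in> D\<^sup>*" using step by (meson rtrancl_into_rtrancl)
      with C t z have "t = z" by (simp add: admissible_iff)
      with step show False
        using arb_acyclic[OF arb] by (meson acyclic_def rtrancl_into_trancl1)
    qed
    with step have "(y, z) \<in> adjacency (edges T - C)"
      using arb_edge_iff[OF arb] by (auto simp: cut_tops_def adjacency_def)
    with step show ?case by (meson rtrancl_into_rtrancl)
  qed simp
  then show "w \<in> component T C t" by (simp add: component_def)
qed

text \<open>The cut is recovered as the set of edges that enter the closed set. Such an edge must
  end in a cut top, because otherwise its upper end would lie in the closed set too.\<close>

lemma cut_edge_of_closed:
  assumes "admissible T C"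
  shows "C = {{x, y} | x y. (x, y) \<in> D \<and> x \<notin> D\<^sup>* `` cut_tops D C \<and> y \<in> D\<^sup>* `` cut_tops D C}"
proof (rule set_eqI, rule iffI)
  fix e assume e: "e \<in> C"
  then have "e \<in> edges T" using assms by (auto simp: admissible_iff)
  then obtain x y where xy: "e = {x, y}" "(x, y) \<in> D"
    using arb_edgeE[OF arb] by metis
  then have y: "y \<in> cut_tops D C" using e by (auto simp: cut_tops_def)
  have "x \<notin> D\<^sup>* `` cut_tops D C"
  proof
    assume "x \<in> D\<^sup>* `` cut_tops D C"
    then obtain t where t: "t \<in> cut_tops D C" "(t, x) \<in> D\<^sup>*" by blast
    with xy have ty: "(t, y) \<in> D\<^sup>+" by (meson rtrancl_into_trancl1)
    with assms t(1) y have "t = y" by (simp add: admissible_iff trancl_into_rtrancl)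
    with ty show False using arb_acyclic[OF arb] by (simp add: acyclic_def)
  qed
  with xy y show "e \<in> {{x, y} | x y. (x, y) \<in> D \<and> x \<notin> D\<^sup>* `` cut_tops D C \<and> y \<in> D\<^sup>* `` cut_tops D C}"
    by blast
next
  fix e assume "e \<in> {{x, y} | x y. (x, y) \<in> D \<and> x \<notin> D\<^sup>* `` cut_tops D C \<and> y \<in> D\<^sup>* `` cut_tops D C}"
  then obtain x y t where e: "e = {x, y}" "(x, y) \<in> D" "x \<notin> D\<^sup>* `` cut_tops D C"
    "t \<in> cut_tops D C" "(t, y) \<in> D\<^sup>*" by blast
  then have "t = y" using arb_ancestor_parent[OF arb] by blast
  with e show "e \<in> C" using arb_parent_unique[OF arb] by (auto simp: cut_tops_def)
qed

text \<open>The inverse map sends a closed set to the edges entering it. Their lower ends form an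
  antichain: if one lay properly below another, its parent would already belong to the set.\<close>

lemma bij_betw_admissible_closed:
  "bij_betw (\<lambda>C. D\<^sup>* `` cut_tops D C) {C. admissible T C}
     {U \<in> closed_subsets (vertices T) D. root_of T \<notin> U}"
proof (rule bij_betw_byWitness[where f' = "\<lambda>U. {{x, y} | x y. (x, y) \<in> D \<and> x \<notin> U \<and> y \<in> U}"])
  show "\<forall>C\<in>{C. admissible T C}.
      {{x, y} | x y. (x, y) \<in> D \<and> x \<notin> D\<^sup>* `` cut_tops D C \<and> y \<in> D\<^sup>* `` cut_tops D C} = C"
    using cut_edge_of_closed by simp
next
  have tops: "cut_tops D {{x, y} | x y. (x, y) \<in> D \<and> x \<notin> U \<and> y \<in> U} = {y \<in> U. \<exists>x. (x, y) \<in> D \<and> x \<notin> U}"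
    if "U \<in> closed_subsets (vertices T) D" for U
    using that by (auto simp: cut_tops_def doubleton_eq_iff closed_subsets_def)
  show "\<forall>U\<in>{U \<in> closed_subsets (vertices T) D. root_of T \<notin> U}.
      D\<^sup>* `` cut_tops D {{x, y} | x y. (x, y) \<in> D \<and> x \<notin> U \<and> y \<in> U} = U"
  proof safe
    fix U t y assume U: "U \<in> closed_subsets (vertices T) D"
      and "t \<in> cut_tops D {{x, y} | x y. (x, y) \<in> D \<and> x \<notin> U \<and> y \<in> U}" "(t, y) \<in> D\<^sup>*"
    then show "y \<in> U" using closed_subsets_rtrancl[OF U] by (auto simp: tops)
  next
    fix U v assume U: "U \<in> closed_subsets (vertices T) D" "root_of T \<notin> U" and v: "v \<in> U"
    then have "(root_of T, v) \<in> D\<^sup>*" using arb_reach[OF arb] by (auto simp: closed_subsets_def)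
    then show "v \<in> D\<^sup>* `` cut_tops D {{x, y} | x y. (x, y) \<in> D \<and> x \<notin> U \<and> y \<in> U}"
      using v
    proof (induction rule: rtrancl_induct)
      case (step y z)
      show ?case
      proof (cases "y \<in> U")
        case True
        with step show ?thesis by (meson Image_iff rtrancl_into_rtrancl)
      next
        case False
        with step show ?thesis by (auto simp: tops[OF U(1)])
      qed
    qed (use U in simp)
  qed
  show "(\<lambda>U. {{x, y} | x y. (x, y) \<in> D \<and> x \<notin> U \<and> y \<in> U}) `
      {U \<in> closed_subsets (vertices T) D. root_of T \<notin> U} \<subseteq> {C. admissible T C}"
  proof safe
    fix U assume U: "U \<in> closed_subsets (vertices T) D" "root_of T \<notin> U"
    have "y = z" if "y \<in> U" "(x, z) \<in> D" "x \<notin> U" "(y, z) \<in> D\<^sup>*" for x y z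
      using arb_ancestor_parent[OF arb that(4) _ that(2)] closed_subsets_rtrancl[OF U(1) that(1)] that(3)
      by blast
    then show "admissible T {{x, y} | x y. (x, y) \<in> D \<and> x \<notin> U \<and> y \<in> U}"
      unfolding admissible_iff tops[OF U(1)] using arb_edge_iff[OF arb] by blast
  qed
next
  show "(\<lambda>C. D\<^sup>* `` cut_tops D C) ` {C. admissible T C}
      \<subseteq> {U \<in> closed_subsets (vertices T) D. root_of T \<notin> U}"
  proof safe
    fix C
    show "D\<^sup>* `` cut_tops D C \<in> closed_subsets (vertices T) D"
      by (auto simp: closed_subsets_def cut_tops_def intro: rtrancl_into_rtrancl
          dest: arb_vertices[OF arb] arb_rtrancl_vertices[OF arb])
  next
    fix C t assume "(t, root_of T) \<in> D\<^sup>*" "t \<in> cut_tops D C"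
    then show False using arb_root(1)[OF arb] by (auto simp: cut_tops_def elim: rtranclE)
  qed
qed

text \<open>Serves both the trunk and the pruned trees. Assumption \<open>up\<close> keeps the
  directed path from \<open>t\<close> to each vertex of \<open>K\<close> inside
  \<open>K\<close>.\<close>

lemma arborescence_restrict_tree:
  assumes t: "t \<in> K" "t \<in> vertices T" and K: "K \<subseteq> D\<^sup>* `` {t}"
    and C: "\<And>x y. (x, y) \<in> D \<Longrightarrow> x \<in> K \<Longrightarrow> y \<in> K \<Longrightarrow> {x, y} \<notin> C"
    and up: "\<And>x y. (x, y) \<in> D \<Longrightarrow> y \<in> K \<Longrightarrow> y \<noteq> t \<Longrightarrow> x \<in> K"
  shows "arborescence (restrict_tree T C K t) (D \<inter> K \<times> K)"
proof -
  have "(t, v) \<in> (D \<inter> K \<times> K)\<^sup>*" if "v \<in> K" for v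
  proof -
    have "(t, v) \<in> D\<^sup>*" using K that by blast
    then show ?thesis using that
    proof (induction rule: rtrancl_induct)
      case (step y z)
      show ?case
      proof (cases "z = t")
        case False
        with step up have "y \<in> K" by blast
        with step show ?thesis by (meson IntI SigmaI rtrancl_into_rtrancl)
      qed simp
    qed simp
  qed
  moreover have "{e \<in> edges T - C. e \<subseteq> K} = (\<lambda>(x, y). {x, y}) ` (D \<inter> K \<times> K)"
    using C arb_edge_iff[OF arb] by (auto elim!: arb_edgeE[OF arb])
  moreover have "(x, t) \<notin> D \<inter> K \<times> K" for x
    using K arb_acyclic[OF arb] by (auto simp: acyclic_def intro: rtrancl_into_trancl1)
  moreover have "single_valued ((D \<inter> K \<times> K)\<inverse>)"
    using arb_parent_unique[OF arb] by (auto simp: single_valued_def)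
  ultimately show ?thesis
    using t by (auto simp: arborescence_def restrict_tree_def)
qed

lemma parent_rel_trunk:
  "parent_rel (trunk T C) = D \<inter> component T C (root_of T) \<times> component T C (root_of T)"
  unfolding trunk_def
proof (intro parent_rel_eqI arborescence_restrict_tree)
  show "component T C (root_of T) \<subseteq> D\<^sup>* `` {root_of T}"
    using arb_reach[OF arb] by (auto simp: component_root)
  show "{x, y} \<notin> C" if "(x, y) \<in> D" "y \<in> component T C (root_of T)" for x y
    using that by (auto simp: component_root cut_tops_def)
  show "x \<in> component T C (root_of T)" if "(x, y) \<in> D" "y \<in> component T C (root_of T)" for x y
    using that arb_vertices[OF arb] by (auto simp: component_root intro: rtrancl_into_rtrancl)
qed (auto simp: self_in_component arb_root[OF arb])

text \<open>A vertex outside the root component lies below some cut top and hence in its component,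
  so the pruned components correspond to the cut tops, and each top is the vertex closest to the
  root.\<close>

lemma pruned_eq:
  assumes C: "admissible T C"
  shows "pruned T C = (\<lambda>t. restrict_tree T C (D\<^sup>* `` {t}) t) ` cut_tops D C"
proof -
  have top: "t \<in> vertices T" if "t \<in> cut_tops D C" for t
    using that arb_vertices[OF arb] by (auto simp: cut_tops_def)
  have "component T C ` vertices T - {component T C (root_of T)} = (\<lambda>t. D\<^sup>* `` {t}) ` cut_tops D C"
  proof (intro subset_antisym subsetI)
    fix K assume "K \<in> component T C ` vertices T - {component T C (root_of T)}"
    then obtain v where v: "v \<in> vertices T" "component T C v \<noteq> component T C (root_of T)"
      and K: "K = component T C v" by blast
    from v(2) have "v \<notin> component T C (root_of T)"
      by (metis component_eq_iff)
    with v(1) obtain t where t: "t \<in> cut_tops D C" "(t, v) \<in> D\<^sup>*" by (auto simp: component_root)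
    then have "v \<in> component T C t" using component_cut_top[OF C t(1)] by blast
    then have "component T C v = D\<^sup>* `` {t}"
      using component_cut_top[OF C t(1)] component_eq_iff by metis
    with t show "K \<in> (\<lambda>t. D\<^sup>* `` {t}) ` cut_tops D C" unfolding K by blast
  next
    fix K assume "K \<in> (\<lambda>t. D\<^sup>* `` {t}) ` cut_tops D C"
    then obtain t where t: "t \<in> cut_tops D C" and K: "K = component T C t"
      using component_cut_top[OF C] by blast
    have "t \<notin> component T C (root_of T)" using t by (auto simp: component_root)
    then have "K \<noteq> component T C (root_of T)" unfolding K by (metis self_in_component)
    with K top[OF t] show "K \<in> component T C ` vertices T - {component T C (root_of T)}" by blast
  qed
  moreover have "closest_to_root T (D\<^sup>* `` {t}) = t" if "t \<in> cut_tops D C" for t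
    by (rule arb_closest_to_root[OF arb]) (use that top in auto)
  ultimately show ?thesis
    unfolding pruned_def by (auto simp: image_image)
qed

lemma parent_rel_restrict_top:
  assumes C: "admissible T C" and t: "t \<in> cut_tops D C"
  shows "parent_rel (restrict_tree T C (D\<^sup>* `` {t}) t) = D \<inter> (D\<^sup>* `` {t}) \<times> (D\<^sup>* `` {t})"
proof (intro parent_rel_eqI arborescence_restrict_tree)
  show "t \<in> vertices T" using t arb_vertices[OF arb] by (auto simp: cut_tops_def)
  show "{x, y} \<notin> C" if xy: "(x, y) \<in> D" "x \<in> D\<^sup>* `` {t}" for x y
  proof
    assume "{x, y} \<in> C"
    with xy have y: "y \<in> cut_tops D C" by (auto simp: cut_tops_def)
    have ty: "(t, y) \<in> D\<^sup>+" using xy by (auto intro: rtrancl_into_trancl1)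
    then have "t = y" using C t y by (simp add: admissible_iff trancl_into_rtrancl)
    with ty show False using arb_acyclic[OF arb] by (simp add: acyclic_def)
  qed
  show "x \<in> D\<^sup>* `` {t}" if "(x, y) \<in> D" "y \<in> D\<^sup>* `` {t}" "y \<noteq> t" for x y
    using that arb_ancestor_parent[OF arb] by blast
qed auto

end

section \<open>Forests as digraphs\<close>

definition forest_parent :: "ltree set \<Rightarrow> (nat \<times> nat) set" where
  "forest_parent F = (\<Union>T\<in>F. parent_rel T)"

lemma forest_parent_simps [simp]:
  "forest_parent {} = {}" "forest_parent {T} = parent_rel T"
  "forest_parent (F \<union> G) = forest_parent F \<union> forest_parent G"
  by (simp_all add: forest_parent_def)

lemma forest_vertices_simps [simp]:
  "forest_vertices {} = {}" "forest_vertices {T} = vertices T"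
  by (simp_all add: forest_vertices_def)

lemma finite_closed_subsets: "finite V \<Longrightarrow> finite (closed_subsets V D)"
  unfolding closed_subsets_def by (rule finite_subset[of _ "Pow V"]) auto

lemma closed_subset_with_root:
  assumes "rooted_tree T" "U \<in> closed_subsets (vertices T) (parent_rel T)" "root_of T \<in> U"
  shows "U = vertices T"
  using closed_subsets_rtrancl[OF assms(2,3)] arb_reach[OF arborescence_parent_rel[OF assms(1)]]
    assms(2) by (auto simp: closed_subsets_def)

lemma parent_rel_subset: "rooted_tree T \<Longrightarrow> parent_rel T \<subseteq> vertices T \<times> vertices T"
  using arborescence_parent_rel by (simp add: arborescence_def)

lemma forest_vertices_pruned:
  assumes "rooted_tree T"
  shows "forest_vertices (pruned T C) = (parent_rel T)\<^sup>* `` cut_tops (parent_rel T) C"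
proof -
  note A = arborescence_parent_rel[OF assms]
  have "(parent_rel T)\<^sup>* `` cut_tops (parent_rel T) C \<subseteq> vertices T"
    by (auto simp: cut_tops_def dest: arb_vertices[OF A] arb_rtrancl_vertices[OF A])
  with pruned_trunk_partition[OF assms, of C] show ?thesis
    unfolding vertices_trunk component_root[OF assms A] by blast
qed

text \<open>A closed set that contains the root is the whole vertex set; it is the one supplied by
  the formal full cut.\<close>

lemma bij_betw_tree_cuts:
  assumes T: "rooted_tree T"
  shows "bij_betw (\<lambda>c. forest_vertices (tree_P T c)) (tree_cuts T)
    (closed_subsets (vertices T) (parent_rel T))"
proof -
  note A = arborescence_parent_rel[OF T]
  let ?f = "\<lambda>c. forest_vertices (tree_P T c)"
    and ?B = "{U \<in> closed_subsets (vertices T) (parent_rel T). root_of T \<notin> U}"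
  have "bij_betw (\<lambda>C. ?f (Edge_Cut C)) {C. admissible T C} ?B"
    using bij_betw_admissible_closed[OF T A] by (simp add: forest_vertices_pruned[OF T])
  moreover have "bij_betw Edge_Cut {C. admissible T C} (Edge_Cut ` {C. admissible T C})"
    by (rule bij_betw_imageI) (auto intro: inj_onI)
  ultimately have 1: "bij_betw ?f (Edge_Cut ` {C. admissible T C}) ?B"
    using bij_betw_comp_iff[of Edge_Cut "{C. admissible T C}" "Edge_Cut ` {C. admissible T C}" ?f ?B]
    by (simp add: comp_def)
  have 2: "bij_betw ?f {Full_Cut} {vertices T}" by simp
  have "vertices T \<in> closed_subsets (vertices T) (parent_rel T)"
    using parent_rel_subset[OF T] by (auto simp: closed_subsets_def)
  then have "closed_subsets (vertices T) (parent_rel T) = {vertices T} \<union> ?B"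
    using closed_subset_with_root[OF T] by auto
  moreover have "{vertices T} \<inter> ?B = {}" using T by (auto simp: rooted_tree_def)
  ultimately show ?thesis
    using bij_betw_combine[OF 2 1] by (simp add: tree_cuts_def)
qed

lemma forest_parent_tree_P_R:
  assumes T: "rooted_tree T" and c: "c \<in> tree_cuts T"
  defines "U \<equiv> forest_vertices (tree_P T c)"
  shows "forest_parent (tree_P T c) = Restr (parent_rel T) U"
    "forest_parent (tree_R T c) = Restr (parent_rel T) (vertices T - U)"
proof -
  note A = arborescence_parent_rel[OF T] and sub = parent_rel_subset[OF T]
  have "forest_parent (tree_P T c) = Restr (parent_rel T) U \<and>
    forest_parent (tree_R T c) = Restr (parent_rel T) (vertices T - U)"
  proof (cases c)
    case Full_Cut
    with sub show ?thesis by (auto simp: U_def)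
  next
    case (Edge_Cut C)
    with c have C: "admissible T C" by (auto simp: tree_cuts_def)
    have U: "U = (parent_rel T)\<^sup>* `` cut_tops (parent_rel T) C"
      by (simp add: U_def Edge_Cut forest_vertices_pruned[OF T])
    have "forest_parent (pruned T C) =
        (\<Union>t\<in>cut_tops (parent_rel T) C. Restr (parent_rel T) ((parent_rel T)\<^sup>* `` {t}))"
      unfolding forest_parent_def pruned_eq[OF T A C]
      by (simp add: parent_rel_restrict_top[OF T A C])
    \<comment> \<open>An edge that starts below a cut top \<open>t\<close> also ends below
      \<open>t\<close>, so every edge inside \<open>U\<close> lies in one of the pruned
      trees.\<close>
    also have "\<dots> = Restr (parent_rel T) U"
      by (auto simp: U intro: rtrancl_into_rtrancl)
    finally show ?thesis
      by (simp add: Edge_Cut parent_rel_trunk[OF T A] component_root[OF T A] U)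
  qed
  then show "forest_parent (tree_P T c) = Restr (parent_rel T) U"
    "forest_parent (tree_R T c) = Restr (parent_rel T) (vertices T - U)" by auto
qed

lemma labeled_forest_treesD:
  assumes "labeled_forest F" "T \<in> F"
  shows "rooted_tree T"
  using assms by (simp add: labeled_forest_def)

lemma labeled_forest_eqI:
  assumes "labeled_forest F" "T \<in> F" "T' \<in> F" "x \<in> vertices T" "x \<in> vertices T'"
  shows "T = T'"
  using assms by (auto simp: labeled_forest_def)

lemma forest_parent_subset:
  assumes "labeled_forest F"
  shows "forest_parent F \<subseteq> forest_vertices F \<times> forest_vertices F"
  using parent_rel_subset[OF labeled_forest_treesD[OF assms]]
  by (force simp: forest_parent_def forest_vertices_def)

lemma forest_parent_inD:
  assumes F: "labeled_forest F" and T: "T \<in> F" and xy: "(x, y) \<in> forest_parent F"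
    and "x \<in> vertices T \<or> y \<in> vertices T"
  shows "(x, y) \<in> parent_rel T"
proof -
  obtain T' where T': "T' \<in> F" "(x, y) \<in> parent_rel T'"
    using xy by (auto simp: forest_parent_def)
  then have "x \<in> vertices T'" "y \<in> vertices T'"
    using parent_rel_subset[OF labeled_forest_treesD[OF F T'(1)]] by auto
  then have "T = T'" using labeled_forest_eqI[OF F T T'(1)] assms(4) by blast
  with T' show ?thesis by simp
qed

context
  fixes F assumes F: "labeled_forest F"
begin

lemma forest_vertices_forest_P:
  "forest_vertices (forest_P F c) = (\<Union>T\<in>F. forest_vertices (tree_P T (c T)))"
  "forest_vertices (forest_R F c) = (\<Union>T\<in>F. forest_vertices (tree_R T (c T)))"
  by (auto simp: forest_vertices_def forest_P_def forest_R_def)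

lemma forest_vertices_P_Int_tree:
  assumes "T \<in> F"
  shows "forest_vertices (forest_P F c) \<inter> vertices T = forest_vertices (tree_P T (c T))"
proof -
  have sub: "forest_vertices (tree_P T (c T)) \<subseteq> vertices T" if "T \<in> F" for T
    using tree_P_R_subset(1)[OF labeled_forest_treesD[OF F that]] .
  then have "T' = T" if "T' \<in> F" "x \<in> vertices T" "x \<in> forest_vertices (tree_P T' (c T'))" for x T'
    using labeled_forest_eqI[OF F that(1) assms _ that(2)] that by blast
  then show ?thesis
    using assms sub[OF assms] by (auto simp: forest_vertices_forest_P)
qed

lemma forest_vertices_R: "forest_vertices (forest_R F c) = forest_vertices F - forest_vertices (forest_P F c)"
proof -
  have T: "vertices T - forest_vertices (forest_P F c) = forest_vertices (tree_R T (c T))" if "T \<in> F" for T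
    using forest_vertices_P_Int_tree[OF that, of c] tree_P_R(3,4)[OF labeled_forest_treesD[OF F that], of "c T"]
    by blast
  have "forest_vertices F - forest_vertices (forest_P F c) = (\<Union>T\<in>F. vertices T - forest_vertices (forest_P F c))"
    by (auto simp: forest_vertices_def)
  then show ?thesis by (simp add: T forest_vertices_forest_P(2))
qed

text \<open>No edge joins two trees, so a closed set of the forest amounts to one closed set in each
  tree, recovered by intersection.\<close>

lemma bij_betw_forest_cuts:
  "bij_betw (\<lambda>c. forest_vertices (forest_P F c)) (forest_cuts F)
     (closed_subsets (forest_vertices F) (forest_parent F))"
  (is "bij_betw ?f _ ?B")
proof (rule bij_betw_imageI)
  note tree = labeled_forest_treesD[OF F]
  show "inj_on ?f (forest_cuts F)"
  proof (rule inj_onI)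
    fix c c' assume c: "c \<in> forest_cuts F" "c' \<in> forest_cuts F" "?f c = ?f c'"
    have "c T = c' T" if "T \<in> F" for T
    proof (rule inj_onD[OF bij_betw_imp_inj_on[OF bij_betw_tree_cuts[OF tree[OF that]]]])
      show "forest_vertices (tree_P T (c T)) = forest_vertices (tree_P T (c' T))"
        using c(3) forest_vertices_P_Int_tree[OF that] by metis
    qed (use c that in \<open>auto simp: forest_cuts_def\<close>)
    then show "c = c'" using c by (auto simp: forest_cuts_def intro: PiE_ext)
  qed
  show "?f ` forest_cuts F = ?B"
  proof (intro subset_antisym subsetI)
    fix U assume "U \<in> ?f ` forest_cuts F"
    then obtain c where c: "c \<in> forest_cuts F" "U = ?f c" by blast
    have "forest_vertices (tree_P T (c T)) \<in> closed_subsets (vertices T) (parent_rel T)" if "T \<in> F" for T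
      using bij_betw_apply[OF bij_betw_tree_cuts[OF tree[OF that]]] c(1) that
      by (auto simp: forest_cuts_def)
    then have cl: "U \<inter> vertices T \<in> closed_subsets (vertices T) (parent_rel T)" if "T \<in> F" for T
      using forest_vertices_P_Int_tree[OF that] that c(2) by simp
    have "U \<subseteq> forest_vertices F"
      unfolding c(2) forest_vertices_forest_P using tree_P_R_subset(1)[OF tree]
      by (force simp: forest_vertices_def[of F])
    moreover have "y \<in> U" if x: "x \<in> U" and xy: "(x, y) \<in> forest_parent F" for x y
    proof -
      obtain T where T: "T \<in> F" "(x, y) \<in> parent_rel T" using xy by (auto simp: forest_parent_def)
      then have "x \<in> vertices T" using parent_rel_subset[OF tree] by blast
      with cl[OF T(1)] T x show ?thesis by (auto simp: closed_subsets_def)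
    qed
    ultimately show "U \<in> ?B" by (auto simp: closed_subsets_def)
  next
    fix U assume U: "U \<in> ?B"
    have "\<exists>c. c \<in> tree_cuts T \<and> forest_vertices (tree_P T c) = U \<inter> vertices T" if "T \<in> F" for T
    proof -
      have "U \<inter> vertices T \<in> closed_subsets (vertices T) (parent_rel T)"
        using U that parent_rel_subset[OF tree[OF that]]
        by (force simp: closed_subsets_def forest_parent_def)
      then have "U \<inter> vertices T \<in> (\<lambda>c. forest_vertices (tree_P T c)) ` tree_cuts T"
        unfolding bij_betw_imp_surj_on[OF bij_betw_tree_cuts[OF tree[OF that]]] .
      then show ?thesis by auto
    qed
    then obtain c where c: "c T \<in> tree_cuts T" "forest_vertices (tree_P T (c T)) = U \<inter> vertices T"
      if "T \<in> F" for T by metis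
    have "U = ?f (restrict c F)"
      using U c(2) by (auto simp: forest_vertices_forest_P closed_subsets_def forest_vertices_def[of F])
    moreover have "restrict c F \<in> forest_cuts F" using c(1) by (auto simp: forest_cuts_def)
    ultimately show "U \<in> ?f ` forest_cuts F" by blast
  qed
qed

lemma forest_parent_forest_P_R:
  assumes c: "c \<in> forest_cuts F"
  defines "U \<equiv> forest_vertices (forest_P F c)"
  shows "forest_parent (forest_P F c) = Restr (forest_parent F) U"
    "forest_parent (forest_R F c) = Restr (forest_parent F) (forest_vertices F - U)"
proof -
  note tree = labeled_forest_treesD[OF F]
  have sub: "x \<in> vertices T" "y \<in> vertices T" if "T \<in> F" "(x, y) \<in> parent_rel T" for T x y
    using parent_rel_subset[OF tree[OF that(1)]] that(2) by auto
  have cT: "c T \<in> tree_cuts T" if "T \<in> F" for T using c that by (auto simp: forest_cuts_def)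
  have "forest_parent (forest_P F c) = (\<Union>T\<in>F. forest_parent (tree_P T (c T)))"
    by (auto simp: forest_parent_def forest_P_def)
  also have "\<dots> = (\<Union>T\<in>F. Restr (parent_rel T) (U \<inter> vertices T))"
    by (simp add: forest_parent_tree_P_R(1)[OF tree cT] U_def forest_vertices_P_Int_tree)
  also have "\<dots> = Restr (forest_parent F) U"
    by (auto simp: forest_parent_def intro: sub)
  finally show "forest_parent (forest_P F c) = Restr (forest_parent F) U" .
  have "forest_parent (forest_R F c) = (\<Union>T\<in>F. forest_parent (tree_R T (c T)))"
    by (auto simp: forest_parent_def forest_R_def)
  also have "\<dots> = (\<Union>T\<in>F. Restr (parent_rel T) (vertices T - U \<inter> vertices T))"
    by (simp add: forest_parent_tree_P_R(2)[OF tree cT] U_def forest_vertices_P_Int_tree)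
  also have "\<dots> = Restr (forest_parent F) (forest_vertices F - U)"
    by (auto simp: forest_parent_def forest_vertices_def intro: sub)
  finally show "forest_parent (forest_R F c) = Restr (forest_parent F) (forest_vertices F - U)" .
qed

end

text \<open>Expresses a tree through its root and the global parent relation, so that the forest can
  be rebuilt from global data.\<close>

lemma vertices_eq_descendants:
  assumes F: "labeled_forest F" and T: "T \<in> F"
  shows "vertices T = (forest_parent F)\<^sup>* `` {root_of T}"
    and "edges T = (\<lambda>(x, y). {x, y}) ` {(x, y) \<in> forest_parent F. x \<in> vertices T}"
proof -
  note A = arborescence_parent_rel[OF labeled_forest_treesD[OF F T]]
  have sub: "parent_rel T \<subseteq> forest_parent F" using T by (auto simp: forest_parent_def)
  show "vertices T = (forest_parent F)\<^sup>* `` {root_of T}"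
  proof (intro subset_antisym subsetI)
    fix v assume "v \<in> vertices T"
    then show "v \<in> (forest_parent F)\<^sup>* `` {root_of T}"
      using arb_reach[OF A] rtrancl_mono[OF sub] by blast
  next
    fix v assume "v \<in> (forest_parent F)\<^sup>* `` {root_of T}"
    then have "(root_of T, v) \<in> (forest_parent F)\<^sup>*" by simp
    then show "v \<in> vertices T"
    proof (induction rule: rtrancl_induct)
      case (step y z)
      then show ?case using forest_parent_inD[OF F T] arb_vertices[OF A] by blast
    qed (rule arb_root[OF A])
  qed
  have "{(x, y) \<in> forest_parent F. x \<in> vertices T} = parent_rel T"
    using forest_parent_inD[OF F T] arb_vertices[OF A] sub by blast
  then show "edges T = (\<lambda>(x, y). {x, y}) ` {(x, y) \<in> forest_parent F. x \<in> vertices T}"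
    using A by (simp add: arborescence_def)
qed

lemma forest_root_iff:
  assumes F: "labeled_forest F" and T: "T \<in> F" and v: "v \<in> vertices T"
  shows "v = root_of T \<longleftrightarrow> v \<notin> Range (forest_parent F)"
proof -
  note A = arborescence_parent_rel[OF labeled_forest_treesD[OF F T]]
  have "v \<in> Range (forest_parent F) \<longleftrightarrow> (\<exists>x. (x, v) \<in> parent_rel T)"
    using forest_parent_inD[OF F T] T v by (auto simp: forest_parent_def)
  then show ?thesis using arb_root(1)[OF A] arb_parent_exists[OF A v] by blast
qed

text \<open>Roots are the vertices without a parent, and each tree consists of the descendants of
  its root. The vertex set belongs to the data because one-vertex trees leave no trace in the parent
  relation.\<close>

lemma labeled_forest_determined:
  assumes F: "labeled_forest F" and F': "labeled_forest F'"
    and "forest_vertices F = forest_vertices F'" "forest_parent F = forest_parent F'"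
  shows "F = F'"
proof -
  have "F \<subseteq> F'" if F: "labeled_forest F" and F': "labeled_forest F'"
    and eq: "forest_vertices F = forest_vertices F'" "forest_parent F = forest_parent F'" for F F'
  proof
    fix T assume T: "T \<in> F"
    have r: "root_of T \<in> vertices T"
      using labeled_forest_treesD[OF F T] by (simp add: rooted_tree_def)
    with T eq(1) obtain T' where T': "T' \<in> F'" "root_of T \<in> vertices T'"
      by (auto simp: forest_vertices_def)
    have root: "root_of T = root_of T'"
      using forest_root_iff[OF F T r] forest_root_iff[OF F' T'] eq by simp
    then have "vertices T = vertices T'" "edges T = edges T'"
      using vertices_eq_descendants[OF F T] vertices_eq_descendants[OF F' T'(1)] eq by auto
    with root have "T = T'" by (simp add: ltree.expand)
    with T' show "T \<in> F'" by simp
  qed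
  from this[OF F F'] this[OF F' F] assms show ?thesis by auto
qed

section \<open>Relabelling, and isomorphism classes of forests as classes of digraphs\<close>

lemma parent_rel_relabel:
  assumes T: "rooted_tree T" and inj: "inj_on h (vertices T)"
  shows "parent_rel (relabel h T) = map_prod h h ` parent_rel T"
proof (rule parent_rel_eqI)
  note A = arborescence_parent_rel[OF T]
  have sub: "parent_rel T \<subseteq> vertices T \<times> vertices T" by (rule parent_rel_subset[OF T])
  have "(h v, h w) \<in> (map_prod h h ` parent_rel T)\<^sup>*" if "(v, w) \<in> (parent_rel T)\<^sup>*" for v w
    using that
  proof (induction rule: rtrancl_induct)
    case (step y z)
    then have "(h y, h z) \<in> map_prod h h ` parent_rel T" by force
    with step show ?case by (meson rtrancl_into_rtrancl)
  qed simp
  moreover have "single_valued ((map_prod h h ` parent_rel T)\<inverse>)"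
    using inj sub A by (auto simp: single_valued_def inj_on_def dest: arb_parent_unique[OF A])
  moreover have "(x, h (root_of T)) \<notin> map_prod h h ` parent_rel T" for x
  proof
    assume "(x, h (root_of T)) \<in> map_prod h h ` parent_rel T"
    then obtain a b where ab: "(a, b) \<in> parent_rel T" "h b = h (root_of T)" by auto
    then have "b = root_of T"
      using inj arb_root(2)[OF A] arb_vertices(2)[OF A] by (meson inj_onD)
    with ab arb_root(1)[OF A] show False by simp
  qed
  moreover have "(\<lambda>e. h ` e) ` edges T = (\<lambda>(x, y). {x, y}) ` map_prod h h ` parent_rel T"
    using A by (simp add: arborescence_def image_image case_prod_unfold)
  ultimately show "arborescence (relabel h T) (map_prod h h ` parent_rel T)"
    using sub arb_root(2)[OF A] arb_reach[OF A] by (auto simp: arborescence_def)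
qed

lemma forest_parent_relabel:
  assumes "labeled_forest F" "inj_on h (forest_vertices F)"
  shows "forest_parent (relabel h ` F) = map_prod h h ` forest_parent F"
proof -
  have "inj_on h (vertices T)" if "T \<in> F" for T
    using assms(2) that by (auto simp: forest_vertices_def intro: inj_on_subset)
  then show ?thesis
    by (simp add: forest_parent_def image_UN parent_rel_relabel labeled_forest_treesD[OF assms(1)])
qed

lemma abs_rforest_eq_iff:
  assumes F: "labeled_forest F" and F': "labeled_forest F'"
  shows "abs_rforest F = abs_rforest F' \<longleftrightarrow>
    (\<exists>h. inj_on h (forest_vertices F) \<and> forest_vertices F' = h ` forest_vertices F \<and>
      forest_parent F' = map_prod h h ` forest_parent F)"
proof -
  have "abs_rforest F = abs_rforest F' \<longleftrightarrow> forest_rel F F'"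
    using Quotient_rel[OF Quotient_rforest] forest_rel_refl F F' by metis
  moreover have "F' = relabel h ` F \<longleftrightarrow>
      forest_vertices F' = h ` forest_vertices F \<and> forest_parent F' = map_prod h h ` forest_parent F"
    if "inj_on h (forest_vertices F)" for h
    using labeled_forest_determined[OF F' labeled_forest_relabel[OF F that]]
      forest_parent_relabel[OF F that] forest_vertices_relabel[of h F] by auto
  ultimately show ?thesis using F F' by (simp add: forest_rel_iff cong: conj_cong)
qed

definition forest_digraph :: "nat set \<Rightarrow> (nat \<times> nat) set \<Rightarrow> bool" where
  "forest_digraph V D \<longleftrightarrow> (\<exists>F. labeled_forest F \<and> forest_vertices F = V \<and> forest_parent F = D)"

text \<open>The description has at most one solution by \<open>labeled_forest_determined\<close>.
  Working with pairs \<open>V\<close>, \<open>D\<close> frees later arguments from the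
  representative chosen by \<open>rep_rforest\<close>.\<close>

definition digraph_class :: "nat set \<Rightarrow> (nat \<times> nat) set \<Rightarrow> rforest" where
  "digraph_class V D =
     abs_rforest (THE F. labeled_forest F \<and> forest_vertices F = V \<and> forest_parent F = D)"

lemma digraph_class_forest:
  assumes "labeled_forest F"
  shows "digraph_class (forest_vertices F) (forest_parent F) = abs_rforest F"
proof -
  have "(THE F'. labeled_forest F' \<and> forest_vertices F' = forest_vertices F \<and>
      forest_parent F' = forest_parent F) = F"
    using assms labeled_forest_determined by (intro the_equality) auto
  then show ?thesis by (simp add: digraph_class_def)
qed

lemma forest_digraph_forest: "labeled_forest F \<Longrightarrow> forest_digraph (forest_vertices F) (forest_parent F)"
  by (auto simp: forest_digraph_def)

lemma forest_digraphD:
  assumes "forest_digraph V D"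
  shows "finite V" "D \<subseteq> V \<times> V"
  using assms finite_forest_vertices forest_parent_subset by (auto simp: forest_digraph_def)

lemma digraph_class_eq_iff:
  assumes "forest_digraph V D" "forest_digraph V' D'"
  shows "digraph_class V D = digraph_class V' D' \<longleftrightarrow>
    (\<exists>h. inj_on h V \<and> V' = h ` V \<and> D' = map_prod h h ` D)"
proof -
  from assms obtain F F' where F: "labeled_forest F" "V = forest_vertices F" "D = forest_parent F"
    "labeled_forest F'" "V' = forest_vertices F'" "D' = forest_parent F'"
    by (auto simp: forest_digraph_def)
  then show ?thesis by (simp add: digraph_class_forest abs_rforest_eq_iff)
qed

lemma forest_digraph_image:
  assumes "forest_digraph V D" "inj_on h V"
  shows "forest_digraph (h ` V) (map_prod h h ` D)"
    "digraph_class (h ` V) (map_prod h h ` D) = digraph_class V D"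
proof -
  from assms(1) obtain F where F: "labeled_forest F" "V = forest_vertices F" "D = forest_parent F"
    by (auto simp: forest_digraph_def)
  with assms(2) show D: "forest_digraph (h ` V) (map_prod h h ` D)"
    using forest_digraph_forest[OF labeled_forest_relabel[of F h]]
    by (simp add: forest_parent_relabel forest_vertices_relabel)
  then show "digraph_class (h ` V) (map_prod h h ` D) = digraph_class V D"
    using assms digraph_class_eq_iff[OF assms(1) D] by auto
qed

text \<open>The two restrictions are P and R of the cut that corresponds to \<open>U\<close>, and
  these are forests.\<close>

lemma forest_digraph_closed_subset:
  assumes "forest_digraph V D" "U \<in> closed_subsets V D"
  shows "forest_digraph U (Restr D U)" "forest_digraph (V - U) (Restr D (V - U))"
proof -
  from assms(1) obtain F where F: "labeled_forest F" "V = forest_vertices F" "D = forest_parent F"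
    by (auto simp: forest_digraph_def)
  obtain c where c: "c \<in> forest_cuts F" "U = forest_vertices (forest_P F c)"
    using bij_betw_imp_surj_on[OF bij_betw_forest_cuts[OF F(1)]] assms(2) F by blast
  show "forest_digraph U (Restr D U)"
    using forest_digraph_forest[OF labeled_forest_P[OF F(1)]] forest_parent_forest_P_R(1)[OF F(1) c(1)] c F
    by metis
  show "forest_digraph (V - U) (Restr D (V - U))"
    using forest_digraph_forest[OF labeled_forest_R[OF F(1)]] forest_parent_forest_P_R(2)[OF F(1) c(1)]
      forest_vertices_R[OF F(1)] c F
    by metis
qed

lemma ex_forest_digraph: "\<exists>V D. forest_digraph V D \<and> X = digraph_class V D"
  using rep_rforest[of X] forest_digraph_forest digraph_class_forest by metis

text \<open>Used to realise several classes on disjoint label sets, by letting \<open>h\<close>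
  range over different residue classes: even and odd labels for two forests, residues modulo 3 for
  three.\<close>

lemma ex_forest_digraph_image:
  assumes "inj (h :: nat \<Rightarrow> nat)"
  shows "\<exists>V D. forest_digraph V D \<and> X = digraph_class V D \<and> V \<subseteq> range h"
proof -
  obtain V D where VD: "forest_digraph V D" "X = digraph_class V D" using ex_forest_digraph by blast
  have "inj_on h V" using assms by (rule inj_on_subset) simp
  from forest_digraph_image[OF VD(1) this] VD(2) show ?thesis
    by (intro exI[of _ "h ` V"] exI[of _ "map_prod h h ` D"]) auto
qed

lemma forest_digraph_Un:
  assumes "forest_digraph V D" "forest_digraph V' D'" "V \<inter> V' = {}"
  shows "forest_digraph (V \<union> V') (D \<union> D')"
proof -
  from assms obtain F F' where F: "labeled_forest F" "V = forest_vertices F" "D = forest_parent F"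
    "labeled_forest F'" "V' = forest_vertices F'" "D' = forest_parent F'"
    by (auto simp: forest_digraph_def)
  with assms(3) have "vertices S \<inter> vertices T = {}" "vertices T \<inter> vertices S = {}"
    if "S \<in> F" "T \<in> F'" for S T
    using that by (auto simp: forest_vertices_def)
  with F(1,4) have "labeled_forest (F \<union> F')"
    unfolding labeled_forest_def by (simp only: finite_Un ball_Un) simp
  from forest_digraph_forest[OF this] F show ?thesis by (simp add: forest_vertices_Un)
qed

text \<open>Replaces the fixed relabelling of \<open>disjoint_sum\<close> by the union of any two
  disjoint representatives.\<close>

lemma forest_sum_digraph_class:
  assumes V: "forest_digraph V D" and V': "forest_digraph V' D'" and disj: "V \<inter> V' = {}"
  shows "forest_sum (digraph_class V D) (digraph_class V' D') = digraph_class (V \<union> V') (D \<union> D')"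
proof -
  define F F' where "F = rep_rforest (digraph_class V D)" and "F' = rep_rforest (digraph_class V' D')"
  have F: "labeled_forest F" "labeled_forest F'"
    "digraph_class (forest_vertices F) (forest_parent F) = digraph_class V D"
    "digraph_class (forest_vertices F') (forest_parent F') = digraph_class V' D'"
    by (simp_all add: F_def F'_def rep_rforest digraph_class_forest)
  obtain h where h: "inj_on h V" "forest_vertices F = h ` V" "forest_parent F = map_prod h h ` D"
    using F(3) digraph_class_eq_iff[OF V forest_digraph_forest[OF F(1)]] by auto
  obtain g where g: "inj_on g V'" "forest_vertices F' = g ` V'" "forest_parent F' = map_prod g g ` D'"
    using F(4) digraph_class_eq_iff[OF V' forest_digraph_forest[OF F(2)]] by auto
  \<comment> \<open>The isomorphism onto \<open>disjoint_sum F F'\<close>: \<open>h\<close> followed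
    by doubling on \<open>V\<close>, and \<open>g\<close> followed by the odd relabelling on
    \<open>V'\<close>.\<close>
  define k where "k x = (if x \<in> V then 2 * h x else 2 * g x + 1)" for x
  note subs = forest_digraphD(2)[OF V] forest_digraphD(2)[OF V']
  have k: "k x = 2 * h x" if "x \<in> V" for x using that by (simp add: k_def)
  have k': "k x = 2 * g x + 1" if "x \<in> V'" for x using that disj by (auto simp: k_def)
  have inj: "inj_on k (V \<union> V')"
  proof (rule inj_onI)
    fix x y assume xy: "x \<in> V \<union> V'" "y \<in> V \<union> V'" "k x = k y"
    have "2 * a \<noteq> Suc (2 * b)" "Suc (2 * b) \<noteq> 2 * a" for a b :: nat by presburger+
    with xy show "x = y" using h(1) g(1) by (auto simp: k k' dest: inj_onD)
  qed
  have "forest_vertices (disjoint_sum F F') = k ` (V \<union> V')"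
    by (auto simp: disjoint_sum_def forest_vertices_Un forest_vertices_relabel h g k k' image_image image_Un)
  moreover have "forest_parent (disjoint_sum F F') = map_prod k k ` (D \<union> D')"
  proof -
    have "forest_parent (disjoint_sum F F') =
        map_prod (\<lambda>n. 2 * n) (\<lambda>n. 2 * n) ` forest_parent F \<union>
        map_prod (\<lambda>n. 2 * n + 1) (\<lambda>n. 2 * n + 1) ` forest_parent F'"
      unfolding disjoint_sum_def
      by (simp add: forest_parent_relabel[OF F(1)] forest_parent_relabel[OF F(2)] inj_on_def)
    also have "\<dots> = map_prod k k ` D \<union> map_prod k k ` D'"
      unfolding h g image_image using subs
      by (intro arg_cong2[where f = "(\<union>)"] image_cong) (auto simp: k k')
    finally show ?thesis by (simp add: image_Un)
  qed
  ultimately have "forest_sum (digraph_class V D) (digraph_class V' D') =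
      digraph_class (k ` (V \<union> V')) (map_prod k k ` (D \<union> D'))"
    using digraph_class_forest[OF labeled_forest_disjoint_sum[OF F(1,2)]]
    by (simp add: forest_sum_def F_def F'_def)
  then show ?thesis
    using forest_digraph_image(2)[OF forest_digraph_Un[OF assms] inj] by simp
qed

section \<open>The product as a sum over descendant-closed sets\<close>

lemma closed_subsets_image:
  assumes "inj_on h V" "D \<subseteq> V \<times> V"
  shows "closed_subsets (h ` V) (map_prod h h ` D) = (`) h ` closed_subsets V D"
proof (intro subset_antisym subsetI)
  fix W assume W: "W \<in> closed_subsets (h ` V) (map_prod h h ` D)"
  let ?U = "{x \<in> V. h x \<in> W}"
  have "W = h ` ?U" using W by (auto simp: closed_subsets_def)
  moreover have "?U \<in> closed_subsets V D"
    using W assms(2) by (force simp: closed_subsets_def)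
  ultimately show "W \<in> (`) h ` closed_subsets V D" by blast
next
  fix W assume "W \<in> (`) h ` closed_subsets V D"
  then obtain U where U: "U \<in> closed_subsets V D" "W = h ` U" by blast
  have "h y \<in> h ` U" if "(x, y) \<in> D" "h x \<in> h ` U" for x y
  proof -
    obtain x' where "x' \<in> U" "h x = h x'" using \<open>h x \<in> h ` U\<close> by blast
    then have "x = x'"
      using U assms that(1) by (auto simp: closed_subsets_def dest: inj_onD)
    with \<open>x' \<in> U\<close> that(1) U show ?thesis by (auto simp: closed_subsets_def)
  qed
  with U show "W \<in> closed_subsets (h ` V) (map_prod h h ` D)"
    by (auto simp: closed_subsets_def) (metis imageI)
qed

lemma Restr_image:
  assumes "inj_on h V" "D \<subseteq> V \<times> V" "U \<subseteq> V"
  shows "Restr (map_prod h h ` D) (h ` U) = map_prod h h ` Restr D U"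
proof -
  have mem: "h a \<in> h ` U \<longleftrightarrow> a \<in> U" if "a \<in> V" for a
    using that assms by (simp add: inj_on_image_mem_iff)
  have "(h a, h b) \<in> map_prod h h ` Restr D U" if "(a, b) \<in> D" "h a \<in> h ` U" "h b \<in> h ` U" for a b
    using that mem assms(2) by (intro rev_image_eqI[of "(a, b)"]) auto
  then show ?thesis by auto (metis imageI)
qed

text \<open>This is the independence of the product from the chosen representative; \<open>P\<close>
  stands for the summand as a function of the two classes.\<close>

lemma sum_closed_subsets_image:
  assumes V: "forest_digraph V D" and inj: "inj_on h V"
  shows "(\<Sum>U\<in>closed_subsets (h ` V) (map_prod h h ` D).
      P (digraph_class U (Restr (map_prod h h ` D) U))
        (digraph_class (h ` V - U) (Restr (map_prod h h ` D) (h ` V - U)))) =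
    (\<Sum>U\<in>closed_subsets V D. P (digraph_class U (Restr D U)) (digraph_class (V - U) (Restr D (V - U))))"
proof -
  note sub = forest_digraphD(2)[OF V]
  have cls: "digraph_class (h ` W) (Restr (map_prod h h ` D) (h ` W)) = digraph_class W (Restr D W)"
    if "W \<subseteq> V" "forest_digraph W (Restr D W)" for W
    using forest_digraph_image(2)[OF that(2) inj_on_subset[OF inj that(1)]]
    by (simp only: Restr_image[OF inj sub that(1)])
  have "inj_on ((`) h) (closed_subsets V D)"
    by (rule inj_on_subset[OF inj_on_image_Pow[OF inj]]) (auto simp: closed_subsets_def)
  moreover have "digraph_class (h ` U) (Restr (map_prod h h ` D) (h ` U)) = digraph_class U (Restr D U)"
    "digraph_class (h ` V - h ` U) (Restr (map_prod h h ` D) (h ` V - h ` U)) =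
      digraph_class (V - U) (Restr D (V - U))" if U: "U \<in> closed_subsets V D" for U
  proof -
    have "U \<subseteq> V" using U by (auto simp: closed_subsets_def)
    moreover from this have "h ` V - h ` U = h ` (V - U)" using inj by (simp add: inj_on_image_set_diff)
    ultimately show "digraph_class (h ` U) (Restr (map_prod h h ` D) (h ` U)) = digraph_class U (Restr D U)"
      "digraph_class (h ` V - h ` U) (Restr (map_prod h h ` D) (h ` V - h ` U)) =
        digraph_class (V - U) (Restr D (V - U))"
      using cls forest_digraph_closed_subset[OF V U] by (simp_all only:) (metis Diff_subset)
  qed
  ultimately show ?thesis
    unfolding closed_subsets_image[OF inj sub] by (simp add: sum.reindex)
qed

text \<open>The working form of the product. The sum over cuts of the fixed representative is
  reindexed by the pruned vertex sets and then carried to an arbitrary representative.\<close>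

lemma lookup_H_mult:
  assumes V: "forest_digraph V D"
  shows "Poly_Mapping.lookup (H_mult f g) (digraph_class V D) =
    (\<Sum>U\<in>closed_subsets V D. Poly_Mapping.lookup f (digraph_class U (Restr D U)) *
       Poly_Mapping.lookup g (digraph_class (V - U) (Restr D (V - U))))"
proof -
  define F where "F = rep_rforest (digraph_class V D)"
  have F: "labeled_forest F" "digraph_class (forest_vertices F) (forest_parent F) = digraph_class V D"
    by (simp_all add: F_def rep_rforest digraph_class_forest)
  obtain h where h: "inj_on h V" "forest_vertices F = h ` V" "forest_parent F = map_prod h h ` D"
    using F(2) digraph_class_eq_iff[OF V forest_digraph_forest[OF F(1)]] by auto
  let ?P = "\<lambda>X Y. Poly_Mapping.lookup f X * Poly_Mapping.lookup g Y"
  have "Poly_Mapping.lookup (H_mult f g) (digraph_class V D) =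
      (\<Sum>c\<in>forest_cuts F. ?P (abs_rforest (forest_P F c)) (abs_rforest (forest_R F c)))"
    by (simp add: H_mult.rep_eq F_def Let_def)
  also have "\<dots> = (\<Sum>c\<in>forest_cuts F.
      let U = forest_vertices (forest_P F c) in
      ?P (digraph_class U (Restr (forest_parent F) U))
        (digraph_class (forest_vertices F - U) (Restr (forest_parent F) (forest_vertices F - U))))"
    unfolding Let_def
  proof (intro sum.cong refl)
    fix c assume "c \<in> forest_cuts F"
    note PR = forest_parent_forest_P_R[OF F(1) this]
    note P = digraph_class_forest[OF labeled_forest_P[OF F(1)], of c, unfolded PR]
      and R = digraph_class_forest[OF labeled_forest_R[OF F(1)], of c,
        unfolded PR forest_vertices_R[OF F(1)]]
    show "?P (abs_rforest (forest_P F c)) (abs_rforest (forest_R F c)) =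
      ?P (digraph_class (forest_vertices (forest_P F c))
          (Restr (forest_parent F) (forest_vertices (forest_P F c))))
        (digraph_class (forest_vertices F - forest_vertices (forest_P F c))
          (Restr (forest_parent F) (forest_vertices F - forest_vertices (forest_P F c))))"
      by (simp only: P R)
  qed
  also have "\<dots> = (\<Sum>U\<in>closed_subsets (forest_vertices F) (forest_parent F).
      ?P (digraph_class U (Restr (forest_parent F) U))
        (digraph_class (forest_vertices F - U) (Restr (forest_parent F) (forest_vertices F - U))))"
    unfolding Let_def by (rule sum.reindex_bij_betw[OF bij_betw_forest_cuts[OF F(1)]])
  also have "\<dots> = (\<Sum>U\<in>closed_subsets V D.
      ?P (digraph_class U (Restr D U)) (digraph_class (V - U) (Restr D (V - U))))"
    unfolding h by (rule sum_closed_subsets_image[OF V h(1)])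
  finally show ?thesis .
qed

section \<open>The bialgebra of forests\<close>

abbreviation delta :: "rforest \<Rightarrow> H_LRF" where
  "delta X \<equiv> Poly_Mapping.single X 1"

abbreviation empty_rforest :: rforest where
  "empty_rforest \<equiv> abs_rforest {}"

lemma forest_digraph_empty: "forest_digraph {} {}" "digraph_class {} {} = empty_rforest"
proof -
  have "labeled_forest {}" by (simp add: labeled_forest_def)
  from forest_digraph_forest[OF this] digraph_class_forest[OF this]
  show "forest_digraph {} {}" "digraph_class {} {} = empty_rforest" by simp_all
qed

lemma digraph_class_eq_empty_iff:
  assumes "forest_digraph V D"
  shows "digraph_class V D = empty_rforest \<longleftrightarrow> V = {}"
proof
  assume "digraph_class V D = empty_rforest"
  then show "V = {}"
    using digraph_class_eq_iff[OF assms forest_digraph_empty(1)] forest_digraph_empty(2) by auto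
next
  assume "V = {}"
  then show "digraph_class V D = empty_rforest"
    using forest_digraphD(2)[OF assms] forest_digraph_empty(2) by simp
qed

lemma forest_sum_commute: "forest_sum X Y = forest_sum Y X"
proof -
  have "inj (\<lambda>n::nat. 2 * n)" "inj (\<lambda>n::nat. 2 * n + 1)" by (auto intro: injI)
  then obtain V D V' D' where V: "forest_digraph V D" "X = digraph_class V D" "V \<subseteq> range (\<lambda>n. 2 * n)"
    "forest_digraph V' D'" "Y = digraph_class V' D'" "V' \<subseteq> range (\<lambda>n. 2 * n + 1)"
    by (metis ex_forest_digraph_image)
  have "even x" if "x \<in> V" for x using that V(3) by auto
  moreover have "odd x" if "x \<in> V'" for x using that V(6) by auto
  ultimately have "V \<inter> V' = {}" by blast
  with V show ?thesis
    using forest_sum_digraph_class[of V D V' D'] forest_sum_digraph_class[of V' D' V D]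
    by (simp add: Un_commute Int_commute)
qed

lemma forest_sum_assoc: "forest_sum (forest_sum X Y) Z = forest_sum X (forest_sum Y Z)"
proof -
  have "inj (\<lambda>n::nat. 3 * n)" "inj (\<lambda>n::nat. 3 * n + 1)" "inj (\<lambda>n::nat. 3 * n + 2)"
    by (auto intro: injI)
  then obtain V D V' D' V'' D'' where
    V: "forest_digraph V D" "X = digraph_class V D" "V \<subseteq> range (\<lambda>n. 3 * n)"
    and V': "forest_digraph V' D'" "Y = digraph_class V' D'" "V' \<subseteq> range (\<lambda>n. 3 * n + 1)"
    and V'': "forest_digraph V'' D''" "Z = digraph_class V'' D''" "V'' \<subseteq> range (\<lambda>n. 3 * n + 2)"
    by (metis ex_forest_digraph_image)
  have 0: "x mod 3 = 0" if "x \<in> V" for x using that V(3) by auto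
  have 1: "x mod 3 = 1" if "x \<in> V'" for x using that V'(3) by auto
  have 2: "x mod 3 = 2" if "x \<in> V''" for x
  proof -
    from that V''(3) obtain n where "x = 3 * n + 2" by blast
    then show ?thesis by presburger
  qed
  have "x \<notin> V'" "x \<notin> V''" if "x \<in> V" for x using 0[OF that] 1[of x] 2[of x] by auto
  moreover have "x \<notin> V''" if "x \<in> V'" for x using 1[OF that] 2[of x] by auto
  ultimately have disj: "V \<inter> V' = {}" "V \<inter> V'' = {}" "V' \<inter> V'' = {}" by blast+
  then have disj': "(V \<union> V') \<inter> V'' = {}" "V \<inter> (V' \<union> V'') = {}" by blast+
  show ?thesis
    unfolding V(2) V'(2) V''(2)
    by (simp add: forest_sum_digraph_class V(1) V'(1) V''(1) disj disj' forest_digraph_Un Un_assoc)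
qed

lemma forest_sum_empty: "forest_sum empty_rforest X = X" "forest_sum X empty_rforest = X"
proof -
  obtain V D where V: "forest_digraph V D" "X = digraph_class V D" using ex_forest_digraph by blast
  show "forest_sum empty_rforest X = X"
    using forest_sum_digraph_class[OF forest_digraph_empty(1) V(1)] V forest_digraph_empty(2) by simp
  then show "forest_sum X empty_rforest = X" by (simp add: forest_sum_commute)
qed

lemma qbilinear_H_mult: "qbilinear H_mult"
  unfolding qbilinear_def
  by (auto intro!: qlinearI poly_mapping_eqI
      simp: H_mult.rep_eq Let_def lookup_add lookup_scaleQ scaleQ_rat_def algebra_simps
        sum.distrib sum_distrib_left)

lemma closed_subsets_Restr:
  assumes "U \<in> closed_subsets V D"
  shows "closed_subsets U (Restr D U) = {W \<in> closed_subsets V D. W \<subseteq> U}"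
  using assms unfolding closed_subsets_def by blast

lemma Restr_Restr: "W \<subseteq> U \<Longrightarrow> Restr (Restr D U) W = Restr D W"
  by blast

text \<open>Edges from \<open>Z\<close> into \<open>W\<close> disappear on restriction, so
  closedness in \<open>V\<close> can only be demanded of the union of \<open>W\<close> and
  \<open>Z\<close>.\<close>

lemma closed_subsets_Restr_Compl:
  assumes "D \<subseteq> V \<times> V" "W \<in> closed_subsets V D"
  shows "closed_subsets (V - W) (Restr D (V - W)) = {Z. Z \<subseteq> V - W \<and> W \<union> Z \<in> closed_subsets V D}"
  using assms unfolding closed_subsets_def by blast

lemma H_mult_assoc: "H_mult (H_mult f g) h = H_mult f (H_mult g h)"
proof (rule poly_mapping_eqI)
  fix X
  obtain V D where V: "forest_digraph V D" "X = digraph_class V D" using ex_forest_digraph by blast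
  note fin = forest_digraphD(1)[OF V(1)]
  let ?K = "closed_subsets V D" and ?L = Poly_Mapping.lookup
  define c where "c W = digraph_class W (Restr D W)" for W
  have left: "?L (H_mult f g) (c U) = (\<Sum>W\<in>{W \<in> ?K. W \<subseteq> U}. ?L f (c W) * ?L g (c (U - W)))"
    if U: "U \<in> ?K" for U
    unfolding c_def lookup_H_mult[OF forest_digraph_closed_subset(1)[OF V(1) U]] closed_subsets_Restr[OF U]
    by (intro sum.cong refl) (simp add: Restr_Restr)
  have right: "?L (H_mult g h) (c (V - W)) =
      (\<Sum>Z\<in>{Z. Z \<subseteq> V - W \<and> W \<union> Z \<in> ?K}. ?L g (c Z) * ?L h (c (V - W - Z)))" if W: "W \<in> ?K" for W
    unfolding c_def lookup_H_mult[OF forest_digraph_closed_subset(2)[OF V(1) W]]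
      closed_subsets_Restr_Compl[OF forest_digraphD(2)[OF V(1)] W]
    by (intro sum.cong refl) (simp add: Restr_Restr)
  have finK: "finite ?K" by (rule finite_closed_subsets[OF fin])
  have "?L (H_mult (H_mult f g) h) X =
      (\<Sum>U\<in>?K. \<Sum>W\<in>{W \<in> ?K. W \<subseteq> U}. ?L f (c W) * ?L g (c (U - W)) * ?L h (c (V - U)))"
    unfolding V(2) lookup_H_mult[OF V(1)] c_def[symmetric] by (simp add: left sum_distrib_right)
  also have "\<dots> = (\<Sum>(U, W)\<in>(SIGMA U:?K. {W \<in> ?K. W \<subseteq> U}).
      ?L f (c W) * ?L g (c (U - W)) * ?L h (c (V - U)))"
    using finK by (subst sum.Sigma) auto
  also have "\<dots> = (\<Sum>(W, Z)\<in>(SIGMA W:?K. {Z. Z \<subseteq> V - W \<and> W \<union> Z \<in> ?K}).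
      ?L f (c W) * ?L g (c Z) * ?L h (c (V - W - Z)))"
  proof (rule sum.reindex_bij_witness[where i = "\<lambda>(W, Z). (W \<union> Z, W)" and j = "\<lambda>(U, W). (W, U - W)"])
    fix p assume "p \<in> (SIGMA U:?K. {W \<in> ?K. W \<subseteq> U})"
    then obtain U W where p: "p = (U, W)" "U \<in> ?K" "W \<in> ?K" "W \<subseteq> U" by auto
    then have "W \<union> (U - W) = U" "V - W - (U - W) = V - U" "U - W \<subseteq> V - W"
      by (auto simp: closed_subsets_def)
    with p show "(case case p of (U, W) \<Rightarrow> (W, U - W) of (W, Z) \<Rightarrow> (W \<union> Z, W)) = p"
      "(case p of (U, W) \<Rightarrow> (W, U - W)) \<in> (SIGMA W:?K. {Z. Z \<subseteq> V - W \<and> W \<union> Z \<in> ?K})"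
      "(case case p of (U, W) \<Rightarrow> (W, U - W) of (W, Z) \<Rightarrow>
        ?L f (c W) * ?L g (c Z) * ?L h (c (V - W - Z))) =
      (case p of (U, W) \<Rightarrow> ?L f (c W) * ?L g (c (U - W)) * ?L h (c (V - U)))"
      by auto
  next
    fix p assume "p \<in> (SIGMA W:?K. {Z. Z \<subseteq> V - W \<and> W \<union> Z \<in> ?K})"
    then obtain W Z where p: "p = (W, Z)" "W \<in> ?K" "Z \<subseteq> V - W" "W \<union> Z \<in> ?K" by auto
    then have "W \<union> Z - W = Z" by blast
    with p show "(case case p of (W, Z) \<Rightarrow> (W \<union> Z, W) of (U, W) \<Rightarrow> (W, U - W)) = p"
      "(case p of (W, Z) \<Rightarrow> (W \<union> Z, W)) \<in> (SIGMA U:?K. {W \<in> ?K. W \<subseteq> U})"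
      by auto
  qed
  also have "\<dots> = (\<Sum>W\<in>?K. \<Sum>Z\<in>{Z. Z \<subseteq> V - W \<and> W \<union> Z \<in> ?K}.
      ?L f (c W) * ?L g (c Z) * ?L h (c (V - W - Z)))"
    using finK fin by (subst sum.Sigma) (auto intro: finite_subset[of _ "Pow V"])
  also have "\<dots> = ?L (H_mult f (H_mult g h)) X"
    unfolding V(2) lookup_H_mult[OF V(1)] c_def[symmetric]
    by (simp add: right sum_distrib_left mult.assoc)
  finally show "?L (H_mult (H_mult f g) h) X = ?L (H_mult f (H_mult g h)) X" .
qed

lemma closed_subsets_trivial: "D \<subseteq> V \<times> V \<Longrightarrow> V \<in> closed_subsets V D" "{} \<in> closed_subsets V D"
  by (auto simp: closed_subsets_def)

text \<open>On the left only the empty closed set contributes, on the right only all of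
  \<open>V\<close>. The latter corresponds to taking the full cut of every tree.\<close>

lemma H_one_H_mult: "H_mult H_one f = f" "H_mult f H_one = f"
proof -
  have "Poly_Mapping.lookup (H_mult H_one f) X = Poly_Mapping.lookup f X \<and>
    Poly_Mapping.lookup (H_mult f H_one) X = Poly_Mapping.lookup f X" for X
  proof -
    obtain V D where V: "forest_digraph V D" "X = digraph_class V D" using ex_forest_digraph by blast
    note sub = forest_digraphD(2)[OF V(1)]
    let ?K = "closed_subsets V D" and ?c = "\<lambda>W. digraph_class W (Restr D W)"
    have fin: "finite ?K" by (rule finite_closed_subsets[OF forest_digraphD(1)[OF V(1)]])
    have eps: "Poly_Mapping.lookup H_one (?c U) = (if U = {} then 1 else 0)"
      "Poly_Mapping.lookup H_one (?c (V - U)) = (if U = V then 1 else 0)" if U: "U \<in> ?K" for U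
    proof -
      have "V - U = {} \<longleftrightarrow> U = V" using U by (auto simp: closed_subsets_def)
      then show "Poly_Mapping.lookup H_one (?c U) = (if U = {} then 1 else 0)"
        "Poly_Mapping.lookup H_one (?c (V - U)) = (if U = V then 1 else 0)"
        using digraph_class_eq_empty_iff[OF forest_digraph_closed_subset(1)[OF V(1) U]]
          digraph_class_eq_empty_iff[OF forest_digraph_closed_subset(2)[OF V(1) U]]
        by (auto simp: H_one_def lookup_single when_def)
    qed
    have D: "Restr D V = D" using sub by blast
    have "Poly_Mapping.lookup (H_mult H_one f) X =
        (\<Sum>U\<in>?K. if U = {} then Poly_Mapping.lookup f (?c (V - U)) else 0)"
      unfolding V(2) lookup_H_mult[OF V(1)] by (intro sum.cong refl) (simp add: eps)
    moreover have "Poly_Mapping.lookup (H_mult f H_one) X =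
        (\<Sum>U\<in>?K. if U = V then Poly_Mapping.lookup f (?c U) else 0)"
      unfolding V(2) lookup_H_mult[OF V(1)] by (intro sum.cong refl) (simp add: eps)
    ultimately show ?thesis
      using fin closed_subsets_trivial(1)[OF sub] closed_subsets_trivial(2)[of V D] by (simp add: D V(2))
  qed
  then show "H_mult H_one f = f" "H_mult f H_one = f" by (auto intro: poly_mapping_eqI)
qed

interpretation H: rat_algebra H_mult H_one
  by unfold_locales (rule qbilinear_H_mult H_mult_assoc H_one_H_mult)+

section \<open>Linear maps on tensor products\<close>

lemma qbilinear_map_tens:
  assumes "qlinear f" "qlinear g"
  shows "qbilinear (\<lambda>x y. f x \<otimes> g y)"
  using qbilinearD[OF qbilinear_tens] assms unfolding qbilinear_def
  by (auto intro: qlinear_compose[where g = "\<lambda>z. _ \<otimes> z"] qlinear_compose[where g = "\<lambda>z. z \<otimes> _"])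

lemma tensor_map_tens: "qlinear f \<Longrightarrow> qlinear g \<Longrightarrow> tensor_map f g (x \<otimes> y) = f x \<otimes> g y"
  by (simp add: tensor_map_def tensor_lift_tens qbilinear_map_tens)

lemma qlinear_tensor_map: "qlinear f \<Longrightarrow> qlinear g \<Longrightarrow> qlinear (tensor_map f g)"
  unfolding tensor_map_def by (rule qlinear_tensor_lift) (rule qbilinear_map_tens)

lemma qbilinear_swap_tens: "qbilinear (\<lambda>x y. y \<otimes> x)"
  using qbilinearD[OF qbilinear_tens] unfolding qbilinear_def by auto

lemma tensor_swap_tens: "tensor_swap (x \<otimes> y) = y \<otimes> x"
  by (simp add: tensor_swap_def tensor_lift_tens qbilinear_swap_tens)

lemma qlinear_tensor_swap: "qlinear tensor_swap"
  unfolding tensor_swap_def by (rule qlinear_tensor_lift[OF qbilinear_swap_tens])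

lemma qbilinear_tens_tens: "qbilinear (\<lambda>x y. x \<otimes> (y \<otimes> z))"
  unfolding qbilinear_def
  by (auto intro: qbilinearD[OF qbilinear_tens]
      qlinear_compose[OF qbilinearD(2)[OF qbilinear_tens] qbilinearD(1)[OF qbilinear_tens]])

lemma qbilinear_tensor_assoc: "qbilinear (\<lambda>t z. tensor_lift (\<lambda>x y. x \<otimes> (y \<otimes> z)) t)"
  unfolding qbilinear_def
proof (intro conjI allI)
  note bt = qbilinearD[OF qbilinear_tens] and b = qbilinear_tens_tens
  note lin = qlinear_tensor_lift[OF b]
  show "qlinear (tensor_lift (\<lambda>x y. x \<otimes> (y \<otimes> z)))" for z by (rule lin)
  show "qlinear (\<lambda>z. tensor_lift (\<lambda>x y. x \<otimes> (y \<otimes> z)) t)" for t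
  proof (rule qlinearI)
    fix z z' c
    show "tensor_lift (\<lambda>x y. x \<otimes> (y \<otimes> (z + z'))) t =
        tensor_lift (\<lambda>x y. x \<otimes> (y \<otimes> z)) t + tensor_lift (\<lambda>x y. x \<otimes> (y \<otimes> z')) t"
      by (rule qlinear_tensor_eqI[OF lin qlinear_plus[OF lin lin]])
        (subst (1 2 3) tensor_lift_tens[OF b], simp add: qlinear_add[OF bt(1)])
    show "tensor_lift (\<lambda>x y. x \<otimes> (y \<otimes> (c *\<^sub>Q z))) t = c *\<^sub>Q tensor_lift (\<lambda>x y. x \<otimes> (y \<otimes> z)) t"
      by (rule qlinear_tensor_eqI[OF lin qlinear_scaleQ[OF lin]])
        (subst (1 2) tensor_lift_tens[OF b], simp add: qlinear_scale[OF bt(1)])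
  qed
qed

lemma tensor_assoc_tens: "tensor_assoc ((x \<otimes> y) \<otimes> z) = x \<otimes> (y \<otimes> z)"
  by (simp add: tensor_assoc_def tensor_lift_tens qbilinear_tensor_assoc qbilinear_tens_tens)

lemma qlinear_tensor_assoc: "qlinear tensor_assoc"
  unfolding tensor_assoc_def by (rule qlinear_tensor_lift[OF qbilinear_tensor_assoc])

section \<open>The comultiplication and the counit\<close>

lemma qlinear_lookup: "qlinear (\<lambda>p :: 'a \<Rightarrow>\<^sub>0 rat. Poly_Mapping.lookup p x)"
  by (rule qlinearI) (simp_all add: lookup_add lookup_scaleQ)

lemma qlinear_tensor_to_fun: "qlinear tensor_to_fun"
  unfolding tensor_to_fun_def by (rule qlinear_tensor_lift[OF qbilinear_pair_product])

lemma tensor_to_fun_tens: "tensor_to_fun (f \<otimes> g) = pair_product f g"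
  unfolding tensor_to_fun_def by (rule tensor_lift_tens[OF qbilinear_pair_product])

lemma tensor_to_fun_eqI:
  assumes "\<And>x y. Poly_Mapping.lookup (tensor_to_fun s) (x, y) = Poly_Mapping.lookup (tensor_to_fun t) (x, y)"
  shows "s = t"
  using bij_is_inj[OF bij_tensor_to_fun] by (rule injD) (use assms in \<open>auto intro: poly_mapping_eqI\<close>)

lemma lookup_tensor_to_fun_H_comult:
  "Poly_Mapping.lookup (tensor_to_fun (H_comult f)) (X, Y) = Poly_Mapping.lookup f (forest_sum X Y)"
  by (simp add: H_comult_def surj_f_inv_f[OF bij_is_surj[OF bij_tensor_to_fun]] H_comult_fun.rep_eq)

lemma qlinear_H_comult: "qlinear H_comult"
  by (rule qlinearI; rule tensor_to_fun_eqI)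
    (simp_all add: lookup_tensor_to_fun_H_comult lookup_add lookup_scaleQ
      qlinear_add[OF qlinear_tensor_to_fun] qlinear_scale[OF qlinear_tensor_to_fun])

text \<open>These are pairs of isomorphism classes rather than of subforests, so each pair occurs in
  the coproduct of \<open>delta X\<close> with coefficient 1.\<close>

definition splittings :: "rforest \<Rightarrow> (rforest \<times> rforest) set" where
  "splittings X = {(A, B). forest_sum A B = X}"

lemma finite_splittings: "finite (splittings X)"
proof (rule finite_subset)
  let ?S = "\<Union>m\<in>{..forest_size X}. {Y. forest_size Y = m}"
  show "splittings X \<subseteq> ?S \<times> ?S" by (auto simp: splittings_def forest_size_sum)
  show "finite (?S \<times> ?S)" using finite_rforests by auto
qed

lemma H_comult_delta: "H_comult (delta X) = (\<Sum>(A, B)\<in>splittings X. delta A \<otimes> delta B)"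
proof (rule tensor_to_fun_eqI)
  fix A B
  have "Poly_Mapping.lookup (tensor_to_fun (\<Sum>(A, B)\<in>splittings X. delta A \<otimes> delta B)) (A, B) =
      (\<Sum>p\<in>splittings X. if p = (A, B) then 1 else 0)"
    unfolding qlinear_sum[OF qlinear_tensor_to_fun] lookup_sum
    by (intro sum.cong refl)
      (auto simp: tensor_to_fun_tens lookup_pair_product lookup_single when_def split: if_splits)
  also have "\<dots> = Poly_Mapping.lookup (tensor_to_fun (H_comult (delta X))) (A, B)"
    using finite_splittings[of X]
    by (auto simp: lookup_tensor_to_fun_H_comult lookup_single when_def splittings_def)
  finally show "Poly_Mapping.lookup (tensor_to_fun (H_comult (delta X))) (A, B) =
    Poly_Mapping.lookup (tensor_to_fun (\<Sum>(A, B)\<in>splittings X. delta A \<otimes> delta B)) (A, B)" by simp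
qed

text \<open>On \<open>delta X\<close> both sides run over the triples of classes with sum
  \<open>X\<close>, grouped in two ways; the reindexing is the associativity of
  \<open>forest_sum\<close>.\<close>

lemma H_coassoc: "tensor_assoc (tensor_map H_comult id (H_comult f)) = tensor_map id H_comult (H_comult f)"
proof (rule qlinear_eqI[where p = f])
  note id = qlinear_id[folded id_def]
  note L = qlinear_tensor_map[OF qlinear_H_comult id] and R = qlinear_tensor_map[OF id qlinear_H_comult]
  note bt = qbilinearD[OF qbilinear_tens]
  show "qlinear (\<lambda>f. tensor_assoc (tensor_map H_comult id (H_comult f)))"
    by (rule qlinear_compose[OF qlinear_compose[OF qlinear_H_comult L] qlinear_tensor_assoc])
  show "qlinear (\<lambda>f. tensor_map id H_comult (H_comult f))"
    by (rule qlinear_compose[OF qlinear_H_comult R])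
  fix X
  have "tensor_assoc (tensor_map H_comult id (H_comult (delta X))) =
      (\<Sum>(A, C)\<in>splittings X. \<Sum>(A', B)\<in>splittings A. delta A' \<otimes> (delta B \<otimes> delta C))"
    by (simp add: H_comult_delta qlinear_sum[OF L] qlinear_sum[OF qlinear_tensor_assoc]
        case_prod_unfold tensor_map_tens[OF qlinear_H_comult id] qlinear_sum[OF bt(2)] tensor_assoc_tens)
  also have "\<dots> = (\<Sum>(p, q)\<in>(SIGMA p:splittings X. splittings (fst p)).
      delta (fst q) \<otimes> (delta (snd q) \<otimes> delta (snd p)))"
    by (simp add: sum.Sigma finite_splittings case_prod_unfold)
  also have "\<dots> = (\<Sum>(p, q)\<in>(SIGMA p:splittings X. splittings (snd p)).
      delta (fst p) \<otimes> (delta (fst q) \<otimes> delta (snd q)))"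
    by (rule sum.reindex_bij_witness[where
          i = "\<lambda>(p, q). ((forest_sum (fst p) (fst q), snd q), (fst p, fst q))" and
          j = "\<lambda>(p, q). ((fst q, forest_sum (snd q) (snd p)), (snd q, snd p))"])
      (auto simp: splittings_def forest_sum_assoc)
  also have "\<dots> = (\<Sum>(A, C)\<in>splittings X. \<Sum>(B, C')\<in>splittings C. delta A \<otimes> (delta B \<otimes> delta C'))"
    by (simp add: sum.Sigma finite_splittings case_prod_unfold)
  also have "\<dots> = tensor_map id H_comult (H_comult (delta X))"
    by (simp add: H_comult_delta qlinear_sum[OF R] case_prod_unfold
        tensor_map_tens[OF id qlinear_H_comult] qlinear_sum[OF bt(1)])
  finally show "tensor_assoc (tensor_map H_comult id (H_comult (delta X))) =
    tensor_map id H_comult (H_comult (delta X))" .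
qed

lemma qlinear_H_counit: "qlinear H_counit"
  unfolding H_counit_def by (rule qlinear_lookup)

lemma H_counit_delta: "H_counit (delta X) = (if X = empty_rforest then 1 else 0)"
  by (simp add: H_counit_def lookup_single when_def)

lemma qbilinear_functional:
  fixes e :: "'a::rat_vector \<Rightarrow> rat"
  assumes "qlinear e"
  shows "qbilinear (\<lambda>y z :: 'b::rat_vector. e y *\<^sub>Q z)" "qbilinear (\<lambda>z :: 'b. \<lambda>y. e y *\<^sub>Q z)"
  unfolding qbilinear_def
  by (auto intro!: qlinearI simp: qlinear_add[OF assms] qlinear_scale[OF assms] scaleQ_add_left
      scaleQ_add_right scaleQ_scaleQ scaleQ_rat_def mult.commute)

lemma H_comult_counit:
  shows "tensor_lift (\<lambda>y z. H_counit y *\<^sub>Q z) (H_comult f) = f"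
    and "tensor_lift (\<lambda>y z. H_counit z *\<^sub>Q y) (H_comult f) = f"
proof -
  note b = qbilinear_functional[OF qlinear_H_counit]
  have *: "(\<Sum>p\<in>splittings X. H_counit (delta (fst p)) *\<^sub>Q delta (snd p)) = delta X" for X
  proof -
    have "(\<Sum>p\<in>splittings X. H_counit (delta (fst p)) *\<^sub>Q delta (snd p)) =
        (\<Sum>p\<in>splittings X. if p = (empty_rforest, X) then delta X else 0)"
      by (intro sum.cong refl)
        (auto simp: H_counit_delta splittings_def forest_sum_empty scaleQ_one)
    then show ?thesis by (simp add: finite_splittings) (simp add: splittings_def forest_sum_empty)
  qed
  have **: "(\<Sum>p\<in>splittings X. H_counit (delta (snd p)) *\<^sub>Q delta (fst p)) = delta X" for X
    unfolding *[of X, symmetric]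
    by (rule sum.reindex_bij_witness[where i = prod.swap and j = prod.swap])
      (auto simp: splittings_def forest_sum_commute)
  show "tensor_lift (\<lambda>y z. H_counit y *\<^sub>Q z) (H_comult f) = f"
    by (rule qlinear_eqI[OF qlinear_compose[OF qlinear_H_comult qlinear_tensor_lift[OF b(1)]] qlinear_id])
      (simp add: H_comult_delta qlinear_sum[OF qlinear_tensor_lift[OF b(1)]] case_prod_unfold
        tensor_lift_tens[OF b(1)] *)
  show "tensor_lift (\<lambda>y z. H_counit z *\<^sub>Q y) (H_comult f) = f"
    by (rule qlinear_eqI[OF qlinear_compose[OF qlinear_H_comult qlinear_tensor_lift[OF b(2)]] qlinear_id])
      (simp add: H_comult_delta qlinear_sum[OF qlinear_tensor_lift[OF b(2)]] case_prod_unfold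
        tensor_lift_tens[OF b(2)] **)
qed

lemma cocommutative_H_comult: "cocommutative H_comult"
  unfolding cocommutative_def
proof
  fix f
  show "tensor_swap (H_comult f) = H_comult f"
  proof (rule qlinear_eqI[OF qlinear_compose[OF qlinear_H_comult qlinear_tensor_swap] qlinear_H_comult])
    fix X
    show "tensor_swap (H_comult (delta X)) = H_comult (delta X)"
      unfolding H_comult_delta qlinear_sum[OF qlinear_tensor_swap]
      by (rule sum.reindex_bij_witness[where i = prod.swap and j = prod.swap])
        (auto simp: splittings_def forest_sum_commute tensor_swap_tens)
  qed
qed

section \<open>Compatibility of the product with the coproduct and the counit\<close>

lemma lookup_tensor_mult_H:
  assumes V: "forest_digraph V D" and V': "forest_digraph V' D'"
  shows "Poly_Mapping.lookup (tensor_to_fun (tensor_mult H_mult s t)) (digraph_class V D, digraph_class V' D') =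
    (\<Sum>U\<in>closed_subsets V D. \<Sum>U'\<in>closed_subsets V' D'.
      Poly_Mapping.lookup (tensor_to_fun s) (digraph_class U (Restr D U), digraph_class U' (Restr D' U')) *
      Poly_Mapping.lookup (tensor_to_fun t)
        (digraph_class (V - U) (Restr D (V - U)), digraph_class (V' - U') (Restr D' (V' - U'))))"
  (is "?lhs s t = ?rhs s t")
proof -
  note tm = qbilinearD[OF H.qbilinear_tensor_mult]
  note lin = qlinear_compose[OF qlinear_tensor_to_fun qlinear_lookup]
  have "qlinear (\<lambda>s. ?lhs s t)" "qlinear (\<lambda>t. ?lhs s t)" for s t
    using qlinear_compose[OF tm(2) lin] qlinear_compose[OF tm(1) lin] by auto
  moreover have "qlinear (\<lambda>s. ?rhs s t)" "qlinear (\<lambda>t. ?rhs s t)" for s t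
    by (rule qlinearI; simp add: qlinear_add[OF qlinear_tensor_to_fun] qlinear_scale[OF qlinear_tensor_to_fun]
        lookup_add lookup_scaleQ scaleQ_rat_def algebra_simps sum.distrib sum_distrib_left)+
  moreover have "?lhs (a \<otimes> b) (a' \<otimes> b') = ?rhs (a \<otimes> b) (a' \<otimes> b')" for a b a' b'
    by (simp add: H.tensor_mult_tens tensor_to_fun_tens lookup_pair_product lookup_H_mult[OF V]
        lookup_H_mult[OF V'] sum_product mult_ac)
  ultimately show ?thesis
    using qlinear_tensor_eqI[of "\<lambda>s. ?lhs s t" "\<lambda>s. ?rhs s t" s] qlinear_tensor_eqI[of "?lhs _" "?rhs _" t]
    by meson
qed

lemma bij_betw_closed_subsets_Un:
  assumes "D \<subseteq> V \<times> V" "D' \<subseteq> V' \<times> V'" "V \<inter> V' = {}"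
  shows "bij_betw (\<lambda>(U, U'). U \<union> U') (closed_subsets V D \<times> closed_subsets V' D')
    (closed_subsets (V \<union> V') (D \<union> D'))"
proof (rule bij_betw_byWitness[where f' = "\<lambda>W. (W \<inter> V, W \<inter> V')"])
  show "\<forall>p\<in>closed_subsets V D \<times> closed_subsets V' D'.
      ((case p of (U, U') \<Rightarrow> U \<union> U') \<inter> V, (case p of (U, U') \<Rightarrow> U \<union> U') \<inter> V') = p"
    using assms(3) by (auto simp: closed_subsets_def)
  show "\<forall>W\<in>closed_subsets (V \<union> V') (D \<union> D'). (case (W \<inter> V, W \<inter> V') of (U, U') \<Rightarrow> U \<union> U') = W"
    by (auto simp: closed_subsets_def)
  show "(\<lambda>(U, U'). U \<union> U') ` (closed_subsets V D \<times> closed_subsets V' D')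
      \<subseteq> closed_subsets (V \<union> V') (D \<union> D')"
    using assms by (fastforce simp: closed_subsets_def)
  show "(\<lambda>W. (W \<inter> V, W \<inter> V')) ` closed_subsets (V \<union> V') (D \<union> D')
      \<subseteq> closed_subsets V D \<times> closed_subsets V' D'"
    using assms by (fastforce simp: closed_subsets_def)
qed

lemma H_comult_mult: "H_comult (H_mult f g) = tensor_mult H_mult (H_comult f) (H_comult g)"
proof (rule tensor_to_fun_eqI)
  fix X Y
  have "inj (\<lambda>n::nat. 2 * n)" "inj (\<lambda>n::nat. 2 * n + 1)" by (auto intro: injI)
  then obtain V D V' D' where V: "forest_digraph V D" "X = digraph_class V D" "V \<subseteq> range (\<lambda>n. 2 * n)"
    and V': "forest_digraph V' D'" "Y = digraph_class V' D'" "V' \<subseteq> range (\<lambda>n. 2 * n + 1)"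
    by (metis ex_forest_digraph_image)
  have "even x" if "x \<in> V" for x using that V(3) by auto
  moreover have "odd x" if "x \<in> V'" for x using that V'(3) by auto
  ultimately have disj: "V \<inter> V' = {}" by blast
  note sub = forest_digraphD(2)[OF V(1)] forest_digraphD(2)[OF V'(1)]
  let ?L = Poly_Mapping.lookup
  let ?K = "closed_subsets V D" and ?K' = "closed_subsets V' D'"
  let ?E = "D \<union> D'"
  define c c' where "c W = digraph_class W (Restr D W)" and "c' W = digraph_class W (Restr D' W)" for W
  have cls: "digraph_class (U \<union> U') (Restr ?E (U \<union> U')) = forest_sum (c U) (c' U')"
    if "U \<subseteq> V" "U' \<subseteq> V'" "forest_digraph U (Restr D U)" "forest_digraph U' (Restr D' U')" for U U'
  proof -
    have "Restr ?E (U \<union> U') = Restr D U \<union> Restr D' U'" using sub disj that(1,2) by blast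
    moreover have "U \<inter> U' = {}" using disj that(1,2) by blast
    ultimately show ?thesis
      using forest_sum_digraph_class[OF that(3,4)] by (simp add: c_def c'_def)
  qed
  have "?L (tensor_to_fun (H_comult (H_mult f g))) (X, Y) = ?L (H_mult f g) (digraph_class (V \<union> V') ?E)"
    by (simp add: lookup_tensor_to_fun_H_comult V(2) V'(2) forest_sum_digraph_class[OF V(1) V'(1) disj])
  also have "\<dots> = (\<Sum>W\<in>closed_subsets (V \<union> V') ?E. ?L f (digraph_class W (Restr ?E W)) *
      ?L g (digraph_class (V \<union> V' - W) (Restr ?E (V \<union> V' - W))))"
    by (rule lookup_H_mult[OF forest_digraph_Un[OF V(1) V'(1) disj]])
  also have "\<dots> = (\<Sum>(U, U')\<in>?K \<times> ?K'. ?L f (digraph_class (U \<union> U') (Restr ?E (U \<union> U'))) *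
      ?L g (digraph_class (V \<union> V' - (U \<union> U')) (Restr ?E (V \<union> V' - (U \<union> U')))))"
    by (subst sum.reindex_bij_betw[OF bij_betw_closed_subsets_Un[OF sub disj], symmetric])
      (simp add: case_prod_unfold)
  also have "\<dots> = (\<Sum>(U, U')\<in>?K \<times> ?K'. ?L f (forest_sum (c U) (c' U')) *
      ?L g (forest_sum (c (V - U)) (c' (V' - U'))))"
  proof (intro sum.cong refl, clarify)
    fix U U' assume U: "U \<in> ?K" "U' \<in> ?K'"
    then have "U \<subseteq> V" "U' \<subseteq> V'" by (auto simp: closed_subsets_def)
    moreover from this have "V \<union> V' - (U \<union> U') = (V - U) \<union> (V' - U')" using disj by blast
    ultimately show "?L f (digraph_class (U \<union> U') (Restr ?E (U \<union> U'))) *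
        ?L g (digraph_class (V \<union> V' - (U \<union> U')) (Restr ?E (V \<union> V' - (U \<union> U')))) =
      ?L f (forest_sum (c U) (c' U')) * ?L g (forest_sum (c (V - U)) (c' (V' - U')))"
      using cls[of U U'] cls[of "V - U" "V' - U'"] forest_digraph_closed_subset[OF V(1) U(1)]
        forest_digraph_closed_subset[OF V'(1) U(2)] by simp
  qed
  also have "\<dots> = ?L (tensor_to_fun (tensor_mult H_mult (H_comult f) (H_comult g))) (X, Y)"
    unfolding V(2) V'(2) lookup_tensor_mult_H[OF V(1) V'(1)] lookup_tensor_to_fun_H_comult c_def c'_def
    by (simp add: sum.cartesian_product)
  finally show "?L (tensor_to_fun (H_comult (H_mult f g))) (X, Y) =
    ?L (tensor_to_fun (tensor_mult H_mult (H_comult f) (H_comult g))) (X, Y)" .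
qed

text \<open>Vertex numbers add under \<open>forest_sum\<close>, so the empty forest splits only into
  two empty forests.\<close>

lemma H_comult_one: "H_comult H_one = H_one \<otimes> H_one"
proof -
  have size: "forest_size empty_rforest = 0"
    by (simp add: forest_size_abs labeled_forest_def)
  have empty: "X = empty_rforest" if "forest_size X = 0" for X
  proof -
    have "forest_vertices (rep_rforest X) = {}"
      using that finite_forest_vertices[OF rep_rforest(1)] by (simp add: forest_size_def)
    then show ?thesis
      using digraph_class_forest[OF rep_rforest(1)] rep_rforest(2)
        digraph_class_eq_empty_iff[OF forest_digraph_forest[OF rep_rforest(1)]] by metis
  qed
  have "forest_sum A B = empty_rforest \<longleftrightarrow> A = empty_rforest \<and> B = empty_rforest" for A B
    using forest_size_sum[of A B] size empty by (metis add_is_0 forest_sum_empty(1))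
  then have "splittings empty_rforest = {(empty_rforest, empty_rforest)}"
    by (auto simp: splittings_def)
  then show ?thesis by (simp add: H_one_def H_comult_delta)
qed

lemma H_counit_mult: "H_counit (H_mult f g) = H_counit f * H_counit g"
proof -
  have "closed_subsets {} {} = {{} :: nat set}" by (auto simp: closed_subsets_def)
  then show ?thesis
    using lookup_H_mult[OF forest_digraph_empty(1), of f g]
    by (simp add: H_counit_def forest_digraph_empty(2))
qed

interpretation H: rat_bialgebra H_mult H_one H_comult H_counit
  by (intro rat_bialgebra.intro rat_coalgebra.intro rat_bialgebra_axioms.intro
      H.rat_algebra_axioms qlinear_H_comult qlinear_H_counit H_coassoc H_comult_counit
      H_comult_mult H_comult_one H_counit_mult) (simp add: H_one_def H_counit_delta)

section \<open>The multiset of trees of a forest\<close>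

text \<open>This turns out to be a complete invariant that takes \<open>forest_sum\<close> to
  multiset addition: classes of forests form the free commutative monoid on
  \<open>rtree\<close>.\<close>

definition trees :: "rforest \<Rightarrow> rtree multiset" where
  "trees X = image_mset abs_rtree (mset_set (rep_rforest X))"

definition tree_forest :: "rtree \<Rightarrow> rforest" where
  "tree_forest A = abs_rforest {rep_rtree A}"

lemma abs_rtree_eqI: "tree_rel T T' \<Longrightarrow> abs_rtree T = abs_rtree T'"
  by (rule Quotient_rel_abs[OF Quotient_rtree])

lemma abs_rtree_relabel:
  "rooted_tree T \<Longrightarrow> inj_on h (vertices T) \<Longrightarrow> abs_rtree (relabel h T) = abs_rtree T"
  using abs_rtree_eqI rooted_tree_relabel by (metis tree_iso_iff tree_rel_def)

lemma trees_abs: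
  assumes F: "labeled_forest F"
  shows "trees (abs_rforest F) = image_mset abs_rtree (mset_set F)"
proof -
  have "forest_rel F (rep_rforest (abs_rforest F))"
    using Quotient_rep_abs[OF Quotient_rforest forest_rel_refl[OF F]]
    by (meson Quotient_symp Quotient_rforest sympD)
  then obtain h \<sigma> where \<sigma>: "bij_betw \<sigma> F (rep_rforest (abs_rforest F))" "\<forall>T\<in>F. tree_iso h T (\<sigma> T)"
    and F': "labeled_forest (rep_rforest (abs_rforest F))"
    by (auto simp: forest_rel_def)
  have \<sigma>_class: "abs_rtree (\<sigma> T) = abs_rtree T" if "T \<in> F" for T
    using that \<sigma> F labeled_forest_treesD[OF F that] abs_rtree_relabel by (auto simp: tree_iso_iff)
  have "mset_set (rep_rforest (abs_rforest F)) = image_mset \<sigma> (mset_set F)"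
    using image_mset_mset_set[OF bij_betw_imp_inj_on[OF \<sigma>(1)]] bij_betw_imp_surj_on[OF \<sigma>(1)] by simp
  then have "trees (abs_rforest F) = image_mset (\<lambda>T. abs_rtree (\<sigma> T)) (mset_set F)"
    unfolding trees_def by (simp only: multiset.map_comp comp_def)
  also have "\<dots> = image_mset abs_rtree (mset_set F)"
    using F by (intro image_mset_cong) (simp add: \<sigma>_class labeled_forest_def)
  finally show ?thesis .
qed

lemma labeled_forest_single: "rooted_tree T \<Longrightarrow> labeled_forest {T}"
  by (simp add: labeled_forest_def)

lemma trees_forest_sum: "trees (forest_sum X Y) = trees X + trees Y"
proof -
  let ?F = "rep_rforest X" and ?G = "rep_rforest Y"
  let ?f = "relabel (\<lambda>n. 2 * n)" and ?g = "relabel (\<lambda>n. 2 * n + 1)"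
  note F = rep_rforest(1)[of X] and G = rep_rforest(1)[of Y]
  have inj: "inj_on (\<lambda>n::nat. 2 * n) A" "inj_on (\<lambda>n::nat. 2 * n + 1) A" for A
    by (auto intro: inj_onI)
  have inj_relabel: "inj_on (relabel h) H" if "inj h" for h H
  proof (rule inj_onI)
    fix S T assume "relabel h S = relabel h T"
    then have "h ` vertices S = h ` vertices T" "(`) h ` edges S = (`) h ` edges T" "h (root_of S) = h (root_of T)"
      by (simp_all add: relabel_def)
    moreover have "inj ((`) h)" using that by (simp add: inj_def inj_image_eq_iff)
    ultimately show "S = T" using that by (auto simp: inj_image_eq_iff inj_eq intro: ltree.expand)
  qed
  have "?f ` ?F \<inter> ?g ` ?G = {}"
  proof (rule ccontr)
    assume "?f ` ?F \<inter> ?g ` ?G \<noteq> {}"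
    then obtain S T where "relabel (\<lambda>n. 2 * n) S = relabel (\<lambda>n. 2 * n + 1) T" by blast
    then have "2 * root_of S = 2 * root_of T + 1" by (simp add: relabel_def)
    then show False by presburger
  qed
  then have "mset_set (disjoint_sum ?F ?G) = image_mset ?f (mset_set ?F) + image_mset ?g (mset_set ?G)"
    using F G inj_relabel inj
    by (simp add: disjoint_sum_def mset_set_Union labeled_forest_def image_mset_mset_set)
  moreover have "abs_rtree (?f T) = abs_rtree T" "abs_rtree (?g T) = abs_rtree T" if "rooted_tree T" for T
    using that inj abs_rtree_relabel by auto
  ultimately show ?thesis
    using F G labeled_forest_disjoint_sum[OF F G]
    by (auto simp: forest_sum_def trees_abs trees_def[of X] trees_def[of Y] multiset.map_comp labeled_forest_def
        intro!: arg_cong2[where f = "(+)"] image_mset_cong)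
qed

lemma tree_forest_abs: "rooted_tree T \<Longrightarrow> tree_forest (abs_rtree T) = abs_rforest {T}"
proof -
  assume T: "rooted_tree T"
  have "tree_rel T (rep_rtree (abs_rtree T))"
    using Quotient_rep_abs[OF Quotient_rtree tree_rel_refl[OF T]]
    by (meson Quotient_symp Quotient_rtree sympD)
  then have "forest_rel {T} {rep_rtree (abs_rtree T)}"
    by (auto simp: forest_rel_iff tree_rel_def tree_iso_iff labeled_forest_single)
  then show ?thesis
    unfolding tree_forest_def using Quotient_rel_abs[OF Quotient_rforest] by metis
qed

lemma trees_tree_forest: "trees (tree_forest A) = {#A#}"
  by (simp add: tree_forest_def trees_abs labeled_forest_single rep_rtree)

lemma trees_empty: "trees empty_rforest = {#}"
  by (simp add: trees_abs labeled_forest_def)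

definition forest_of :: "rtree list \<Rightarrow> rforest" where
  "forest_of L = foldr (\<lambda>A. forest_sum (tree_forest A)) L empty_rforest"

lemma forest_of_simps [simp]:
  "forest_of [] = empty_rforest" "forest_of (A # L) = forest_sum (tree_forest A) (forest_of L)"
  by (simp_all add: forest_of_def)

lemma trees_forest_of: "trees (forest_of L) = mset L"
  by (induction L) (simp_all add: trees_empty trees_forest_sum trees_tree_forest)

lemma forest_of_rotate: "forest_of (L @ A # M) = forest_of (A # L @ M)"
  by (induction L) (auto, metis forest_sum_assoc forest_sum_commute)

lemma forest_of_mset: "mset L = mset M \<Longrightarrow> forest_of L = forest_of M"
proof (induction L arbitrary: M)
  case (Cons A L)
  then have "A \<in> set M" by (metis list.set_intros(1) set_mset_mset)
  then obtain M1 M2 where M: "M = M1 @ A # M2" by (meson split_list)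
  with Cons have "forest_of L = forest_of (M1 @ M2)" by simp
  then show ?case unfolding M forest_of_rotate by simp
qed simp

lemma ex_forest_of: "\<exists>L. X = forest_of L"
proof -
  have "\<exists>L. abs_rforest F = forest_of L" if "finite F" "labeled_forest F" for F
    using that
  proof (induction F rule: finite_induct)
    case empty
    show ?case by (intro exI[of _ "[]"]) simp
  next
    case (insert T F)
    then have T: "rooted_tree T" and F: "labeled_forest F" by (auto simp: labeled_forest_def)
    then obtain L where L: "abs_rforest F = forest_of L" using insert by blast
    have disj: "vertices T \<inter> forest_vertices F = {}"
      using insert.hyps insert.prems by (force simp: labeled_forest_def forest_vertices_def)
    have "abs_rforest (insert T F) =
        digraph_class (forest_vertices (insert T F)) (forest_parent (insert T F))"
      using digraph_class_forest[OF insert.prems] by simp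
    also have "\<dots> = digraph_class (vertices T \<union> forest_vertices F) (parent_rel T \<union> forest_parent F)"
      by (simp add: forest_vertices_def forest_parent_def)
    also have "\<dots> = forest_sum (digraph_class (vertices T) (parent_rel T)) (abs_rforest F)"
      using forest_sum_digraph_class[OF _ forest_digraph_forest[OF F] disj, of "parent_rel T"]
        forest_digraph_forest[OF labeled_forest_single[OF T]] digraph_class_forest[OF F] by simp
    also have "digraph_class (vertices T) (parent_rel T) = tree_forest (abs_rtree T)"
      using digraph_class_forest[OF labeled_forest_single[OF T]] tree_forest_abs[OF T] by simp
    finally show ?case using L by (intro exI[of _ "abs_rtree T # L"]) simp
  qed
  then show ?thesis using rep_rforest[of X] by (metis labeled_forest_def)
qed

text \<open>Each class is \<open>forest_of\<close> some list, and by commutativity of the sum only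
  the multiset of that list matters.\<close>

lemma trees_inject: "trees X = trees Y \<longleftrightarrow> X = Y"
  by (metis ex_forest_of forest_of_mset trees_forest_of)

abbreviation num_trees :: "rforest \<Rightarrow> nat" where
  "num_trees X \<equiv> size (trees X)"

lemma num_trees_eq_0_iff: "num_trees X = 0 \<longleftrightarrow> X = empty_rforest"
  using trees_inject[of X empty_rforest] by (simp add: trees_empty)

lemma num_trees_eq_1_iff: "num_trees X = 1 \<longleftrightarrow> (\<exists>A. X = tree_forest A)"
  by (auto simp: size_1_singleton_mset trees_tree_forest simp flip: trees_inject)

lemma tree_forest_inject: "tree_forest A = tree_forest B \<longleftrightarrow> A = B"
  by (auto simp: trees_tree_forest simp flip: trees_inject)

lemma abs_rforest_eq_tree_forest_iff:
  assumes "labeled_forest F"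
  shows "abs_rforest F = tree_forest A \<longleftrightarrow> (\<exists>T. F = {T} \<and> abs_rtree T = A)"
proof
  assume "abs_rforest F = tree_forest A"
  then have *: "image_mset abs_rtree (mset_set F) = {#A#}"
    using trees_abs[OF assms] trees_tree_forest by metis
  then have "card F = 1" by (metis size_image_mset size_mset_set size_single)
  then obtain T where "F = {T}" by (meson card_1_singletonE)
  with * show "\<exists>T. F = {T} \<and> abs_rtree T = A" by simp
next
  assume "\<exists>T. F = {T} \<and> abs_rtree T = A"
  then show "abs_rforest F = tree_forest A"
    using tree_forest_abs assms by (auto simp: labeled_forest_def)
qed

text \<open>Each tree is counted by its root. In this form the number of trees can be followed
  through restrictions of the digraph.\<close>

lemma num_trees_digraph_class:
  assumes "forest_digraph V D"
  shows "num_trees (digraph_class V D) = card (V - Range D)"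
proof -
  obtain F where F: "labeled_forest F" "V = forest_vertices F" "D = forest_parent F"
    using assms by (auto simp: forest_digraph_def)
  have root: "root_of T \<in> vertices T" if "T \<in> F" for T
    using labeled_forest_treesD[OF F(1) that] by (simp add: rooted_tree_def)
  have "inj_on root_of F"
    using root labeled_forest_eqI[OF F(1)] by (metis inj_onI)
  moreover have "root_of ` F = V - Range D"
    using root forest_root_iff[OF F(1)] unfolding F forest_vertices_def by blast
  ultimately have "card F = card (V - Range D)" by (metis card_image)
  then show ?thesis using F by (simp add: digraph_class_forest trees_abs)
qed

section \<open>Leading terms of products\<close>

lemma forest_digraph_single_valued:
  assumes "forest_digraph V D"
  shows "single_valued (D\<inverse>)"
proof (rule single_valuedI)
  obtain F where F: "labeled_forest F" "D = forest_parent F"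
    using assms by (auto simp: forest_digraph_def)
  fix z x y assume xy: "(z, x) \<in> D\<inverse>" "(z, y) \<in> D\<inverse>"
  then obtain T where T: "T \<in> F" "(x, z) \<in> parent_rel T" by (auto simp: F forest_parent_def)
  note A = arborescence_parent_rel[OF labeled_forest_treesD[OF F(1) T(1)]]
  have "z \<in> vertices T" using arb_vertices(2)[OF A T(2)] .
  then have "(y, z) \<in> parent_rel T" using forest_parent_inD[OF F(1) T(1)] xy F(2) by simp
  with T(2) show "x = y" using arb_parent_unique[OF A] by blast
qed

text \<open>Cutting keeps every root and turns the lower end of each edge from \<open>V - U\<close>
  into \<open>U\<close> into a new one. Equal counts therefore leave no such edge; by uniqueness of
  parents, having a parent in \<open>U\<close> means that the parent lies in \<open>U\<close>. Edges
  out of \<open>U\<close> into \<open>V - U\<close> are excluded by closedness.\<close>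

lemma roots_closed_subset:
  assumes V: "forest_digraph V D" and U: "U \<in> closed_subsets V D"
  shows "card (V - Range D) \<le> card (U - Range (Restr D U)) + card (V - U - Range (Restr D (V - U)))"
    and "card (V - Range D) = card (U - Range (Restr D U)) + card (V - U - Range (Restr D (V - U)))
      \<Longrightarrow> D = Restr D U \<union> Restr D (V - U)"
proof -
  note fin = forest_digraphD(1)[OF V] and sub = forest_digraphD(2)[OF V]
  let ?A = "U - Range (Restr D U)" and ?B = "V - U - Range (Restr D (V - U))"
  have UV: "U \<subseteq> V" "D `` U \<subseteq> U" using U by (auto simp: closed_subsets_def)
  have finAB: "finite ?A" "finite ?B" using fin UV finite_subset by blast+
  have le: "V - Range D \<subseteq> ?A \<union> ?B" by blast
  have card: "card (?A \<union> ?B) = card ?A + card ?B" using finAB by (intro card_Un_disjoint) blast+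
  show "card (V - Range D) \<le> card ?A + card ?B"
    using card_mono[OF _ le] finAB card by simp
  assume "card (V - Range D) = card ?A + card ?B"
  then have "V - Range D = ?A \<union> ?B"
    using card_subset_eq[OF _ le] finAB card by simp
  then have "y \<in> Range (Restr D U)" if "(x, y) \<in> D" "y \<in> U" for x y
    using that by blast
  then have "x \<in> U" if "(x, y) \<in> D" "y \<in> U" for x y
    using that forest_digraph_single_valued[OF V] by (fastforce simp: single_valued_def)
  then show "D = Restr D U \<union> Restr D (V - U)" using sub UV by blast
qed

lemma lookup_H_mult_delta:
  assumes V: "forest_digraph V D"
  shows "Poly_Mapping.lookup (H_mult (delta A) (delta B)) (digraph_class V D) =
    rat_of_nat (card {U \<in> closed_subsets V D.
      digraph_class U (Restr D U) = A \<and> digraph_class (V - U) (Restr D (V - U)) = B})"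
proof -
  have "Poly_Mapping.lookup (H_mult (delta A) (delta B)) (digraph_class V D) =
      (\<Sum>U\<in>closed_subsets V D.
        if digraph_class U (Restr D U) = A \<and> digraph_class (V - U) (Restr D (V - U)) = B then 1 else 0)"
    unfolding lookup_H_mult[OF V] by (intro sum.cong refl) (auto simp: lookup_single when_def)
  then show ?thesis
    using finite_closed_subsets[OF forest_digraphD(1)[OF V]] by (simp add: sum.If_cases Int_def)
qed

lemma factor_num_trees:
  assumes V: "forest_digraph V D" and U: "U \<in> closed_subsets V D"
    "digraph_class U (Restr D U) = A" "digraph_class (V - U) (Restr D (V - U)) = B"
  shows "num_trees (digraph_class V D) \<le> num_trees A + num_trees B"
    and "num_trees (digraph_class V D) = num_trees A + num_trees B \<Longrightarrow>
      D = Restr D U \<union> Restr D (V - U) \<and> digraph_class V D = forest_sum A B"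
proof -
  note W = forest_digraph_closed_subset[OF V U(1)]
  note n = num_trees_digraph_class[OF V] num_trees_digraph_class[OF W(1)] num_trees_digraph_class[OF W(2)]
  show "num_trees (digraph_class V D) \<le> num_trees A + num_trees B"
    using roots_closed_subset(1)[OF V U(1)] n U by simp
  assume "num_trees (digraph_class V D) = num_trees A + num_trees B"
  then have D: "D = Restr D U \<union> Restr D (V - U)"
    using roots_closed_subset(2)[OF V U(1)] n U by simp
  moreover have "U \<union> (V - U) = V" using U(1) by (auto simp: closed_subsets_def)
  ultimately show "D = Restr D U \<union> Restr D (V - U) \<and> digraph_class V D = forest_sum A B"
    using forest_sum_digraph_class[OF W] U by auto
qed

lemma H_mult_delta_leading:
  assumes "Poly_Mapping.lookup (H_mult (delta A) (delta B)) X \<noteq> 0"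
  shows "num_trees X \<le> num_trees A + num_trees B"
    and "num_trees X = num_trees A + num_trees B \<Longrightarrow> X = forest_sum A B"
proof -
  obtain V D where V: "forest_digraph V D" "X = digraph_class V D" using ex_forest_digraph by blast
  let ?S = "{U \<in> closed_subsets V D.
    digraph_class U (Restr D U) = A \<and> digraph_class (V - U) (Restr D (V - U)) = B}"
  have "card ?S \<noteq> 0"
    using assms unfolding V(2) lookup_H_mult_delta[OF V(1)] by simp
  then have "?S \<noteq> {}" by (rule contrapos_nn) (simp only: card.empty)
  then obtain U where "U \<in> ?S" by blast
  then have "U \<in> closed_subsets V D"
    "digraph_class U (Restr D U) = A" "digraph_class (V - U) (Restr D (V - U)) = B" by simp_all
  from factor_num_trees[OF V(1) this] V(2) show "num_trees X \<le> num_trees A + num_trees B"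
    "num_trees X = num_trees A + num_trees B \<Longrightarrow> X = forest_sum A B" by auto
qed

text \<open>The coefficient counts closed sets, and the summand \<open>V\<close> that represents
  \<open>A\<close> is one of them.\<close>

lemma H_mult_delta_forest_sum_neq_0:
  "Poly_Mapping.lookup (H_mult (delta A) (delta B)) (forest_sum A B) \<noteq> 0"
proof -
  have "inj (\<lambda>n::nat. 2 * n)" "inj (\<lambda>n::nat. 2 * n + 1)" by (auto intro: injI)
  then obtain V D V' D' where V: "forest_digraph V D" "A = digraph_class V D" "V \<subseteq> range (\<lambda>n. 2 * n)"
    and V': "forest_digraph V' D'" "B = digraph_class V' D'" "V' \<subseteq> range (\<lambda>n. 2 * n + 1)"
    by (metis ex_forest_digraph_image)
  have "even x" if "x \<in> V" for x using that V(3) by auto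
  moreover have "odd x" if "x \<in> V'" for x using that V'(3) by auto
  ultimately have disj: "V \<inter> V' = {}" by blast
  note sub = forest_digraphD(2)[OF V(1)] forest_digraphD(2)[OF V'(1)]
  note VV' = forest_digraph_Un[OF V(1) V'(1) disj]
  define S where "S = {U \<in> closed_subsets (V \<union> V') (D \<union> D'). digraph_class U (Restr (D \<union> D') U) = A \<and>
      digraph_class (V \<union> V' - U) (Restr (D \<union> D') (V \<union> V' - U)) = B}"
  have "Restr (D \<union> D') V = D" "Restr (D \<union> D') V' = D'" "V \<union> V' - V = V'" using sub disj by blast+
  moreover have "V \<in> closed_subsets (V \<union> V') (D \<union> D')"
    using sub disj unfolding closed_subsets_def by blast
  ultimately have "V \<in> S" using V V' by (simp add: S_def)
  moreover have "finite S" using finite_closed_subsets[OF forest_digraphD(1)[OF VV']] by (simp add: S_def)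
  ultimately have "card S \<noteq> 0" by (metis card_0_eq empty_iff)
  then show ?thesis
    by (simp only: S_def V(2) V'(2) forest_sum_digraph_class[OF V(1) V'(1) disj]
        lookup_H_mult_delta[OF VV'] of_nat_eq_0_iff not_False_eq_True)
qed

text \<open>With the maximal number of trees no edge is cut, so complements of the counted sets are
  closed too, and complementation exchanges the two counts. This cancels the two-tree part of the
  commutator of two trees.\<close>

lemma H_mult_delta_top_commute:
  assumes "num_trees X = num_trees A + num_trees B"
  shows "Poly_Mapping.lookup (H_mult (delta A) (delta B)) X = Poly_Mapping.lookup (H_mult (delta B) (delta A)) X"
proof -
  obtain V D where V: "forest_digraph V D" "X = digraph_class V D" using ex_forest_digraph by blast
  let ?c = "\<lambda>U. digraph_class U (Restr D U)"
  let ?S = "\<lambda>A B. {U \<in> closed_subsets V D. ?c U = A \<and> ?c (V - U) = B}"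
  have compl: "V - U \<in> ?S B A \<and> V - (V - U) = U"
    if "U \<in> ?S A B" "num_trees X = num_trees A + num_trees B" for U A B
  proof -
    have D: "D = Restr D U \<union> Restr D (V - U)"
      using factor_num_trees(2)[OF V(1)] that V(2) by auto
    then have "V - U \<in> closed_subsets V D" unfolding closed_subsets_def by blast
    moreover have "V - (V - U) = U" using that by (auto simp: closed_subsets_def)
    ultimately show ?thesis using that by simp
  qed
  have "bij_betw (\<lambda>U. V - U) (?S A B) (?S B A)"
    by (rule bij_betw_byWitness[where f' = "\<lambda>U. V - U"])
      (use compl assms in \<open>auto simp: add.commute\<close>)
  then show ?thesis
    unfolding V(2) lookup_H_mult_delta[OF V(1)] by (simp add: bij_betw_same_card)
qed

section \<open>The Lie algebra of trees inside the algebra of forests\<close>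

definition H_incl :: "nT \<Rightarrow> H_LRF" where
  "H_incl = lin_ext (\<lambda>A. delta (tree_forest A))"

lemma qlinear_H_incl: "qlinear H_incl"
  unfolding H_incl_def by (rule qlinear_lin_ext)

lemma lookup_H_incl_tree_forest: "Poly_Mapping.lookup (H_incl p) (tree_forest A) = Poly_Mapping.lookup p A"
  by (rule qlinear_eqI[OF qlinear_compose[OF qlinear_H_incl qlinear_lookup] qlinear_lookup])
    (simp add: H_incl_def lin_ext_single scaleQ_one lookup_single when_def tree_forest_inject)

lemma lookup_H_incl_0:
  assumes "num_trees X \<noteq> 1"
  shows "Poly_Mapping.lookup (H_incl p) X = 0"
proof (rule qlinear_eqI[OF qlinear_compose[OF qlinear_H_incl qlinear_lookup], where p = p])
  show "qlinear (\<lambda>p :: nT. 0 :: rat)" by (rule qlinearI) simp_all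
  show "Poly_Mapping.lookup (H_incl (Poly_Mapping.single A 1)) X = 0" for A
    using assms num_trees_eq_1_iff[of X]
    by (auto simp: H_incl_def lin_ext_single scaleQ_one lookup_single when_def)
qed

lemma H_incl_inject: "H_incl p = H_incl q \<longleftrightarrow> p = q"
  by (metis lookup_H_incl_tree_forest poly_mapping_eqI)

lemma admissible_single:
  assumes "e \<in> edges T"
  shows "admissible T {e}"
proof -
  have "card ({e} \<inter> P) \<le> 1" for P
    using card_mono[of "{e}" "{e} \<inter> P"] by simp
  with assms show ?thesis by (simp add: admissible_def)
qed

text \<open>Different cut tops give pruned trees with different roots, so there is a single cut top,
  and the edge above it is the only cut edge.\<close>

lemma pruned_single_imp:
  assumes T: "rooted_tree T" and C: "admissible T C" and P: "pruned T C = {S}"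
  shows "\<exists>e\<in>edges T. C = {e}"
proof -
  let ?D = "parent_rel T"
  note A = arborescence_parent_rel[OF T]
  let ?f = "\<lambda>t. restrict_tree T C (?D\<^sup>* `` {t}) t"
  have f: "?f ` cut_tops ?D C = {S}" using pruned_eq[OF T A C] P by simp
  then obtain t where t_top: "t \<in> cut_tops ?D C" by blast
  have "s = t" if "s \<in> cut_tops ?D C" for s
  proof -
    have "?f s = S" "?f t = S"
      using imageI[OF that, of ?f] imageI[OF t_top, of ?f] unfolding f by simp_all
    then have "?f s = ?f t" by simp
    then show ?thesis by (simp add: restrict_tree_def)
  qed
  with t_top have t: "cut_tops ?D C = {t}" by blast
  then obtain x where x: "(x, t) \<in> ?D" "{x, t} \<in> C" by (auto simp: cut_tops_def)
  have "e = {x, t}" if "e \<in> C" for e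
  proof -
    have "e \<in> edges T" using that C by (auto simp: admissible_def)
    then obtain a b where ab: "e = {a, b}" "(a, b) \<in> ?D" using arb_edgeE[OF A] by metis
    then have "b \<in> cut_tops ?D C" using that by (auto simp: cut_tops_def)
    with t ab x show ?thesis using arb_parent_unique[OF A] by auto
  qed
  with x C show ?thesis by (auto simp: admissible_def)
qed

text \<open>The general cuts counted by the product reduce to the single-edge cuts of the pre-Lie
  coefficient, because the pruned part must be one tree.\<close>

lemma lookup_H_mult_tree_forest:
  "Poly_Mapping.lookup (H_mult (delta (tree_forest A)) (delta (tree_forest B))) (tree_forest X) =
    rat_of_nat (ck_coeff A B X)"
proof -
  define T where "T = rep_rtree X"
  have T: "rooted_tree T" by (simp add: T_def rep_rtree)
  define D where "D = parent_rel T"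
  note arb = arborescence_parent_rel[OF T, folded D_def]
  have V: "forest_digraph (vertices T) D" "digraph_class (vertices T) D = tree_forest X"
    using forest_digraph_forest[OF labeled_forest_single[OF T]]
      digraph_class_forest[OF labeled_forest_single[OF T]]
    by (simp_all add: D_def tree_forest_def T_def)
  let ?c = "\<lambda>U. digraph_class U (Restr D U)"
  let ?U = "\<lambda>C. D\<^sup>* `` cut_tops D C"
  define Q where "Q = {C. admissible T C \<and> abs_rforest (pruned T C) = tree_forest A \<and>
    abs_rforest {trunk T C} = tree_forest B}"
  have c: "?c (?U C) = abs_rforest (pruned T C)" "?c (vertices T - ?U C) = abs_rforest {trunk T C}"
    if "admissible T C" for C
  proof -
    have cut: "Edge_Cut C \<in> tree_cuts T" using that by (simp add: tree_cuts_def)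
    have "forest_vertices (pruned T C) = ?U C" by (simp add: D_def forest_vertices_pruned[OF T])
    moreover have "vertices (trunk T C) = vertices T - ?U C"
      by (simp add: vertices_trunk component_root[OF T arb])
    ultimately show "?c (?U C) = abs_rforest (pruned T C)"
      "?c (vertices T - ?U C) = abs_rforest {trunk T C}"
      using forest_parent_tree_P_R[OF T cut] digraph_class_forest[OF labeled_forest_pruned[OF T, of C]]
        digraph_class_forest[OF labeled_forest_single[OF rooted_tree_trunk[OF T, of C]]]
      by (simp_all add: D_def)
  qed
  have "{U \<in> closed_subsets (vertices T) D. ?c U = tree_forest A \<and> ?c (vertices T - U) = tree_forest B} =
      ?U ` Q"
  proof (intro subset_antisym subsetI)
    fix U assume U: "U \<in> {U \<in> closed_subsets (vertices T) D.
      ?c U = tree_forest A \<and> ?c (vertices T - U) = tree_forest B}"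
    \<comment> \<open>The full cut is ruled out since it leaves the empty forest, which is not the
      class of the tree \<open>B\<close>.\<close>
    have "root_of T \<notin> U"
    proof
      assume "root_of T \<in> U"
      then have "U = vertices T" using closed_subset_with_root[OF T] U by (auto simp: D_def)
      then have "empty_rforest = tree_forest B" using U forest_digraph_empty(2) by simp
      then show False using trees_tree_forest[of B] trees_empty by simp
    qed
    then obtain C where C: "admissible T C" "U = ?U C"
      using U bij_betw_imp_surj_on[OF bij_betw_admissible_closed[OF T arb]] by blast
    with U c[OF C(1)] show "U \<in> ?U ` Q" by (auto simp: Q_def)
  next
    fix U assume "U \<in> ?U ` Q"
    then obtain C where C: "C \<in> Q" "U = ?U C" by blast
    then have "U \<in> closed_subsets (vertices T) D"
      using bij_betw_apply[OF bij_betw_admissible_closed[OF T arb], of C] by (simp add: Q_def)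
    with C c[of C] show "U \<in> {U \<in> closed_subsets (vertices T) D.
      ?c U = tree_forest A \<and> ?c (vertices T - U) = tree_forest B}" by (simp add: Q_def)
  qed
  moreover have "inj_on ?U Q"
    by (rule inj_on_subset[OF bij_betw_imp_inj_on[OF bij_betw_admissible_closed[OF T arb]]])
      (auto simp: Q_def)
  ultimately have "Poly_Mapping.lookup (H_mult (delta (tree_forest A)) (delta (tree_forest B))) (tree_forest X) =
      rat_of_nat (card Q)"
    unfolding V(2)[symmetric] lookup_H_mult_delta[OF V(1)] by (simp add: card_image)
  also have "Q = (\<lambda>e. {e}) ` {e \<in> edges T. (\<exists>S. pruned T {e} = {S} \<and> abs_rtree S = A) \<and>
      abs_rtree (trunk T {e}) = B}" (is "_ = _ ` ?E")
  proof -
    have Q: "C \<in> Q \<longleftrightarrow> admissible T C \<and> (\<exists>S. pruned T C = {S} \<and> abs_rtree S = A) \<and> abs_rtree (trunk T C) = B" for C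
      by (simp add: Q_def abs_rforest_eq_tree_forest_iff labeled_forest_pruned[OF T]
          labeled_forest_single rooted_tree_trunk[OF T])
    show ?thesis
    proof (intro subset_antisym subsetI)
      fix C assume C: "C \<in> Q"
      then obtain S where "admissible T C" "pruned T C = {S}" unfolding Q by blast
      then obtain e where "e \<in> edges T" "C = {e}" using pruned_single_imp[OF T] by blast
      with C show "C \<in> (\<lambda>e. {e}) ` ?E" unfolding Q by simp
    next
      fix C assume "C \<in> (\<lambda>e. {e}) ` ?E"
      then show "C \<in> Q" unfolding Q using admissible_single[of _ T] by auto
    qed
  qed
  also have "card \<dots> = card ?E" by (rule card_image) (simp add: inj_on_def)
  finally show ?thesis by (simp add: ck_coeff_def T_def Let_def)
qed

lemma qbilinear_ck_product: "qbilinear ck_product"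
  unfolding qbilinear_def
proof (intro conjI allI)
  fix p
  show "qlinear (\<lambda>q. ck_product p q)"
    unfolding ck_product_def lin_ext_def[of _ p]
    by (intro qlinear_setsum qlinear_scaleQ qlinear_lin_ext)
  show "qlinear (\<lambda>q. ck_product q p)"
    unfolding ck_product_def by (rule qlinear_lin_ext)
qed

lemma qlinear_minus: "qlinear f \<Longrightarrow> qlinear g \<Longrightarrow> qlinear (\<lambda>x. f x - g x)"
  by (rule qlinearI) (auto simp: qlinear_add qlinear_scale rat_vector.scale_right_diff_distrib)

lemma qbilinear_commutator:
  assumes "qbilinear b"
  shows "qbilinear (\<lambda>x y. b x y - b y x)"
  using qbilinearD[OF assms] unfolding qbilinear_def by (auto intro: qlinear_minus)

lemma qbilinear_ck_bracket: "qbilinear ck_bracket"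
  using qbilinear_commutator[OF qbilinear_ck_product] unfolding ck_bracket_def[abs_def] .

lemma H_incl_bracket:
  "H_incl (ck_bracket p q) = H_mult (H_incl p) (H_incl q) - H_mult (H_incl q) (H_incl p)"
proof (rule qbilinear_eqI[where b = "\<lambda>p q. H_incl (ck_bracket p q)"
      and b' = "\<lambda>p q. H_mult (H_incl p) (H_incl q) - H_mult (H_incl q) (H_incl p)"])
  show "qbilinear (\<lambda>p q. H_incl (ck_bracket p q))"
    using qbilinearD[OF qbilinear_ck_bracket] unfolding qbilinear_def
    by (auto intro: qlinear_compose[OF _ qlinear_H_incl])
  show "qbilinear (\<lambda>p q. H_mult (H_incl p) (H_incl q) - H_mult (H_incl q) (H_incl p))"
    using qbilinearD[OF qbilinear_H_mult] unfolding qbilinear_def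
    by (auto intro!: qlinear_minus intro: qlinear_compose[OF qlinear_H_incl])
next
  fix A B
  let ?p = "delta (tree_forest A)" and ?q = "delta (tree_forest B)" and ?L = Poly_Mapping.lookup
  have incl: "H_incl (Poly_Mapping.single T 1) = delta (tree_forest T)" for T
    by (simp add: H_incl_def lin_ext_single scaleQ_one)
  have bracket: "ck_bracket (Poly_Mapping.single A 1) (Poly_Mapping.single B 1) =
      ck_basis_product A B - ck_basis_product B A"
    by (simp add: ck_bracket_def ck_product_def lin_ext_single scaleQ_one)
  have "?L (H_incl (ck_basis_product A B - ck_basis_product B A)) X = ?L (H_mult ?p ?q - H_mult ?q ?p) X" for X
  proof -
    \<comment> \<open>Coefficients are compared by the number of trees: one tree gives the pre-Lie
      coefficients, two trees give equal terms that cancel, and for no tree or more than two both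
      products vanish.\<close>
    have "num_trees X = 0 \<or> num_trees X = 1 \<or> num_trees X = 2 \<or> 2 < num_trees X" by linarith
    then consider C where "X = tree_forest C" | "num_trees X = 2" | "X = empty_rforest" | "2 < num_trees X"
      using num_trees_eq_1_iff[of X] num_trees_eq_0_iff[of X] by blast
    then show ?thesis
    proof cases
      case (1 C)
      then show ?thesis
        by (simp add: lookup_H_incl_tree_forest lookup_minus lookup_H_mult_tree_forest ck_basis_product.rep_eq)
    next
      case 2
      then show ?thesis
        using H_mult_delta_top_commute[of X "tree_forest A" "tree_forest B"]
        by (simp add: lookup_H_incl_0 lookup_minus trees_tree_forest)
    next
      case 3
      \<comment> \<open>Evaluation at the empty forest is the counit, which is multiplicative and
        vanishes on trees.\<close>
      have "H_counit (delta (tree_forest T)) = 0" for T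
        using num_trees_eq_0_iff[of "tree_forest T"] by (simp add: H_counit_delta trees_tree_forest)
      then have "?L (H_mult ?p ?q) X = 0" "?L (H_mult ?q ?p) X = 0"
        using H_counit_mult by (simp_all add: 3 flip: H_counit_def)
      then show ?thesis by (simp add: 3 lookup_H_incl_0 lookup_minus trees_empty)
    next
      case 4
      then have "?L (H_mult ?p ?q) X = 0" "?L (H_mult ?q ?p) X = 0"
        using H_mult_delta_leading(1)[of "tree_forest A" "tree_forest B" X]
          H_mult_delta_leading(1)[of "tree_forest B" "tree_forest A" X]
        by (auto simp: trees_tree_forest)
      with 4 show ?thesis by (simp add: lookup_H_incl_0 lookup_minus)
    qed
  qed
  then show "H_incl (ck_bracket (Poly_Mapping.single A 1) (Poly_Mapping.single B 1)) =
    H_mult (H_incl (Poly_Mapping.single A 1)) (H_incl (Poly_Mapping.single B 1)) -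
    H_mult (H_incl (Poly_Mapping.single B 1)) (H_incl (Poly_Mapping.single A 1))"
    unfolding incl bracket by (rule poly_mapping_eqI)
qed

text \<open>The Jacobi identity holds for commutators in an associative algebra and is pulled back
  along the injective map \<open>H_incl\<close>.\<close>

lemma lie_algebra_ck_bracket: "lie_algebra ck_bracket"
  unfolding lie_algebra_def
proof (intro conjI allI)
  show "qbilinear ck_bracket" by (rule qbilinear_ck_bracket)
  show "ck_bracket x x = 0" for x by (simp add: ck_bracket_def)
  fix x y z
  note hm = qbilinearD[OF qbilinear_H_mult]
  have "H_incl (ck_bracket x (ck_bracket y z) + ck_bracket y (ck_bracket z x) + ck_bracket z (ck_bracket x y)) = H_incl 0"
    by (simp add: qlinear_add[OF qlinear_H_incl] H_incl_bracket qlinear_0[OF qlinear_H_incl]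
        qlinear_diff[OF hm(1)] qlinear_diff[OF hm(2)] H_mult_assoc)
  then show "ck_bracket x (ck_bracket y z) + ck_bracket y (ck_bracket z x) + ck_bracket z (ck_bracket x y) = 0"
    by (simp only: H_incl_inject)
qed

section \<open>Linear algebra\<close>

lemma subspace_range: "qlinear f \<Longrightarrow> rat_vector.subspace (range f)"
proof (rule rat_vector.subspaceI)
  assume f: "qlinear f"
  show "0 \<in> range f" by (metis f qlinear_0 rangeI)
  show "x + y \<in> range f" if "x \<in> range f" "y \<in> range f" for x y
    using that by (metis (no_types, lifting) f imageE qlinear_add rangeI)
  show "c *\<^sub>Q x \<in> range f" if "x \<in> range f" for c x
    using that by (metis (no_types, lifting) f imageE qlinear_scale rangeI)
qed

lemma qlinear_apply_sum:
  assumes "qlinear f"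
  shows "f p = (\<Sum>k\<in>Poly_Mapping.keys p. Poly_Mapping.lookup p k *\<^sub>Q f (Poly_Mapping.single k (1::rat)))"
  by (subst poly_mapping_as_sum[of p]) (simp add: qlinear_sum[OF assms] qlinear_scale[OF assms])

lemma lookup_qlinear_sum:
  fixes f :: "('a \<Rightarrow>\<^sub>0 rat) \<Rightarrow> ('b \<Rightarrow>\<^sub>0 rat)"
  assumes "qlinear f"
  shows "Poly_Mapping.lookup (f p) x = (\<Sum>k\<in>Poly_Mapping.keys p.
    Poly_Mapping.lookup p k * Poly_Mapping.lookup (f (Poly_Mapping.single k 1)) x)"
  by (subst qlinear_apply_sum[OF assms]) (simp add: lookup_sum lookup_scaleQ scaleQ_rat_def)

text \<open>In the image of a nonzero vector, the coefficient at an index of maximal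
  \<open>n\<close> in its support receives only the diagonal contribution, so the kernel is trivial.
  Surjectivity is induction on \<open>n\<close>: the lower terms of the image of a basis vector are
  already in the range.\<close>

lemma bij_triangular:
  fixes f :: "('a \<Rightarrow>\<^sub>0 rat) \<Rightarrow> ('a \<Rightarrow>\<^sub>0 rat)" and n :: "'a \<Rightarrow> nat"
  assumes f: "qlinear f"
    and diag: "\<And>x. Poly_Mapping.lookup (f (Poly_Mapping.single x 1)) x \<noteq> 0"
    and lower: "\<And>x y. Poly_Mapping.lookup (f (Poly_Mapping.single y 1)) x \<noteq> 0 \<Longrightarrow> x \<noteq> y \<Longrightarrow> n x < n y"
  shows "bij f"
proof (rule bijI)
  have "p = 0" if "f p = 0" for p
  proof (rule ccontr)
    assume "p \<noteq> 0"
    then have "n ` Poly_Mapping.keys p \<noteq> {}" by simp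
    then have "Max (n ` Poly_Mapping.keys p) \<in> n ` Poly_Mapping.keys p"
      by (intro Max_in) simp_all
    then obtain y where y: "y \<in> Poly_Mapping.keys p" "n y = Max (n ` Poly_Mapping.keys p)" by auto
    have "Poly_Mapping.lookup (f (Poly_Mapping.single z 1)) y = 0" if "z \<in> Poly_Mapping.keys p - {y}" for z
    proof -
      have "n z \<le> n y" unfolding y(2) using that by (intro Max_ge) auto
      then show ?thesis using lower[of z y] that by auto
    qed
    then have "Poly_Mapping.lookup (f p) y =
        Poly_Mapping.lookup p y * Poly_Mapping.lookup (f (Poly_Mapping.single y 1)) y"
      by (subst lookup_qlinear_sum[OF f], subst sum.remove[OF _ y(1)]) simp_all
    then show False using that diag[of y] y(1) by (simp add: in_keys_iff)
  qed
  then show "inj f" by (intro injI) (metis f qlinear_diff right_minus_eq)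
  note sub = subspace_range[OF f]
  have "Poly_Mapping.single y 1 \<in> range f" for y
  proof (induction y rule: measure_induct_rule[of n])
    case (less y)
    let ?q = "f (Poly_Mapping.single y 1)"
    let ?c = "Poly_Mapping.lookup ?q y" and ?K = "Poly_Mapping.keys ?q"
    have y: "y \<in> ?K" using diag by (simp add: in_keys_iff)
    define r where "r = (\<Sum>x\<in>?K - {y}. Poly_Mapping.lookup ?q x *\<^sub>Q Poly_Mapping.single x (1::rat))"
    have "r \<in> range f" unfolding r_def
    proof (rule rat_vector.subspace_sum[OF sub], rule rat_vector.subspace_scale[OF sub])
      fix x assume "x \<in> ?K - {y}"
      then show "Poly_Mapping.single x 1 \<in> range f"
        using lower[of y x] by (intro less) (simp add: in_keys_iff)
    qed
    then have "(1 / ?c) *\<^sub>Q (?q - r) \<in> range f"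
      by (intro rat_vector.subspace_scale[OF sub] rat_vector.subspace_diff[OF sub]) simp_all
    moreover have "?q = ?c *\<^sub>Q Poly_Mapping.single y 1 + r"
      using poly_mapping_as_sum[of ?q] y by (simp add: r_def sum.remove)
    then have "(1 / ?c) *\<^sub>Q (?q - r) = (1 / ?c) *\<^sub>Q ?c *\<^sub>Q Poly_Mapping.single y 1"
      by (metis add_diff_cancel_right')
    then have "(1 / ?c) *\<^sub>Q (?q - r) = Poly_Mapping.single y 1"
      using diag[of y] by (simp add: scaleQ_scaleQ scaleQ_one)
    ultimately show ?case by simp
  qed
  then have "p \<in> range f" for p
    by (subst poly_mapping_as_sum)
      (intro rat_vector.subspace_sum[OF sub] rat_vector.subspace_scale[OF sub])
  then show "surj f" by auto
qed

section \<open>The homomorphism from the enveloping algebra\<close>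

text \<open>Induction on words: every word arises from the unit by left multiplication with
  generators, and words span the algebra.\<close>

lemma qlinear_U_eqI:
  assumes f: "qlinear f" and g: "qlinear g"
    and one: "f U_one = g U_one"
    and step: "\<And>x u. f u = g u \<Longrightarrow> f (U_mult (U_incl x) u) = g (U_mult (U_incl x) u)"
  shows "f u = g u"
proof -
  have "f (abs_U_nT (word w)) = g (abs_U_nT (word w))" for w
  proof (induction w)
    case Nil
    then show ?case using one by (simp add: U_one.abs_eq)
  next
    case (Cons x w)
    have "abs_U_nT (word (x # w)) = U_mult (U_incl x) (abs_U_nT (word w))"
      by (simp add: U_incl_def free_mult_word flip: abs_U_nT_mult)
    with Cons step show ?case by simp
  qed
  then have "f (abs_U_nT p) = g (abs_U_nT p)" for p
    by (rule qlinear_eqI[OF qlinear_compose[OF qlinear_abs_U_nT f] qlinear_compose[OF qlinear_abs_U_nT g]])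
  then show ?thesis by (metis abs_rep_U_nT)
qed

definition H_word :: "nT list \<Rightarrow> H_LRF" where
  "H_word w = foldr (\<lambda>x. H_mult (H_incl x)) w H_one"

lemma H_word_simps [simp]: "H_word [] = H_one" "H_word (x # w) = H_mult (H_incl x) (H_word w)"
  by (simp_all add: H_word_def)

lemma H_word_append: "H_word (v @ w) = H_mult (H_word v) (H_word w)"
  by (induction v) (simp_all add: H_one_H_mult H_mult_assoc)

lemma lin_ext_H_word_mult:
  "lin_ext H_word (free_mult p q) = H_mult (lin_ext H_word p) (lin_ext H_word q)"
proof (rule qbilinear_eqI[where b = "\<lambda>p q. lin_ext H_word (free_mult p q)"
      and b' = "\<lambda>p q. H_mult (lin_ext H_word p) (lin_ext H_word q)"])
  note fm = qbilinearD[OF qbilinear_free_mult] and hm = qbilinearD[OF qbilinear_H_mult]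
  show "qbilinear (\<lambda>p q. lin_ext H_word (free_mult p q))"
    unfolding qbilinear_def
    by (auto intro: qlinear_compose[OF fm(1) qlinear_lin_ext] qlinear_compose[OF fm(2) qlinear_lin_ext])
  show "qbilinear (\<lambda>p q. H_mult (lin_ext H_word p) (lin_ext H_word q))"
    unfolding qbilinear_def
    by (auto intro: qlinear_compose[OF qlinear_lin_ext hm(1)] qlinear_compose[OF qlinear_lin_ext hm(2)])
qed (simp add: free_mult_word lin_ext_single scaleQ_one H_word_append)

lift_definition U_to_H :: "U_nT \<Rightarrow> H_LRF" is "lin_ext H_word"
proof -
  fix p q :: "nT list \<Rightarrow>\<^sub>0 rat"
  note lin = qlinear_lin_ext[of H_word] and hm = qbilinearD[OF qbilinear_H_mult]
  have "lin_ext H_word r = 0" if "r \<in> envelope_relations ck_bracket" for r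
    using that unfolding envelope_relations_def
    by (auto simp: qlinear_diff[OF lin] qlinear_scale[OF lin] lin_ext_single scaleQ_one H_one_H_mult
        qlinear_add[OF qlinear_H_incl] qlinear_scale[OF qlinear_H_incl] H_incl_bracket)
  moreover assume "envelope_rel ck_bracket p q"
  ultimately show "lin_ext H_word p = lin_ext H_word q"
    by (intro qlinear_vanishes_on_ideal[OF lin])
      (auto simp: envelope_rel_def lin_ext_H_word_mult qlinear_0[OF hm(1)] qlinear_0[OF hm(2)])
qed

lemma qlinear_U_to_H: "qlinear U_to_H"
  by (rule qlinearI; transfer)
    (simp_all add: qlinear_add[OF qlinear_lin_ext] qlinear_scale[OF qlinear_lin_ext])

lemma U_to_H_mult: "U_to_H (U_mult u v) = H_mult (U_to_H u) (U_to_H v)"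
  by transfer (rule lin_ext_H_word_mult)

lemma U_to_H_one: "U_to_H U_one = H_one"
  by transfer (simp add: lin_ext_single scaleQ_one)

lemma U_to_H_incl: "U_to_H (U_incl x) = H_incl x"
  by (simp add: U_incl_def U_to_H.abs_eq lin_ext_single scaleQ_one H_one_H_mult)

section \<open>Ordered monomials span the enveloping algebra\<close>

definition tree_word :: "rtree list \<Rightarrow> U_nT" where
  "tree_word L = foldr (\<lambda>A. U_mult (U_incl (Poly_Mapping.single A 1))) L U_one"

lemma tree_word_simps [simp]:
  "tree_word [] = U_one" "tree_word (A # L) = U_mult (U_incl (Poly_Mapping.single A 1)) (tree_word L)"
  by (simp_all add: tree_word_def)

text \<open>The filtration of the enveloping algebra by word length. The bound is strict so that
  \<open>short_words (length L)\<close> holds the error of reordering \<open>L\<close>.\<close>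

definition short_words :: "nat \<Rightarrow> U_nT set" where
  "short_words k = rat_vector.span {tree_word L | L. length L < k}"

text \<open>Stated for arbitrary \<open>x\<close>, not only for single trees, because the bracket of
  two trees is a linear combination of trees.\<close>

lemma short_words_mult:
  assumes "v \<in> short_words k"
  shows "U_mult (U_incl x) v \<in> short_words (Suc k)"
proof -
  note um = qbilinearD[OF qbilinear_U_mult]
  have gen: "U_mult (U_incl x) (tree_word L) \<in> short_words (Suc k)" if "length L < k" for L
  proof -
    have "U_mult (U_incl x) (tree_word L) =
        (\<Sum>A\<in>Poly_Mapping.keys x. Poly_Mapping.lookup x A *\<^sub>Q tree_word (A # L))"
      using qlinear_apply_sum[OF qlinear_compose[OF U_incl_linear um(2)], of x] by simp
    moreover have "tree_word (A # L) \<in> short_words (Suc k)" for A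
      unfolding short_words_def by (rule rat_vector.span_base) (use that in \<open>force simp del: tree_word_simps\<close>)
    ultimately show ?thesis
      by (simp add: short_words_def rat_vector.span_sum rat_vector.span_scale)
  qed
  show ?thesis
    using assms unfolding short_words_def
    by (induction rule: rat_vector.span_induct_alt)
      (auto simp: qlinear_0[OF um(1)] qlinear_add[OF um(1)] qlinear_scale[OF um(1)]
        intro!: gen[unfolded short_words_def] rat_vector.span_add rat_vector.span_scale rat_vector.span_zero simp del: tree_word_simps)
qed

text \<open>Moving \<open>A\<close> past one letter costs one bracket, which replaces two letters by
  a single Lie algebra element and so yields shorter words.\<close>

lemma tree_word_move:
  "tree_word (L @ A # M) - tree_word (A # L @ M) \<in> short_words (Suc (length L + length M))"
proof (induction L)
  case Nil
  show ?case by (simp add: short_words_def rat_vector.span_zero)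
next
  case (Cons B L)
  note um = qbilinearD[OF qbilinear_U_mult]
  let ?A = "U_incl (Poly_Mapping.single A 1)" and ?B = "U_incl (Poly_Mapping.single B 1)"
  let ?b = "ck_bracket (Poly_Mapping.single B 1) (Poly_Mapping.single A 1)"
  have "tree_word ((B # L) @ A # M) - tree_word (A # (B # L) @ M) =
      U_mult ?B (tree_word (L @ A # M) - tree_word (A # L @ M)) +
      (U_mult ?B (U_mult ?A (tree_word (L @ M))) - U_mult ?A (U_mult ?B (tree_word (L @ M))))"
    by (simp add: qlinear_diff[OF um(1)])
  also have "U_mult ?B (U_mult ?A (tree_word (L @ M))) - U_mult ?A (U_mult ?B (tree_word (L @ M))) =
      U_mult (U_incl ?b) (tree_word (L @ M))"
    by (simp add: U_incl_bracket qlinear_diff[OF um(2)] U.assoc)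
  finally have eq: "tree_word ((B # L) @ A # M) - tree_word (A # (B # L) @ M) =
      U_mult ?B (tree_word (L @ A # M) - tree_word (A # L @ M)) + U_mult (U_incl ?b) (tree_word (L @ M))" .
  have "tree_word (L @ M) \<in> short_words (Suc (length L + length M))"
    unfolding short_words_def by (rule rat_vector.span_base) force
  from short_words_mult[OF this, of ?b] short_words_mult[OF Cons.IH, of "Poly_Mapping.single B 1"]
  show ?case unfolding eq short_words_def by (simp add: rat_vector.span_add)
qed

lemma tree_word_mset:
  "mset L = mset M \<Longrightarrow> tree_word L - tree_word M \<in> short_words (length L)"
proof (induction L arbitrary: M)
  case Nil
  then show ?case by (simp add: short_words_def rat_vector.span_zero)
next
  case (Cons A L)
  note um = qbilinearD[OF qbilinear_U_mult]
  from Cons.prems have "A \<in> set M" by (metis list.set_intros(1) set_mset_mset)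
  then obtain M1 M2 where M: "M = M1 @ A # M2" by (meson split_list)
  with Cons.prems have mset: "mset L = mset (M1 @ M2)" by simp
  then have len: "length L = length M1 + length M2" by (metis length_append size_mset)
  let ?A = "U_incl (Poly_Mapping.single A 1)"
  have 1: "U_mult ?A (tree_word L - tree_word (M1 @ M2)) \<in> short_words (Suc (length L))"
    by (rule short_words_mult[OF Cons.IH[OF mset]])
  have 2: "tree_word M - tree_word (A # M1 @ M2) \<in> short_words (Suc (length L))"
    using tree_word_move[of M1 A M2] by (simp add: M len)
  have eq: "tree_word (A # L) - tree_word M =
      U_mult ?A (tree_word L - tree_word (M1 @ M2)) - (tree_word M - tree_word (A # M1 @ M2))"
    by (simp add: qlinear_diff[OF um(1)])
  show ?case
    unfolding eq short_words_def length_Cons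
    by (rule rat_vector.span_diff[OF 1[unfolded short_words_def] 2[unfolded short_words_def]])
qed

text \<open>Fixes one ordering for each multiset of trees; it plays the part of a linear order on
  the generators.\<close>

definition trees_list :: "rforest \<Rightarrow> rtree list" where
  "trees_list X = (SOME L. X = forest_of L)"

lemma forest_of_trees_list: "forest_of (trees_list X) = X"
  unfolding trees_list_def using someI_ex[OF ex_forest_of[of X]] by simp

lemma mset_trees_list: "mset (trees_list X) = trees X"
  by (metis forest_of_trees_list trees_forest_of)

definition H_to_U :: "H_LRF \<Rightarrow> U_nT" where
  "H_to_U = lin_ext (\<lambda>X. tree_word (trees_list X))"

lemma qlinear_H_to_U: "qlinear H_to_U"
  unfolding H_to_U_def by (rule qlinear_lin_ext)

text \<open>Induction on length: the word in its chosen order is the image of a basis element, and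
  the reordering error consists of shorter words.\<close>

lemma tree_word_in_range: "tree_word L \<in> range H_to_U"
proof (induction L rule: measure_induct_rule[of length])
  case (less L)
  note sub = subspace_range[OF qlinear_H_to_U]
  let ?M = "trees_list (forest_of L)"
  have "short_words (length L) \<subseteq> range H_to_U"
    unfolding short_words_def by (rule rat_vector.span_minimal[OF _ sub]) (use less in blast)
  moreover have "tree_word L - tree_word ?M \<in> short_words (length L)"
    by (rule tree_word_mset) (simp add: mset_trees_list trees_forest_of)
  moreover have "tree_word ?M = H_to_U (delta (forest_of L))"
    by (simp add: H_to_U_def lin_ext_single scaleQ_one)
  ultimately have "(tree_word L - tree_word ?M) + tree_word ?M \<in> range H_to_U"
    by (intro rat_vector.subspace_add[OF sub]) auto
  then show ?case by simp
qed

lemma surj_H_to_U: "surj H_to_U"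
proof -
  note sub = subspace_range[OF qlinear_H_to_U] and um = qbilinearD[OF qbilinear_U_mult]
  have span: "rat_vector.span (range tree_word) \<subseteq> range H_to_U"
    by (rule rat_vector.span_minimal[OF _ sub]) (use tree_word_in_range in blast)
  have "abs_U_nT (word w) \<in> rat_vector.span (range tree_word)" for w
  proof (induction w)
    case Nil
    have "tree_word [] \<in> rat_vector.span (range tree_word)"
      by (rule rat_vector.span_base) (rule rangeI)
    then show ?case by (simp add: U_one.abs_eq)
  next
    case (Cons x w)
    have gen: "U_mult (U_incl x) (tree_word L) \<in> rat_vector.span (range tree_word)" for L
    proof -
      have "tree_word L \<in> short_words (Suc (length L))"
        unfolding short_words_def by (rule rat_vector.span_base) force
      then have "U_mult (U_incl x) (tree_word L) \<in> short_words (Suc (Suc (length L)))"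
        by (rule short_words_mult)
      moreover have "short_words k \<subseteq> rat_vector.span (range tree_word)" for k
        unfolding short_words_def by (rule rat_vector.span_mono) blast
      ultimately show ?thesis by blast
    qed
    have "U_mult (U_incl x) u \<in> rat_vector.span (range tree_word)"
      if "u \<in> rat_vector.span (range tree_word)" for u
      using that
      by (induction rule: rat_vector.span_induct_alt)
        (auto simp: qlinear_0[OF um(1)] qlinear_add[OF um(1)] qlinear_scale[OF um(1)] gen
          intro!: rat_vector.span_add rat_vector.span_scale rat_vector.span_zero)
    moreover have "abs_U_nT (word (x # w)) = U_mult (U_incl x) (abs_U_nT (word w))"
      by (simp add: U_incl_def free_mult_word flip: abs_U_nT_mult)
    ultimately show ?case using Cons by simp
  qed
  then have w: "abs_U_nT (word w) \<in> range H_to_U" for w using span by blast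
  have "abs_U_nT p \<in> range H_to_U" for p
    unfolding qlinear_apply_sum[OF qlinear_abs_U_nT, of p]
    by (intro rat_vector.subspace_sum[OF sub] rat_vector.subspace_scale[OF sub] w)
  then have "u \<in> range H_to_U" for u by (metis abs_rep_U_nT)
  then show ?thesis by auto
qed

text \<open>The three claims are proved together. In the image of \<open>A # L\<close>, the terms
  \<open>Y\<close> from the image of \<open>L\<close> other than \<open>forest_of L\<close> cannot
  reach \<open>Suc (length L)\<close> trees, so nothing cancels the leading coefficient.\<close>

lemma U_to_H_tree_word_leading:
  shows "Poly_Mapping.lookup (U_to_H (tree_word L)) X \<noteq> 0 \<Longrightarrow> num_trees X \<le> length L"
    and "Poly_Mapping.lookup (U_to_H (tree_word L)) X \<noteq> 0 \<Longrightarrow> num_trees X = length L \<Longrightarrow> X = forest_of L"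
    and "Poly_Mapping.lookup (U_to_H (tree_word L)) (forest_of L) \<noteq> 0"
proof (induction L arbitrary: X)
  case Nil
  {
    case 1
    then show ?case
      by (auto simp: U_to_H_one H_one_def lookup_single when_def trees_empty split: if_splits)
  next
    case 2
    then show ?case
      by (auto simp: U_to_H_one H_one_def lookup_single when_def split: if_splits)
  next
    case 3
    show ?case by (simp add: U_to_H_one H_one_def)
  }
next
  case (Cons A L)
  let ?P = "U_to_H (tree_word L)" and ?A = "tree_forest A"
  have expand: "Poly_Mapping.lookup (U_to_H (tree_word (A # L))) X =
      (\<Sum>Y\<in>Poly_Mapping.keys ?P. Poly_Mapping.lookup ?P Y * Poly_Mapping.lookup (H_mult (delta ?A) (delta Y)) X)"
    for X
  proof -
    have "U_to_H (tree_word (A # L)) = H_mult (delta ?A) ?P"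
      by (simp add: U_to_H_mult U_to_H_incl H_incl_def lin_ext_single scaleQ_one)
    then show ?thesis
      using lookup_qlinear_sum[OF qbilinearD(1)[OF qbilinear_H_mult], of "delta ?A" ?P X] by simp
  qed
  have bound: "num_trees X \<le> Suc (length L) \<and> (num_trees X = Suc (length L) \<longrightarrow>
      Y = forest_of L \<and> X = forest_sum ?A Y)"
    if "Poly_Mapping.lookup ?P Y \<noteq> 0" "Poly_Mapping.lookup (H_mult (delta ?A) (delta Y)) X \<noteq> 0" for X Y
    using Cons.IH(1,2)[OF that(1)] H_mult_delta_leading[OF that(2)]
    by (auto simp: trees_tree_forest)
  have bound': "num_trees X \<le> Suc (length L) \<and> (num_trees X = Suc (length L) \<longrightarrow> X = forest_of (A # L))"
    if nz: "Poly_Mapping.lookup (U_to_H (tree_word (A # L))) X \<noteq> 0" for X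
  proof -
    obtain Y where "Poly_Mapping.lookup ?P Y * Poly_Mapping.lookup (H_mult (delta ?A) (delta Y)) X \<noteq> 0"
      using nz unfolding expand by (rule sum.not_neutral_contains_not_neutral)
    with bound[of Y X] show ?thesis by auto
  qed
  {
    case 1
    with bound' show ?case by simp
  next
    case 2
    with bound' show ?case by simp
  next
    case 3
    let ?X = "forest_of (A # L)"
    have "num_trees ?X = Suc (length L)" by (simp only: trees_forest_of size_mset list.size)
    then have zero: "Poly_Mapping.lookup ?P Y * Poly_Mapping.lookup (H_mult (delta ?A) (delta Y)) ?X = 0"
      if "Y \<noteq> forest_of L" for Y
      using bound[of Y ?X] that by auto
    have mem: "forest_of L \<in> Poly_Mapping.keys ?P" using Cons.IH(3) by (simp add: in_keys_iff)
    have rest: "(\<Sum>Y\<in>Poly_Mapping.keys ?P - {forest_of L}. Poly_Mapping.lookup ?P Y *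
        Poly_Mapping.lookup (H_mult (delta ?A) (delta Y)) ?X) = 0"
      by (rule sum.neutral) (use zero in blast)
    have "Poly_Mapping.lookup (U_to_H (tree_word (A # L))) ?X = Poly_Mapping.lookup ?P (forest_of L) *
        Poly_Mapping.lookup (H_mult (delta ?A) (delta (forest_of L))) ?X"
      unfolding expand by (subst sum.remove[OF _ mem]) (simp_all only: rest finite_keys add_0_right)
    then show ?case
      using Cons.IH(3) H_mult_delta_forest_sum_neq_0[of ?A "forest_of L"] by simp
  }
qed

text \<open>\<open>H_to_U\<close> need not be the inverse. The composite with it is triangular for
  the number of trees and hence bijective, so \<open>U_to_H\<close> is surjective; surjectivity of
  \<open>H_to_U\<close> then makes it injective.\<close>

lemma bij_U_to_H: "bij U_to_H"
proof -
  have "bij (\<lambda>p. U_to_H (H_to_U p))"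
  proof (rule bij_triangular[where n = num_trees])
    have eq: "U_to_H (H_to_U (delta Y)) = U_to_H (tree_word (trees_list Y))" for Y
      by (simp add: H_to_U_def lin_ext_single scaleQ_one)
    have len: "length (trees_list Y) = num_trees Y" for Y by (metis mset_trees_list size_mset)
    show "Poly_Mapping.lookup (U_to_H (H_to_U (delta X))) X \<noteq> 0" for X
      using U_to_H_tree_word_leading(3)[of "trees_list X"] by (simp add: eq forest_of_trees_list)
    show "num_trees X < num_trees Y"
      if "Poly_Mapping.lookup (U_to_H (H_to_U (delta Y))) X \<noteq> 0" "X \<noteq> Y" for X Y
      using U_to_H_tree_word_leading(1,2)[of "trees_list Y" X] that
      by (auto simp: eq len forest_of_trees_list order_less_le)
  qed (rule qlinear_compose[OF qlinear_H_to_U qlinear_U_to_H])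
  then have bij: "bij (U_to_H \<circ> H_to_U)" by (simp add: comp_def)
  then have "surj U_to_H" by (metis bij_is_surj fun.set_map image_mono subset_UNIV top.extremum_unique)
  moreover have "inj U_to_H"
    by (metis bij bij_is_inj surj_H_to_U inj_on_imageI)
  ultimately show ?thesis by (simp add: bij_def)
qed

section \<open>Transport of Hopf algebra structures\<close>

lemma rat_coalgebra_transport:
  fixes cop :: "'a::rat_vector \<Rightarrow> ('a, 'a) tensor" and eps :: "'a \<Rightarrow> rat"
    and f :: "'a \<Rightarrow> 'b::rat_vector" and g :: "'b \<Rightarrow> 'a"
  assumes "rat_coalgebra cop eps"
    and f: "qlinear f" and g: "qlinear g" and gf: "\<And>x. g (f x) = x" and fg: "\<And>y. f (g y) = y"
  shows "rat_coalgebra (\<lambda>y. tensor_map f f (cop (g y))) (\<lambda>y. eps (g y))"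
proof -
  interpret A: rat_coalgebra cop eps by fact
  define cop' where "cop' y = tensor_map f f (cop (g y))" for y
  note ff = qlinear_tensor_map[OF f f]
  have cop': "qlinear cop'"
    unfolding cop'_def[abs_def] by (rule qlinear_compose[OF qlinear_compose[OF g A.cop_linear] ff])
  have eps': "qlinear (\<lambda>y. eps (g y))" by (rule qlinear_compose[OF g A.eps_linear])
  have idA: "qlinear (id :: 'a \<Rightarrow> 'a)" and idB: "qlinear (id :: 'b \<Rightarrow> 'b)"
    using qlinear_id by (simp_all add: id_def)
  note L = qlinear_tensor_map[OF A.cop_linear idA] and R = qlinear_tensor_map[OF idA A.cop_linear]
  note L' = qlinear_tensor_map[OF cop' idB] and R' = qlinear_tensor_map[OF idB cop']
  note fff = qlinear_tensor_map[OF f ff] and fff' = qlinear_tensor_map[OF ff f]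
  have left: "tensor_map cop' id (tensor_map f f t) = tensor_map (tensor_map f f) f (tensor_map cop id t)" for t
    by (rule qlinear_tensor_eqI[OF qlinear_compose[OF ff L'] qlinear_compose[OF L fff']])
      (simp add: tensor_map_tens f A.cop_linear idA idB cop' ff, simp add: cop'_def gf)
  have right: "tensor_map id cop' (tensor_map f f t) = tensor_map f (tensor_map f f) (tensor_map id cop t)" for t
    by (rule qlinear_tensor_eqI[OF qlinear_compose[OF ff R'] qlinear_compose[OF R fff]])
      (simp add: tensor_map_tens f A.cop_linear idA idB cop' ff, simp add: cop'_def gf)
  note bt = qbilinearD[OF qbilinear_tens]
  \<comment> \<open>Naturality of the associator. The left factor is itself a tensor, so the
    extension from pure tensors is carried out twice.\<close>
  have assoc2: "tensor_assoc (tensor_map (tensor_map f f) f (r \<otimes> z)) =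
      tensor_map f (tensor_map f f) (tensor_assoc (r \<otimes> z))" for r z
    by (rule qlinear_tensor_eqI[where t = r,
          OF qlinear_compose[OF qlinear_compose[OF bt(2) fff'] qlinear_tensor_assoc]
            qlinear_compose[OF qlinear_compose[OF bt(2) qlinear_tensor_assoc] fff]])
      (simp add: tensor_map_tens f ff tensor_assoc_tens)
  have assoc: "tensor_assoc (tensor_map (tensor_map f f) f t) = tensor_map f (tensor_map f f) (tensor_assoc t)" for t
    by (rule qlinear_tensor_eqI[OF qlinear_compose[OF fff' qlinear_tensor_assoc]
          qlinear_compose[OF qlinear_tensor_assoc fff] assoc2])
  have counit: "tensor_lift (\<lambda>y z. eps (g y) *\<^sub>Q z) (tensor_map f f t) = f (tensor_lift (\<lambda>y z. eps y *\<^sub>Q z) t)"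
    "tensor_lift (\<lambda>y z. eps (g z) *\<^sub>Q y) (tensor_map f f t) = f (tensor_lift (\<lambda>y z. eps z *\<^sub>Q y) t)" for t
  proof -
    note b = qbilinear_functional[OF A.eps_linear] and b' = qbilinear_functional[OF eps']
    show "tensor_lift (\<lambda>y z. eps (g y) *\<^sub>Q z) (tensor_map f f t) = f (tensor_lift (\<lambda>y z. eps y *\<^sub>Q z) t)"
      by (rule qlinear_tensor_eqI[OF qlinear_compose[OF ff qlinear_tensor_lift[OF b'(1)]]
            qlinear_compose[OF qlinear_tensor_lift[OF b(1)] f]])
        (simp add: tensor_map_tens f tensor_lift_tens[OF b(1)] tensor_lift_tens[OF b'(1)] gf qlinear_scale[OF f])
    show "tensor_lift (\<lambda>y z. eps (g z) *\<^sub>Q y) (tensor_map f f t) = f (tensor_lift (\<lambda>y z. eps z *\<^sub>Q y) t)"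
      by (rule qlinear_tensor_eqI[OF qlinear_compose[OF ff qlinear_tensor_lift[OF b'(2)]]
            qlinear_compose[OF qlinear_tensor_lift[OF b(2)] f]])
        (simp add: tensor_map_tens f tensor_lift_tens[OF b(2)] tensor_lift_tens[OF b'(2)] gf qlinear_scale[OF f])
  qed
  have "rat_coalgebra cop' (\<lambda>y. eps (g y))"
  proof (intro rat_coalgebra.intro cop' eps')
    fix y
    have y: "cop' y = tensor_map f f (cop (g y))" by (simp add: cop'_def)
    show "tensor_assoc (tensor_map cop' id (cop' y)) = tensor_map id cop' (cop' y)"
      unfolding y left right assoc A.coassoc ..
    show "tensor_lift (\<lambda>y z. eps (g y) *\<^sub>Q z) (cop' y) = y"
      "tensor_lift (\<lambda>y z. eps (g z) *\<^sub>Q y) (cop' y) = y"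
      unfolding y counit A.counit_left A.counit_right by (rule fg)+
  qed
  then show ?thesis by (simp add: cop'_def[abs_def])
qed

text \<open>The target is already a bialgebra; only the antipode is carried over, by conjugation
  with the isomorphism \<open>f\<close>.\<close>

lemma hopf_algebra_transport:
  fixes m :: "'a::rat_vector \<Rightarrow> 'a \<Rightarrow> 'a" and m' :: "'b::rat_vector \<Rightarrow> 'b \<Rightarrow> 'b"
  assumes A: "hopf_algebra m u cop eps ant" and B: "rat_bialgebra m' u' cop' eps'"
    and f: "qlinear f" and g: "qlinear g" and gf: "\<And>x. g (f x) = x" and fg: "\<And>y. f (g y) = y"
    and mult: "\<And>x y. f (m x y) = m' (f x) (f y)" and unit: "f u = u'"
    and comult: "\<And>x. cop' (f x) = tensor_map f f (cop x)" and counit: "\<And>x. eps' (f x) = eps x"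
  shows "hopf_algebra m' u' cop' eps' (\<lambda>y. f (ant (g y)))"
proof -
  interpret A: hopf_algebra m u cop eps ant by fact
  interpret B: rat_bialgebra m' u' cop' eps' by fact
  note m = qbilinearD[OF A.bilinear] and m' = qbilinearD[OF B.bilinear]
  have ant': "qlinear (\<lambda>y. f (ant (g y)))"
    by (rule qlinear_compose[OF qlinear_compose[OF g A.ant_linear] f])
  have b: "qbilinear (\<lambda>y z. m (ant y) z)" "qbilinear (\<lambda>y z. m y (ant z))"
    unfolding qbilinear_def
    by (auto intro: m qlinear_compose[OF A.ant_linear m(1)] qlinear_compose[OF A.ant_linear m(2)])
  have b': "qbilinear (\<lambda>y z. m' (f (ant (g y))) z)" "qbilinear (\<lambda>y z. m' y (f (ant (g z))))"
    unfolding qbilinear_def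
    by (auto intro: m' qlinear_compose[OF ant' m'(1)] qlinear_compose[OF ant' m'(2)])
  note ff = qlinear_tensor_map[OF f f]
  have left: "tensor_lift (\<lambda>y z. m' (f (ant (g y))) z) (tensor_map f f t) = f (tensor_lift (\<lambda>y z. m (ant y) z) t)" for t
    by (rule qlinear_tensor_eqI[OF qlinear_compose[OF ff qlinear_tensor_lift[OF b'(1)]]
          qlinear_compose[OF qlinear_tensor_lift[OF b(1)] f]])
      (simp add: tensor_map_tens f tensor_lift_tens[OF b(1)] tensor_lift_tens[OF b'(1)] gf mult)
  have right: "tensor_lift (\<lambda>y z. m' y (f (ant (g z)))) (tensor_map f f t) = f (tensor_lift (\<lambda>y z. m y (ant z)) t)" for t
    by (rule qlinear_tensor_eqI[OF qlinear_compose[OF ff qlinear_tensor_lift[OF b'(2)]]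
          qlinear_compose[OF qlinear_tensor_lift[OF b(2)] f]])
      (simp add: tensor_map_tens f tensor_lift_tens[OF b(2)] tensor_lift_tens[OF b'(2)] gf mult)
  show ?thesis
  proof (intro hopf_algebra.intro hopf_algebra_axioms.intro B ant')
    fix y
    have y: "cop' y = tensor_map f f (cop (g y))" "eps' y = eps (g y)"
      using comult[of "g y"] counit[of "g y"] by (simp_all add: fg)
    show "tensor_lift (\<lambda>y z. m' (f (ant (g y))) z) (cop' y) = eps' y *\<^sub>Q u'"
      "tensor_lift (\<lambda>y z. m' y (f (ant (g z)))) (cop' y) = eps' y *\<^sub>Q u'"
      unfolding y left right A.ant_left A.ant_right by (simp_all add: qlinear_scale[OF f] unit)
  qed
qed

section \<open>The enveloping algebra as a Hopf algebra\<close>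

lemma qlinear_U_comult: "qlinear U_comult"
  by (rule qlinearI; transfer)
    (simp_all add: qlinear_add[OF qlinear_lin_ext] qlinear_scale[OF qlinear_lin_ext])

lemma U_comult_mult: "U_comult (U_mult u v) = tensor_mult U_mult (U_comult u) (U_comult v)"
  by transfer (rule free_comult_mult)

lemma U_comult_one: "U_comult U_one = U_one \<otimes> U_one"
  using U_comult.abs_eq[of "word []"] by (simp add: lin_ext_single scaleQ_one flip: U_one.abs_eq)

lemma U_comult_incl: "U_comult (U_incl x) = U_incl x \<otimes> U_one + U_one \<otimes> U_incl x"
  using U_comult.abs_eq[of "word [x]"]
  by (simp add: lin_ext_single scaleQ_one U.tensor_unit_right flip: U_incl_def)

lemma qlinear_U_counit: "qlinear U_counit"
  by (rule qlinearI; transfer) (simp_all add: lookup_add lookup_scaleQ)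

lemma U_counit_mult: "U_counit (U_mult u v) = U_counit u * U_counit v"
  by transfer (rule lookup_free_mult_Nil)

lemma U_counit_one: "U_counit U_one = 1"
  by transfer simp

lemma U_counit_incl: "U_counit (U_incl x) = 0"
  by (simp add: U_incl_def U_counit.abs_eq lookup_single)

text \<open>A single tree splits only trivially, so trees are primitive.\<close>

lemma H_comult_incl: "H_comult (H_incl p) = H_incl p \<otimes> H_one + H_one \<otimes> H_incl p"
proof (rule qlinear_eqI[OF qlinear_compose[OF qlinear_H_incl qlinear_H_comult]
      qlinear_plus[OF qlinear_compose[OF qlinear_H_incl qbilinearD(2)[OF qbilinear_tens]]
        qlinear_compose[OF qlinear_H_incl qbilinearD(1)[OF qbilinear_tens]]]])
  fix A
  let ?A = "tree_forest A"
  have ne: "?A \<noteq> empty_rforest" using trees_inject[of ?A empty_rforest] by (simp add: trees_tree_forest trees_empty)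
  have "forest_sum X Y = ?A \<longleftrightarrow> X = ?A \<and> Y = empty_rforest \<or> X = empty_rforest \<and> Y = ?A" for X Y
    by (simp add: trees_forest_sum trees_tree_forest trees_empty union_is_single flip: trees_inject)
  then have "splittings ?A = {(?A, empty_rforest), (empty_rforest, ?A)}"
    unfolding splittings_def by blast
  then show "H_comult (H_incl (Poly_Mapping.single A 1)) =
      H_incl (Poly_Mapping.single A 1) \<otimes> H_one + H_one \<otimes> H_incl (Poly_Mapping.single A 1)"
    using ne by (simp add: H_incl_def lin_ext_single scaleQ_one H_comult_delta H_one_def)
qed

text \<open>Both sides are algebra homomorphisms, so agreement on the unit and on the primitive
  generators suffices.\<close>

lemma H_comult_U_to_H: "H_comult (U_to_H u) = tensor_map U_to_H U_to_H (U_comult u)"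
proof -
  note lin = qlinear_U_to_H
  note T = qlinear_tensor_map[OF lin lin]
  note utm = qbilinearD[OF U.qbilinear_tensor_mult] and htm = qbilinearD[OF H.qbilinear_tensor_mult]
  have mult1: "tensor_map U_to_H U_to_H (tensor_mult U_mult (x \<otimes> y) t) =
      tensor_mult H_mult (tensor_map U_to_H U_to_H (x \<otimes> y)) (tensor_map U_to_H U_to_H t)" for x y t
    by (rule qlinear_tensor_eqI[OF qlinear_compose[OF utm(1) T] qlinear_compose[OF T htm(1)]])
      (simp add: U.tensor_mult_tens H.tensor_mult_tens tensor_map_tens lin U_to_H_mult)
  have mult: "tensor_map U_to_H U_to_H (tensor_mult U_mult s t) =
      tensor_mult H_mult (tensor_map U_to_H U_to_H s) (tensor_map U_to_H U_to_H t)" for s t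
    by (rule qlinear_tensor_eqI[OF qlinear_compose[OF utm(2) T] qlinear_compose[OF T htm(2)] mult1])
  show ?thesis
  proof (rule qlinear_U_eqI[OF qlinear_compose[OF lin qlinear_H_comult] qlinear_compose[OF qlinear_U_comult T]])
    show "H_comult (U_to_H U_one) = tensor_map U_to_H U_to_H (U_comult U_one)"
      by (simp add: U_to_H_one H_comult_one U_comult_one tensor_map_tens lin)
    show "H_comult (U_to_H (U_mult (U_incl x) u)) = tensor_map U_to_H U_to_H (U_comult (U_mult (U_incl x) u))"
      if "H_comult (U_to_H u) = tensor_map U_to_H U_to_H (U_comult u)" for x u
      by (simp add: U_to_H_mult H_comult_mult U_comult_mult mult that U_to_H_incl U_comult_incl
          H_comult_incl qlinear_add[OF T] tensor_map_tens lin U_to_H_one)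
  qed
qed

lemma H_counit_U_to_H: "H_counit (U_to_H u) = U_counit u"
proof (rule qlinear_U_eqI[OF qlinear_compose[OF qlinear_U_to_H qlinear_H_counit] qlinear_U_counit])
  have "H_counit (H_incl x) = 0" for x
    by (simp add: H_counit_def lookup_H_incl_0 trees_empty)
  then show "H_counit (U_to_H (U_mult (U_incl x) u)) = U_counit (U_mult (U_incl x) u)" for x u
    by (simp add: U_to_H_mult H_counit_mult U_counit_mult U_to_H_incl U_counit_incl)
qed (simp add: U_to_H_one U_counit_one H.eps_unit)

lemma inv_U_to_H: "inv U_to_H (U_to_H u) = u" "U_to_H (inv U_to_H h) = h"
  using bij_U_to_H by (simp_all add: bij_is_inj bij_is_surj surj_f_inv_f)

lemma qlinear_inv_U_to_H: "qlinear (inv U_to_H)"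
proof (rule qlinearI)
  show "inv U_to_H (x + y) = inv U_to_H x + inv U_to_H y" for x y
    by (rule injD[OF bij_is_inj[OF bij_U_to_H]]) (simp add: inv_U_to_H qlinear_add[OF qlinear_U_to_H])
  show "inv U_to_H (c *\<^sub>Q x) = c *\<^sub>Q inv U_to_H x" for c x
    by (rule injD[OF bij_is_inj[OF bij_U_to_H]]) (simp add: inv_U_to_H qlinear_scale[OF qlinear_U_to_H])
qed

lemma U_comult_inv: "U_comult u = tensor_map (inv U_to_H) (inv U_to_H) (H_comult (U_to_H u))"
proof -
  note lin = qlinear_tensor_map[OF qlinear_U_to_H qlinear_U_to_H]
    and inv = qlinear_tensor_map[OF qlinear_inv_U_to_H qlinear_inv_U_to_H]
  have "tensor_map (inv U_to_H) (inv U_to_H) (tensor_map U_to_H U_to_H t) = t" for t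
    by (rule qlinear_tensor_eqI[OF qlinear_compose[OF lin inv] qlinear_id])
      (simp add: tensor_map_tens qlinear_U_to_H qlinear_inv_U_to_H inv_U_to_H)
  then show ?thesis by (simp add: H_comult_U_to_H)
qed

lemma rat_bialgebra_U: "rat_bialgebra U_mult U_one U_comult U_counit"
proof (intro rat_bialgebra.intro rat_bialgebra_axioms.intro)
  have "rat_coalgebra (\<lambda>u. tensor_map (inv U_to_H) (inv U_to_H) (H_comult (U_to_H u))) (\<lambda>u. H_counit (U_to_H u))"
    by (rule rat_coalgebra_transport[OF H.rat_coalgebra_axioms qlinear_inv_U_to_H qlinear_U_to_H])
      (simp_all add: inv_U_to_H)
  then show "rat_coalgebra U_comult U_counit"
    by (simp add: H_counit_U_to_H flip: U_comult_inv)
qed (simp_all add: U.rat_algebra_axioms U_comult_mult U_comult_one U_counit_mult U_counit_one)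

lemma qlinear_U_antipode: "qlinear U_antipode"
proof -
  have "qlinear free_antipode" unfolding free_antipode_def by (rule qlinear_lin_ext)
  note lin = qlinear_compose[OF this qlinear_abs_U_nT]
  show ?thesis
  proof (rule qlinearI)
    fix u v c
    obtain p q where "u = abs_U_nT p" "v = abs_U_nT q" by (metis abs_rep_U_nT)
    then show "U_antipode (u + v) = U_antipode u + U_antipode v"
      "U_antipode (c *\<^sub>Q u) = c *\<^sub>Q U_antipode u"
      using qlinear_add[OF lin] qlinear_scale[OF lin]
      by (simp_all add: plus_U_nT.abs_eq scaleQ_U_nT.abs_eq U_antipode.abs_eq)
  qed
qed

lemma U_antipode_mult: "U_antipode (U_mult u v) = U_mult (U_antipode v) (U_antipode u)"
proof -
  obtain p q where "u = abs_U_nT p" "v = abs_U_nT q" by (metis abs_rep_U_nT)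
  then show ?thesis
    by (simp add: U_antipode.abs_eq free_antipode_mult flip: abs_U_nT_mult)
qed

lemma U_antipode_one: "U_antipode U_one = U_one"
  by (simp add: U_one.abs_eq U_antipode.abs_eq free_antipode_def lin_ext_single scaleQ_one)

lemma U_antipode_incl: "U_antipode (U_incl x) = - U_incl x"
  by (simp add: U_incl_def U_antipode.abs_eq free_antipode_def lin_ext_single scaleQ_one
      uminus_U_nT.abs_eq)

lemma hopf_algebra_U: "hopf_algebra U_mult U_one U_comult U_counit U_antipode"
proof (intro hopf_algebra.intro hopf_algebra_axioms.intro rat_bialgebra_U qlinear_U_antipode)
  note um = qbilinearD[OF qbilinear_U_mult] and tm = qbilinearD[OF U.qbilinear_tensor_mult]
  let ?l = "\<lambda>y z. U_mult (U_antipode y) z" and ?r = "\<lambda>y z. U_mult y (U_antipode z)"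
  have bl: "qbilinear ?l" and br: "qbilinear ?r"
    unfolding qbilinear_def
    by (auto intro: um qlinear_compose[OF qlinear_U_antipode um(1)] qlinear_compose[OF qlinear_U_antipode um(2)])
  note L = qlinear_tensor_lift[OF bl] and R = qlinear_tensor_lift[OF br]
  have zero: "qlinear (\<lambda>t. 0)" by (rule qlinearI) simp_all
  have neg: "U_mult (- u) v = - U_mult u v" "U_mult u (- v) = - U_mult u v" for u v
    using qlinear_diff[OF um(2), of 0 u v] qlinear_diff[OF um(1), of u 0 v]
    by (simp_all add: qlinear_0[OF um(1)] qlinear_0[OF um(2)])
  let ?x = "\<lambda>x. U_incl x \<otimes> U_one + U_one \<otimes> U_incl x"
  \<comment> \<open>Writing S for \<open>U_antipode\<close>, the tensor \<open>y \<otimes> z\<close>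
    contributes S(xy)z + S(y)xz, and S(xy) = -S(y)x.\<close>
  have left: "tensor_lift ?l (tensor_mult U_mult (?x x) t) = 0" for x t
    by (rule qlinear_tensor_eqI[OF qlinear_compose[OF tm(1) L] zero])
      (simp add: qlinear_add[OF tm(2)] U.tensor_mult_tens qlinear_add[OF L] tensor_lift_tens[OF bl]
        U.unit_left U_antipode_mult U_antipode_incl neg U.assoc)
  \<comment> \<open>Here \<open>y \<otimes> z\<close> contributes xyS(z) - yS(z)x, a commutator with
    \<open>x\<close>. It does not vanish for every \<open>t\<close>, but it does in the induction
    step, where the lift is a multiple of the unit.\<close>
  have right: "tensor_lift ?r (tensor_mult U_mult (?x x) t) =
      U_mult (U_incl x) (tensor_lift ?r t) - U_mult (tensor_lift ?r t) (U_incl x)" for x t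
    by (rule qlinear_tensor_eqI[OF qlinear_compose[OF tm(1) R]
          qlinear_minus[OF qlinear_compose[OF R um(1)] qlinear_compose[OF R um(2)]]])
      (simp add: qlinear_add[OF tm(2)] U.tensor_mult_tens qlinear_add[OF R] tensor_lift_tens[OF br]
        U.unit_left U_antipode_mult U_antipode_incl neg U.assoc)
  note eps = qlinear_compose[OF qlinear_U_counit qbilinearD(2)[OF qbilinear_functional(1)[OF qlinear_id]]]
  show "tensor_lift ?l (U_comult u) = U_counit u *\<^sub>Q U_one" for u
    by (rule qlinear_U_eqI[OF qlinear_compose[OF qlinear_U_comult L] eps])
      (simp_all add: U_comult_one tensor_lift_tens[OF bl] U_antipode_one U.unit_left U_counit_one
        scaleQ_one U_comult_mult U_comult_incl left U_counit_mult U_counit_incl)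
  show "tensor_lift ?r (U_comult u) = U_counit u *\<^sub>Q U_one" for u
    by (rule qlinear_U_eqI[OF qlinear_compose[OF qlinear_U_comult R] eps])
      (simp_all add: U_comult_one tensor_lift_tens[OF br] U_antipode_one U.unit_left U.unit_right
        U_counit_one scaleQ_one U_comult_mult U_comult_incl right U_counit_mult U_counit_incl
        qlinear_scale[OF um(1)] qlinear_scale[OF um(2)])
qed

theorem theorem5p2:
  shows "lie_algebra ck_bracket \<and>
    (\<exists>S. hopf_algebra H_mult H_one H_comult H_counit S \<and>
      cocommutative H_comult \<and>
      (\<exists>\<phi>. hopf_isomorphism H_mult H_one H_comult H_counit S
             U_mult U_one U_comult U_counit U_antipode \<phi>))"
proof (intro conjI exI)
  let ?S = "\<lambda>h. U_to_H (U_antipode (inv U_to_H h))"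
  show "lie_algebra ck_bracket" by (rule lie_algebra_ck_bracket)
  show "cocommutative H_comult" by (rule cocommutative_H_comult)
  show S: "hopf_algebra H_mult H_one H_comult H_counit ?S"
    by (rule hopf_algebra_transport[OF hopf_algebra_U H.rat_bialgebra_axioms qlinear_U_to_H qlinear_inv_U_to_H])
      (simp_all add: inv_U_to_H U_to_H_mult U_to_H_one H_comult_U_to_H H_counit_U_to_H)
  show "hopf_isomorphism H_mult H_one H_comult H_counit ?S
      U_mult U_one U_comult U_counit U_antipode (inv U_to_H)"
  proof (intro hopf_isomorphism.intro hopf_isomorphism_axioms.intro S hopf_algebra_U qlinear_inv_U_to_H)
    show "bij (inv U_to_H)" by (rule bij_imp_bij_inv[OF bij_U_to_H])
    fix x y
    show "inv U_to_H (H_mult x y) = U_mult (inv U_to_H x) (inv U_to_H y)"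
      by (rule injD[OF bij_is_inj[OF bij_U_to_H]]) (simp add: U_to_H_mult inv_U_to_H)
    show "inv U_to_H H_one = U_one" by (metis U_to_H_one inv_U_to_H(1))
    show "U_comult (inv U_to_H x) = tensor_map (inv U_to_H) (inv U_to_H) (H_comult x)"
      by (simp add: U_comult_inv inv_U_to_H)
    show "U_counit (inv U_to_H x) = H_counit x" by (simp add: inv_U_to_H flip: H_counit_U_to_H)
    show "U_antipode (inv U_to_H x) = inv U_to_H (U_to_H (U_antipode (inv U_to_H x)))"
      by (simp add: inv_U_to_H)
  qed
qed

end
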